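(* Let $\alpha\in\mathbb{R}$ with $-1<\alpha<1$. Then the functional $$I_\alpha(\mu)=\iint W_\alpha(z-w)\,d\mu(z)\,d\mu(w)+\int |z|^2\,d\mu(z),$$ defined on Borel probability measures $\mu$ on $\mathbb{C}$, has a unique minimiser, and this minimiser is the normalised characteristic function of the domain enclosed by the ellipse centred at $0$ with horizontal semi-axis $\sqrt{1-\alpha}$ and vertical semi-axis $\sqrt{1+\alpha}$; that is, it is the measure $$\frac{1}{|E|}\,\chi_{E}\,dA,\qquad E=\left\{x+iy\in\mathbb{C}:\ \frac{x^2}{1-\alpha}+\frac{y^2}{1+\alpha}\le 1\right\}.$$
   Context: Identify $\mathbb{C}$ with $\mathbb{R}^2$, $z=x+iy$. The interaction kernel is $$W_\alpha(z)=-\log|z|+\alpha\,\frac{x^2}{|z|^2},\qquad z=x+iy\neq 0,$$ with the convention $W_\alpha(0)=+\infty$. $dA$ denotes Lebesgue measure in the plane, $|E|$ the Lebesgue measure of $E$, and $\chi_E$ the characteristic function of $E$. The energy $I_\alpha$ takes values in $(-\infty,+\infty]$; since $W_\alpha(z-w)+\tfrac12(|z|^2+|w|^2)$ is bounded from below, $I_\alpha(\mu)$ is understood for every probability measure $\mu$ as $\iint\big(W_\alpha(z-w)+\tfrac12(|z|^2+|w|^2)\big)\,d\mu(z)\,d\mu(w)$, which coincides with the displayed formula whenever $\int|z|^2\,d\mu<\infty$. *)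

theory Defs
  imports "HOL-Probability.Probability"
begin

definition W_kernel :: "real \<Rightarrow> complex \<Rightarrow> ereal" where
  "W_kernel \<alpha> z =
     (if z = 0 then \<infinity> else ereal (- ln (cmod z) + \<alpha> * ((Re z)\<^sup>2 / (cmod z)\<^sup>2)))"

(* Lebesgue integral of an extended-real function as positive part minus negative part;
   e2ennreal truncates negative values to 0. The value is meaningful when one of the two
   parts is finite, in particular for functions bounded below on a probability space. *)
definition ereal_integral :: "'a measure \<Rightarrow> ('a \<Rightarrow> ereal) \<Rightarrow> ereal" where
  "ereal_integral M f =
     enn2ereal (\<integral>\<^sup>+ x. e2ennreal (f x) \<partial>M) - enn2ereal (\<integral>\<^sup>+ x. e2ennreal (- f x) \<partial>M)"

(* The confinement is split symmetrically and put under the double integral, so that the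
   integrand is bounded below and the energy is well defined for every probability measure;
   if the second moment is finite, this is the double integral of W_kernel plus the integral
   of the squared modulus. *)
definition energy :: "real \<Rightarrow> complex measure \<Rightarrow> ereal" where
  "energy \<alpha> \<mu> =
     ereal_integral (\<mu> \<Otimes>\<^sub>M \<mu>)
       (\<lambda>(z, w). W_kernel \<alpha> (z - w) + ereal (((cmod z)\<^sup>2 + (cmod w)\<^sup>2) / 2))"

definition borel_prob :: "complex measure \<Rightarrow> bool" where
  "borel_prob \<mu> \<longleftrightarrow> prob_space \<mu> \<and> sets \<mu> = sets borel"

definition ellipse_domain :: "real \<Rightarrow> complex set" where
  "ellipse_domain \<alpha> = {z. (Re z)\<^sup>2 / (1 - \<alpha>) + (Im z)\<^sup>2 / (1 + \<alpha>) \<le> 1}"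

end

theory Submission
  imports Defs "HOL-Real_Asymp.Real_Asymp"
begin

text \<open>
  Let R(phi)^2 = 1 - alpha cos(2 phi) and u = (cos phi, sin phi). Up to an additive constant,
  W_alpha(z) is the average of -ln |z . u| over phi in [0, pi] with density R(phi)^2 / pi, and |z|^2
  is the average of 2 (z . u)^2 / R(phi)^2 with the same density. Hence the energy of a measure is,
  up to a constant, the average over phi of the one-dimensional energy
  double integral of -ln |s - t| + s^2 + t^2 of the law of (z . u) / R(phi).
  That energy has the semicircle law on [-1, 1] as its only minimiser, and the uniform measure on
  the ellipse projects to the semicircle law for every phi with cos phi nonzero, because R(phi) is
  the half-width of the ellipse in direction u. Conversely, a minimiser has the same projections as the
  ellipse in almost every direction, and these determine it.

  In one dimension, uniqueness follows from positive definiteness of the logarithmic kernel, seen from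
  -ln |s| = integral over t > 0 of t / (s^2 + t^2) - t / (1 + t^2) and
  t / (s^2 + t^2) = integral over x > 0 of exp (- t x) cos (s x).
\<close>

section \<open>Logarithmic sine integrals\<close>

text \<open>Energies may be infinite, so the logarithm and its confinement are kept together in one
  nonnegative \<open>ennreal\<close> kernel, and Tonelli moves between plane and directions for
  every measure. Only one-dimensional laws of finite energy are split into real integrals, where
  energies can be subtracted.

  The weight comes from matching Fourier coefficients. In the expansion of ln |sin x| the
  coefficient of cos 2x is -1, so a weight 1 - \<alpha> cos(2 phi) adds to the average of -ln |z .
  u| exactly \<alpha> cos(2 arg z) / 2 = \<alpha> x^2 / |z|^2 - \<alpha> / 2, the anisotropic term
  up to a constant. The same weight must be the squared half-width of the ellipse, (1 - \<alpha>)
  cos^2 phi + (1 + \<alpha>) sin^2 phi, and this fixes the semi-axes. The assumption |\<alpha>| < 1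
  makes the weight positive, so almost every direction for the weighted law is almost every
  direction for Lebesgue measure.

  Because \<open>ln 0 = 0\<close>, the diagonal has to be given the value infinity by hand, and
  zeros are discarded before the logarithm of a product is split.\<close>

lemma continuous_on_x_ln_x: "continuous_on {0..} (\<lambda>x::real. x * ln x)"
proof -
  have "((\<lambda>x::real. x * ln x) \<longlongrightarrow> 0) (at_right 0)" by real_asymp
  then have "continuous (at 0 within {0..}) (\<lambda>x::real. x * ln x)"
    by (simp add: continuous_within at_within_Ici_at_right)
  moreover have "continuous (at x within {0..}) (\<lambda>x::real. x * ln x)" if "x > 0" for x
    using that by (intro continuous_intros) auto
  ultimately show ?thesis
    by (auto simp: continuous_on_eq_continuous_within le_less)
qed

text \<open>The convention \<open>ln 0 = 0\<close> agrees with the limit here, so the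
  antiderivatives below are continuous up to 0 and pi, and the fundamental theorem asks for
  derivatives in the interior only.\<close>

lemma continuous_on_sin_ln_sin: "continuous_on {0..pi} (\<lambda>x::real. sin x * ln (sin x))"
  by (rule continuous_on_compose2[OF continuous_on_x_ln_x]) (auto intro!: continuous_intros sin_ge_zero)

lemma has_integral_ln_sin_cos2: "((\<lambda>x. ln (sin x) * cos (2 * x)) has_integral - (pi / 2)) {0..pi}"
proof -
  \<comment> \<open>Integration by parts with sin x cos x as antiderivative of cos 2x: the factor
    cos x / sin x leaves cos^2 x, whose antiderivative is the bracket.\<close>
  let ?F = "\<lambda>x. sin x * ln (sin x) * cos x - (x / 2 + sin x * cos x / 2)"
  have "((\<lambda>x. ln (sin x) * cos (2 * x)) has_integral (?F pi - ?F 0)) {0..pi}"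
  proof (rule fundamental_theorem_of_calculus_interior)
    show "continuous_on {0..pi} ?F"
      by (intro continuous_on_diff continuous_on_mult[OF continuous_on_sin_ln_sin]; intro continuous_intros; simp)
    fix x assume x: "x \<in> {0<..<pi}"
    then have s: "sin x > 0" by (auto intro: sin_gt_zero)
    have e: "cos x * cos x = 1 - sin x * sin x"
      using sin_squared_eq[of x] by (simp add: power2_eq_square)
    have c2: "cos (2 * x) = 1 - 2 * sin x * sin x"
      using e by (simp add: cos_double power2_eq_square)
    have "(?F has_real_derivative (cos x * ln (sin x) + sin x * (cos x / sin x)) * cos x
         - sin x * ln (sin x) * sin x - (1 / 2 + (cos x * cos x - sin x * sin x) / 2)) (at x)"
      using s by (auto intro!: derivative_eq_intros simp: field_simps)
    also have "(cos x * ln (sin x) + sin x * (cos x / sin x)) * cos x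
         - sin x * ln (sin x) * sin x - (1 / 2 + (cos x * cos x - sin x * sin x) / 2)
         = ln (sin x) * cos (2 * x)"
      unfolding c2 using s by (simp add: field_simps) (use e in algebra)
    finally show "(?F has_vector_derivative ln (sin x) * cos (2 * x)) (at x)"
      by (simp add: has_real_derivative_iff_has_vector_derivative)
  qed simp
  then show ?thesis by simp
qed

lemma has_integral_ln_sin_cos4: "((\<lambda>x. ln (sin x) * cos (4 * x)) has_integral - (pi / 4)) {0..pi}"
proof -
  \<comment> \<open>The same with sin 4x / 4 = sin x cos x cos 2x; the remainder is cos^2 x cos 2x =
    1/4 + cos 2x / 2 + cos 4x / 4.\<close>
  let ?F = "\<lambda>x. sin x * ln (sin x) * (cos x * cos (2 * x)) - (x / 4 + sin (2 * x) / 4 + sin (4 * x) / 16)"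
  have "((\<lambda>x. ln (sin x) * cos (4 * x)) has_integral (?F pi - ?F 0)) {0..pi}"
  proof (rule fundamental_theorem_of_calculus_interior)
    show "continuous_on {0..pi} ?F"
      by (intro continuous_on_diff continuous_on_mult[OF continuous_on_sin_ln_sin]; intro continuous_intros; simp)
    fix x assume x: "x \<in> {0<..<pi}"
    then have s: "sin x > 0" by (auto intro: sin_gt_zero)
    define S where "S = sin x"
    define C where "C = cos x"
    have e: "C * C = 1 - S * S"
      using sin_squared_eq[of x] by (simp add: power2_eq_square S_def C_def)
    have c2: "cos (2 * x) = 1 - 2 * S * S" "sin (2 * x) = 2 * S * C"
      using e by (simp_all add: cos_double sin_double power2_eq_square S_def C_def)
    have "cos (4 * x) = cos (2 * (2 * x))" by simp
    then have c4: "cos (4 * x) = (1 - 2 * S * S)\<^sup>2 - (2 * S * C)\<^sup>2"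
      by (subst (asm) cos_double) (simp add: c2)
    have C2: "C ^ 2 = 1 - S ^ 2" using e by (simp add: power2_eq_square)
    have "(?F has_real_derivative (C * ln S + C) * (C * cos (2 * x)) +
       S * ln S * (- S * cos (2 * x) - C * (2 * sin (2 * x)))
        - (1 / 4 + cos (2 * x) / 2 + cos (4 * x) / 4)) (at x)"
      using s unfolding S_def C_def by (auto intro!: derivative_eq_intros simp: field_simps)
    also have "(C * ln S + C) * (C * cos (2 * x)) +
       S * ln S * (- S * cos (2 * x) - C * (2 * sin (2 * x)))
        - (1 / 4 + cos (2 * x) / 2 + cos (4 * x) / 4)
         = ln S * ((C^2 - S^2) * (1 - 2 * S\<^sup>2) - 4 * S^2 * C^2)
         + (C^2 * (1 - 2 * S\<^sup>2) - (1 / 4 + (1 - 2 * S\<^sup>2) / 2 + ((1 - 2 * S * S)\<^sup>2 - (2 * S * C)\<^sup>2) / 4))"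
      unfolding c4 unfolding c2 by (simp add: field_simps power2_eq_square)
    also have "\<dots> = ln S * cos (4 * x)"
      unfolding c4 power_mult_distrib C2 by (simp add: field_simps power2_eq_square)
    finally show "(?F has_vector_derivative ln (sin x) * cos (4 * x)) (at x)"
      by (simp add: has_real_derivative_iff_has_vector_derivative S_def)
  qed simp
  moreover have "sin (4 * pi) = 0" "sin (2*pi) = 0"
    using sin_npi[of 4] by simp_all
  ultimately show ?thesis by simp
qed

text \<open>The integrands of interest have period pi. Extending one period by 0 makes the affine
  substitution rules for \<open>lborel\<close> available.\<close>

definition on_period :: "(real \<Rightarrow> real) \<Rightarrow> real \<Rightarrow> real" where
  "on_period f x = indicator {0..pi} x * f x"

lemma ln_sin_nonpos: "0 \<le> x \<Longrightarrow> x \<le> pi \<Longrightarrow> ln (sin x) \<le> (0::real)"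
  using sin_ge_zero[of x] sin_le_one[of x] by (cases "sin x = 0") auto

text \<open>In ln sin x = ln sin x cos 2x + 2 sin^2 x ln sin x the first term has a known integral
  and the second is continuous. The constant sign then turns gauge integrability into Lebesgue
  integrability.\<close>

lemma integrable_on_period_ln_sin: "integrable lborel (on_period (\<lambda>x. ln (sin x)))"
proof -
  have 1: "((\<lambda>x. ln (sin x) * cos (2 * x)) integrable_on {0..pi})"
    using has_integral_ln_sin_cos2 by blast
  have 2: "(\<lambda>x. 2 * sin x * (sin x * ln (sin x))) integrable_on {0..pi}"
    by (intro integrable_continuous_interval continuous_on_mult[OF _ continuous_on_sin_ln_sin] continuous_intros)
  have "(\<lambda>x. ln (sin x)) integrable_on {0..pi}"
    using integrable_add[OF 1 2] unfolding cos_double_sin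
    by (rule integrable_eq) (simp add: power2_eq_square algebra_simps)
  then obtain I where I: "((\<lambda>x. - ln (sin x)) has_integral I) {0..pi}"
    using integrable_neg by blast
  have "integral\<^sup>N lborel (\<lambda>x. indicator {0..pi} x * - ln (sin x)) = I"
    by (rule nn_integral_has_integral_lebesgue[OF _ I]) (simp add: ln_sin_nonpos)
  moreover have nn: "0 \<le> indicator {0..pi} x * - ln (sin x)" for x :: real
    using ln_sin_nonpos[of x] by (auto simp: indicator_def)
  ultimately have "integrable lborel (\<lambda>x. indicator {0..pi} x * - ln (sin x))"
    by (intro integrableI_bounded) auto
  from integrable_minus[OF this] show ?thesis by (simp add: on_period_def[abs_def])
qed

lemma has_bochner_on_period:
  assumes "integrable lborel (on_period f)" "(f has_integral I) {0..pi}"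
  shows "has_bochner_integral lborel (on_period f) I"
proof -
  have s: "set_integrable lborel {0..pi} f"
    using assms(1) by (simp add: set_integrable_def on_period_def[abs_def])
  have "integral\<^sup>L lborel (on_period f) = integral {0..pi} f"
    using set_borel_integral_eq_integral(2)[OF s] by (simp add: set_lebesgue_integral_def on_period_def[abs_def])
  then show ?thesis using assms by (simp add: has_bochner_integral_iff integral_unique)
qed

lemma integrable_on_period_mult_bounded:
  assumes "integrable lborel (on_period f)" "g \<in> borel_measurable borel" "\<And>x. \<bar>g x\<bar> \<le> B"
  shows "integrable lborel (on_period (\<lambda>x. f x * g x))"
proof -
  have "integrable lborel (\<lambda>x. B * on_period f x)" using assms by simp
  then show ?thesis
  proof (rule Bochner_Integration.integrable_bound)
    have "(\<lambda>x. on_period f x * g x) \<in> borel_measurable lborel"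
      using assms by measurable
    then show "on_period (\<lambda>x. f x * g x) \<in> borel_measurable lborel"
      by (simp add: on_period_def[abs_def] mult.assoc)
    have "0 \<le> B" using assms(3)[of 0] by linarith
    then show "AE x in lborel. norm (on_period (\<lambda>x. f x * g x) x) \<le> norm (B * on_period f x)"
      using assms(3) by (auto simp: on_period_def abs_mult indicator_def mult.commute[of B] intro!: mult_left_mono)
  qed
qed

lemma has_bochner_on_period_reflect:
  assumes "has_bochner_integral lborel (on_period f) I"
  shows "has_bochner_integral lborel (on_period (\<lambda>x. f (pi - x))) I"
proof -
  have "has_bochner_integral lborel (\<lambda>x. on_period f (pi + (-1) * x)) (I /\<^sub>R \<bar>-1\<bar>)"
    using assms by (subst (asm) lborel_has_bochner_integral_real_affine_iff[of "-1" _ _ pi]) auto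
  then show ?thesis
    by (simp add: on_period_def[abs_def] indicator_def conj_commute)
qed

text \<open>After a cut at \<open>pi - \<theta>\<close> the left piece is translated onto
  [\<theta>, pi] and, by periodicity, the right piece onto (0, \<theta>]. Arbitrary shifts are
  reduced modulo pi.\<close>

lemma has_bochner_on_period_shift:
  assumes f: "has_bochner_integral lborel (on_period f) I" and per: "\<And>x. f (x + pi) = f x"
  shows "has_bochner_integral lborel (on_period (\<lambda>x. f (x - \<theta>))) I"
proof -
  have shift: "has_bochner_integral lborel (on_period (\<lambda>x. f (x - \<theta>))) I" if \<theta>: "0 \<le> \<theta>" "\<theta> \<le> pi" for \<theta>
  proof -
    let ?A = "\<lambda>x. indicator {0..pi - \<theta>} x * f x" and ?B = "\<lambda>x. indicator {pi - \<theta><..pi} x * f x"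
    have int: "integrable lborel (on_period f)" using f by (simp add: has_bochner_integral_iff)
    have "integrable lborel (\<lambda>x. indicator {0..pi - \<theta>} x *\<^sub>R on_period f x)"
      by (intro integrable_mult_indicator int) auto
    then have A: "integrable lborel ?A"
      by (rule Bochner_Integration.integrable_cong[THEN iffD1, rotated 2]) (use \<theta> in \<open>auto simp: on_period_def indicator_def\<close>)
    have "integrable lborel (\<lambda>x. indicator {pi - \<theta><..pi} x *\<^sub>R on_period f x)"
      by (intro integrable_mult_indicator int) auto
    then have B: "integrable lborel ?B"
      by (rule Bochner_Integration.integrable_cong[THEN iffD1, rotated 2]) (use \<theta> in \<open>auto simp: on_period_def indicator_def\<close>)
    have "I = integral\<^sup>L lborel (\<lambda>x. ?A x + ?B x)"
      using f unfolding has_bochner_integral_iff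
      by (auto intro!: Bochner_Integration.integral_cong simp: on_period_def indicator_def split: if_splits) (use \<theta> in auto)
    then have I: "I = integral\<^sup>L lborel ?A + integral\<^sup>L lborel ?B" using A B by simp
    have "has_bochner_integral lborel (\<lambda>x. ?A (- \<theta> + 1 * x)) (integral\<^sup>L lborel ?A /\<^sub>R \<bar>1\<bar>)"
      using A by (subst lborel_has_bochner_integral_real_affine_iff[of 1, symmetric]) (auto simp: has_bochner_integral_iff)
    moreover have "has_bochner_integral lborel (\<lambda>x. ?B ((pi - \<theta>) + 1 * x)) (integral\<^sup>L lborel ?B /\<^sub>R \<bar>1\<bar>)"
      using B by (subst lborel_has_bochner_integral_real_affine_iff[of 1, symmetric]) (auto simp: has_bochner_integral_iff)
    ultimately have H: "has_bochner_integral lborel (\<lambda>x. ?A (- \<theta> + 1 * x) + ?B ((pi - \<theta>) + 1 * x)) I"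
      unfolding I by (auto intro: has_bochner_integral_add)
    have eq: "?A (- \<theta> + 1 * x) + ?B ((pi - \<theta>) + 1 * x) = on_period (\<lambda>x. f (x - \<theta>)) x" if "x \<noteq> 0" "x \<noteq> \<theta>" for x
      using that \<theta> per[of "x - \<theta>"] by (auto simp: on_period_def indicator_def add.commute add_diff_eq diff_add_eq)
    have AE: "AE x in lborel. ?A (- \<theta> + 1 * x) + ?B ((pi - \<theta>) + 1 * x) = on_period (\<lambda>x. f (x - \<theta>)) x"
      using AE_lborel_singleton[of 0] AE_lborel_singleton[of \<theta>] by eventually_elim (rule eq)
    \<comment> \<open>Only \<open>on_period f\<close> is known to be measurable. The shifted
      function inherits this from the translated pieces, since it differs from their sum at most at
      two points.\<close>
    have "on_period (\<lambda>x. f (x - \<theta>)) = (\<lambda>x. if x = 0 \<or> x = \<theta> then on_period (\<lambda>x. f (x - \<theta>)) x else ?A (- \<theta> + 1 * x) + ?B ((pi - \<theta>) + 1 * x))"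
      using eq by auto
    moreover have "\<dots> \<in> borel_measurable borel"
    proof -
      have m: "(\<lambda>x. ?A (- \<theta> + 1 * x) + ?B ((pi - \<theta>) + 1 * x)) \<in> borel_measurable borel"
        using H by (auto simp: has_bochner_integral_iff)
      show ?thesis
        by (rule measurable_discrete_difference[OF m, where X="{0, \<theta>}"]) auto
    qed
    ultimately have "on_period (\<lambda>x. f (x - \<theta>)) \<in> borel_measurable borel" by simp
    then show ?thesis
      by (intro has_bochner_integralI_AE[OF H _ AE]) simp
  qed
  define n where "n = \<lfloor>\<theta> / pi\<rfloor>"
  have peri: "f (x + real k * pi) = f x" for x k
  proof (induction k)
    case (Suc k)
    then show ?case using per[of "x + real k * pi"] by (simp add: algebra_simps)
  qed simp
  have "f (x + of_int m * pi) = f x" for x m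
    by (cases m rule: int_cases2) (use peri[of x "nat m"] peri[of "x + of_int m * pi" "nat (- m)"] in auto)
  from this[of _ n] have e: "f (x - (\<theta> - of_int n * pi)) = f (x - \<theta>)" for x
    by (metis diff_diff_eq2 add.commute add_diff_eq)
  have "of_int n \<le> \<theta> / pi" "\<theta> / pi \<le> of_int n + 1"
    unfolding n_def by linarith+
  then have "0 \<le> \<theta> - of_int n * pi" "\<theta> - of_int n * pi \<le> pi"
    by (auto simp: field_simps)
  from shift[OF this] show ?thesis by (simp add: e)
qed

section \<open>The law of a random direction\<close>

text \<open>One family serves two purposes: \<open>angle_law 1 \<alpha>\<close> averages over
  directions, \<open>angle_law 2 1\<close> parametrises the semicircle law.\<close>

definition angle_law :: "nat \<Rightarrow> real \<Rightarrow> real measure" where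
  "angle_law k \<beta> = density lborel (\<lambda>x. ennreal (on_period (\<lambda>x. (1 - \<beta> * cos (2 * real k * x)) / pi) x))"

text \<open>This number is -ln 2. It stays symbolic because it enters only the additive constants
  \<open>log_pot\<close> and \<open>energy_shift\<close>.\<close>

definition mean_ln_sin :: real where
  "mean_ln_sin = integral\<^sup>L lborel (on_period (\<lambda>x. ln (sin x))) / pi"

lemma sets_angle_law [measurable_cong, simp]: "sets (angle_law k \<beta>) = sets borel"
  by (simp add: angle_law_def)

lemma space_angle_law [simp]: "space (angle_law k \<beta>) = UNIV"
  by (simp add: angle_law_def)

lemma angle_density_nonneg: "\<bar>\<beta>\<bar> \<le> 1 \<Longrightarrow> 0 \<le> on_period (\<lambda>x. (1 - \<beta> * cos (2 * real k * x)) / pi) x"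
proof -
  assume "\<bar>\<beta>\<bar> \<le> 1"
  then have "\<bar>\<beta> * cos (2 * real k * x)\<bar> \<le> 1 * 1"
    unfolding abs_mult by (intro mult_mono) auto
  then show ?thesis by (auto simp: on_period_def indicator_def)
qed

lemma borel_measurable_on_period [measurable]:
  "f \<in> borel_measurable borel \<Longrightarrow> on_period f \<in> borel_measurable borel"
  unfolding on_period_def[abs_def] by measurable

lemma has_bochner_angle_law:
  assumes "\<bar>\<beta>\<bar> \<le> 1" and f: "f \<in> borel_measurable borel"
    and "has_bochner_integral lborel (on_period (\<lambda>x. f x * (1 - \<beta> * cos (2 * real k * x)))) I"
  shows "has_bochner_integral (angle_law k \<beta>) f (I / pi)"
proof -
  have "has_bochner_integral lborel (\<lambda>x. on_period (\<lambda>x. f x * (1 - \<beta> * cos (2 * real k * x))) x / pi) (I / pi)"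
    using assms(3) by (rule has_bochner_integral_divide_zero)
  then have "has_bochner_integral lborel (\<lambda>x. on_period (\<lambda>x. (1 - \<beta> * cos (2 * real k * x)) / pi) x *\<^sub>R f x) (I / pi)"
    by (rule has_bochner_integral_cong[THEN iffD1, rotated 3]) (auto simp: on_period_def)
  then show ?thesis
    unfolding angle_law_def using f
    by (intro has_bochner_integral_density) (auto intro!: angle_density_nonneg assms)
qed

lemma has_bochner_on_period_cos:
  assumes "k > 0" shows "has_bochner_integral lborel (on_period (\<lambda>x. cos (2 * real k * x))) 0"
proof -
  have "has_bochner_integral lborel (\<lambda>x. cos (2 * real k * x) * indicator {0..pi} x)
      (sin (2 * real k * pi) / (2 * real k) - sin (2 * real k * 0) / (2 * real k))"
    using assms by (intro has_bochner_integral_FTC_Icc_real) (auto intro!: derivative_eq_intros)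
  then show ?thesis
    using sin_npi[of "2 * k"] by (simp add: on_period_def[abs_def] mult.commute)
qed

lemma has_bochner_on_period_const: "has_bochner_integral lborel (on_period (\<lambda>x. c)) (c * pi)"
proof -
  have "has_bochner_integral lborel (indicator {0..pi}) (measure lborel {0..pi} :: real)"
    by (intro has_bochner_integral_real_indicator) auto
  then have "has_bochner_integral lborel (\<lambda>x. c * indicator {0..pi} x) (c * pi)"
    by (intro has_bochner_integral_mult_right) simp
  then show ?thesis by (simp add: on_period_def[abs_def] mult.commute)
qed

lemma prob_space_angle_law:
  assumes "\<bar>\<beta>\<bar> \<le> 1" "k > 0" shows "prob_space (angle_law k \<beta>)"
proof
  have "has_bochner_integral lborel (\<lambda>x. (on_period (\<lambda>x. 1) x - \<beta> * on_period (\<lambda>x. cos (2 * real k * x)) x) / pi) ((1 * pi - \<beta> * 0) / pi)"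
    using assms by (intro has_bochner_integral_divide_zero has_bochner_integral_diff has_bochner_integral_mult_right
       has_bochner_on_period_const has_bochner_on_period_cos)
  then have "has_bochner_integral lborel (on_period (\<lambda>x. (1 - \<beta> * cos (2 * real k * x)) / pi)) 1"
    by (rule has_bochner_integral_cong[THEN iffD1, rotated 3]) (auto simp: on_period_def indicator_def)
  then have "(\<integral>\<^sup>+ x. ennreal (on_period (\<lambda>x. (1 - \<beta> * cos (2 * real k * x)) / pi) x) \<partial>lborel) = ennreal 1"
    using angle_density_nonneg[OF assms(1), of k] by (subst nn_integral_eq_integral) (auto simp: has_bochner_integral_iff)
  then show "emeasure (angle_law k \<beta>) (space (angle_law k \<beta>)) = 1"
    by (simp add: angle_law_def emeasure_density)
qed

lemma has_bochner_ln_sin_cos: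
  assumes "k = 1 \<or> k = 2"
  shows "has_bochner_integral lborel (on_period (\<lambda>x. ln (sin x) * cos (2 * real k * x))) (- (pi / (2 * real k)))"
  using assms
proof (intro has_bochner_on_period integrable_on_period_mult_bounded[where B=1] integrable_on_period_ln_sin)
  show "((\<lambda>x. ln (sin x) * cos (2 * real k * x)) has_integral - (pi / (2 * real k))) {0..pi}"
    using assms has_integral_ln_sin_cos2 has_integral_ln_sin_cos4 by auto
qed auto

text \<open>The reflection x -> pi - x fixes ln sin x and changes the sign of sin(2 k x).\<close>

lemma has_bochner_ln_sin_sin:
  "has_bochner_integral lborel (on_period (\<lambda>x. ln (sin x) * sin (2 * real k * x))) 0"
proof -
  let ?f = "\<lambda>x. ln (sin x) * sin (2 * real k * x)"
  have "integrable lborel (on_period ?f)"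
    by (rule integrable_on_period_mult_bounded[where B=1]) (auto intro: integrable_on_period_ln_sin)
  then obtain I where I: "has_bochner_integral lborel (on_period ?f) I"
    by (auto simp: has_bochner_integral_iff)
  have "sin (2 * real k * (pi - x)) = - sin (2 * real k * x)" for x
    using sin_npi[of "2 * k"] cos_npi[of "2 * k"] by (simp add: right_diff_distrib sin_diff)
  then have "has_bochner_integral lborel (on_period (\<lambda>x. - ?f x)) I"
    using has_bochner_on_period_reflect[OF I] by simp
  moreover have "has_bochner_integral lborel (on_period (\<lambda>x. - ?f x)) (- I)"
    using has_bochner_integral_minus[OF I] by (simp add: on_period_def[abs_def])
  ultimately have "I = - I" by (rule has_bochner_integral_eq)
  with I show ?thesis by simp
qed

text \<open>Translation moves \<theta> from the logarithm to the density, where the addition theorem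
  isolates a single Fourier coefficient of ln sin. For \<open>k = 1\<close> the resulting cosine
  becomes the anisotropic term of W, for \<open>k = 2\<close> the quadratic potential of the
  semicircle law.\<close>

lemma has_bochner_angle_law_ln_sin:
  assumes \<beta>: "\<bar>\<beta>\<bar> \<le> 1" and k: "k = 1 \<or> k = 2"
  shows "has_bochner_integral (angle_law k \<beta>) (\<lambda>x. ln \<bar>sin (x - \<theta>)\<bar>) (mean_ln_sin + \<beta> * cos (2 * real k * \<theta>) / (2 * real k))"
proof -
  let ?c = "cos (2 * real k * \<theta>)" and ?s = "sin (2 * real k * \<theta>)"
  let ?g = "\<lambda>x. ln \<bar>sin x\<bar> * (1 - \<beta> * cos (2 * real k * (x + \<theta>)))"
  let ?I = "pi * mean_ln_sin - \<beta> * (?c * (- (pi / (2 * real k))) - ?s * 0)"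
  have "has_bochner_integral lborel (on_period (\<lambda>x. ln (sin x))) (pi * mean_ln_sin)"
    using integrable_on_period_ln_sin by (auto simp: mean_ln_sin_def has_bochner_integral_iff)
  then have "has_bochner_integral lborel (\<lambda>x. on_period (\<lambda>x. ln (sin x)) x - \<beta> * (?c * on_period (\<lambda>x. ln (sin x) * cos (2 * real k * x)) x
       - ?s * on_period (\<lambda>x. ln (sin x) * sin (2 * real k * x)) x)) ?I"
    using k by (intro has_bochner_integral_diff has_bochner_integral_mult_right has_bochner_ln_sin_cos has_bochner_ln_sin_sin)
  then have "has_bochner_integral lborel (on_period ?g) ?I"
    by (rule has_bochner_integral_cong[THEN iffD1, rotated 3])
       (auto simp: on_period_def indicator_def sin_ge_zero distrib_left cos_add algebra_simps)
  moreover have "?g (x + pi) = ?g x" for x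
  proof -
    have "2 * real k * (x + pi + \<theta>) = 2 * real k * (x + \<theta>) + real (2 * k) * pi"
      by (simp add: algebra_simps)
    then have "cos (2 * real k * (x + pi + \<theta>)) = cos (2 * real k * (x + \<theta>))"
      using sin_npi[of "2 * k"] cos_npi[of "2 * k"] by (simp only: cos_add) simp
    then show ?thesis by simp
  qed
  ultimately have "has_bochner_integral lborel (on_period (\<lambda>x. ?g (x - \<theta>))) ?I"
    by (rule has_bochner_on_period_shift)
  then have "has_bochner_integral (angle_law k \<beta>) (\<lambda>x. ln \<bar>sin (x - \<theta>)\<bar>) (?I / pi)"
    by (intro has_bochner_angle_law \<beta>) auto
  moreover have "?I / pi = mean_ln_sin + \<beta> * cos (2 * real k * \<theta>) / (2 * real k)"
    by (simp add: field_simps)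
  ultimately show ?thesis by simp
qed

section \<open>The semicircle law and its logarithmic potential\<close>

text \<open>The density of angle_law 2 1 is 2 sin^2(2x) / pi on [0, pi], so its image under cos(2x) is the
  semicircle law with density (2 / pi) sqrt(1 - t^2). This choice lets one integral,
  has_bochner_angle_law_ln_sin, serve both the semicircle potential and the angular average of W.\<close>

definition semicircle :: "real measure" where
  "semicircle = distr (angle_law 2 1) borel (\<lambda>x. cos (2 * x))"

lemma sets_semicircle [measurable_cong, simp]: "sets semicircle = sets borel"
  by (simp add: semicircle_def)

lemma space_semicircle [simp]: "space semicircle = UNIV"
  by (simp add: semicircle_def)

lemma prob_space_semicircle: "prob_space semicircle"
  unfolding semicircle_def
  by (intro prob_space.prob_space_distr prob_space_angle_law) auto

lemma AE_angle_lawI: "AE x in lborel. P x \<Longrightarrow> AE x in angle_law k \<beta>. P x"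
  unfolding angle_law_def by (subst AE_density) auto

lemma AE_sin_nonzero:
  fixes a b :: real
  assumes "a \<noteq> 0" shows "AE x in lborel. sin (a * x + b) \<noteq> 0"
proof -
  have "{x. sin (a * x + b) = 0} \<subseteq> range (\<lambda>i::int. (of_int i * pi - b) / a)"
  proof
    fix x assume "x \<in> {x. sin (a * x + b) = 0}"
    then obtain i :: int where "a * x + b = of_int i * pi" by (auto simp: sin_zero_iff_int2)
    then have "x = (of_int i * pi - b) / a" using assms by (simp add: field_simps)
    then show "x \<in> range (\<lambda>i::int. (of_int i * pi - b) / a)" by blast
  qed
  then have "countable {x. sin (a * x + b) = 0}"
    by (rule countable_subset) auto
  then have "{x. sin (a * x + b) = 0} \<in> null_sets lborel"
    by (rule countable_imp_null_set_lborel)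
  then show ?thesis by (rule AE_I') auto
qed

lemma AE_semicircle_iff: "Measurable.pred borel P \<Longrightarrow> (AE t in semicircle. P t) \<longleftrightarrow> (AE x in angle_law 2 1. P (cos (2 * x)))"
  unfolding semicircle_def by (subst AE_distr_iff) auto

lemma AE_semicircle_bounded: "AE t in semicircle. \<bar>t\<bar> \<le> 1"
  by (subst AE_semicircle_iff) auto

lemma has_bochner_semicircle:
  fixes f :: "real \<Rightarrow> real"
  assumes f: "f \<in> borel_measurable borel" and "has_bochner_integral (angle_law 2 1) (\<lambda>x. f (cos (2 * x))) I"
  shows "has_bochner_integral semicircle f I"
proof -
  have m: "(\<lambda>x::real. cos (2 * x)) \<in> angle_law 2 1 \<rightarrow>\<^sub>M borel" by measurable
  show ?thesis using assms unfolding semicircle_def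
    by (simp add: has_bochner_integral_iff integral_distr[OF m f] integrable_distr_eq[OF m f])
qed

text \<open>With s = cos \<theta> and t = cos 2x this factorisation splits ln |s - t| into ln 2 and
  two translates of ln |sin x|.\<close>

lemma cos_diff_cos_double:
  fixes \<theta> x :: real shows "cos \<theta> - cos (2 * x) = 2 * sin (x - \<theta> / 2) * sin (x - (- \<theta> / 2))"
proof -
  have "cos \<theta> - cos (2 * x) = 2 * sin ((\<theta> + 2 * x) / 2) * sin ((2 * x - \<theta>) / 2)"
    by (rule cos_diff_cos)
  moreover have "(\<theta> + 2 * x) / 2 = x - (- \<theta> / 2)" "(2 * x - \<theta>) / 2 = x - \<theta> / 2"
    by (auto simp: field_simps)
  ultimately show ?thesis by simp
qed

lemma AE_semicircle_neq: "AE t in semicircle. t \<noteq> s"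
proof (cases "\<bar>s\<bar> \<le> 1")
  case True
  define \<theta> where "\<theta> = arccos s"
  have s: "s = cos \<theta>" using True by (simp add: \<theta>_def)
  have "AE x in lborel. sin (1 * x + (- \<theta> / 2)) \<noteq> 0" "AE x in lborel. sin (1 * x + \<theta> / 2) \<noteq> 0"
    by (intro AE_sin_nonzero; simp)+
  then have "AE x in lborel. cos (2 * x) \<noteq> s"
  proof eventually_elim
    case (elim x)
    then show ?case using cos_diff_cos_double[of \<theta> x] by (auto simp: s)
  qed
  then show ?thesis by (subst AE_semicircle_iff) (auto intro: AE_angle_lawI)
next
  case False
  then show ?thesis using AE_semicircle_bounded by (auto elim!: eventually_mono)
qed

text \<open>The logarithmic potential of the semicircle law at 0. The two translates contribute
  cos(2 \<theta>) / 2 = s^2 - 1/2 for s = cos \<theta>, which is the origin of the -1/2.\<close>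

definition log_pot :: real where "log_pot = ln 2 + 2 * mean_ln_sin - 1 / 2"

lemma has_bochner_semicircle_ln:
  assumes "\<bar>s\<bar> \<le> 1"
  shows "has_bochner_integral semicircle (\<lambda>t. ln \<bar>s - t\<bar>) (s\<^sup>2 + log_pot)"
proof (rule has_bochner_semicircle)
  define \<theta> where "\<theta> = arccos s"
  have s: "s = cos \<theta>" using assms by (simp add: \<theta>_def)
  interpret prob_space "angle_law 2 1" by (rule prob_space_angle_law) auto
  have H: "has_bochner_integral (angle_law 2 1) (\<lambda>x. ln \<bar>sin (x - \<phi>)\<bar>) (mean_ln_sin + cos (4 * \<phi>) / 4)" for \<phi>
    using has_bochner_angle_law_ln_sin[of 1 2 \<phi>] by simp
  have c: "has_bochner_integral (angle_law 2 1) (\<lambda>x. ln 2 :: real) (ln 2)"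
    using prob_space by (simp add: has_bochner_integral_iff)
  have A: "has_bochner_integral (angle_law 2 1) (\<lambda>x. ln 2 + (ln \<bar>sin (x - \<theta> / 2)\<bar> + ln \<bar>sin (x - (- \<theta> / 2))\<bar>))
     (ln 2 + ((mean_ln_sin + cos (4 * (\<theta> / 2)) / 4) + (mean_ln_sin + cos (4 * (- \<theta> / 2)) / 4)))"
    by (intro has_bochner_integral_add H c)
  have B: "ln 2 + ((mean_ln_sin + cos (4 * (\<theta> / 2)) / 4) + (mean_ln_sin + cos (4 * (- \<theta> / 2)) / 4)) = s\<^sup>2 + log_pot"
    unfolding log_pot_def s by (simp add: cos_double_cos[of \<theta>])
  \<comment> \<open>The zeros of the sines are discarded because the logarithm of a product splits
    only for nonzero factors.\<close>
  have C: "AE x in angle_law 2 1. ln 2 + (ln \<bar>sin (x - \<theta> / 2)\<bar> + ln \<bar>sin (x - (- \<theta> / 2))\<bar>) = ln \<bar>s - cos (2 * x)\<bar>"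
  proof -
    have "AE x in lborel. sin (1 * x + (- \<theta> / 2)) \<noteq> 0" "AE x in lborel. sin (1 * x + \<theta> / 2) \<noteq> 0"
      by (intro AE_sin_nonzero; simp)+
    then have "AE x in lborel. ln 2 + (ln \<bar>sin (x - \<theta> / 2)\<bar> + ln \<bar>sin (x - (- \<theta> / 2))\<bar>) = ln \<bar>s - cos (2 * x)\<bar>"
    proof eventually_elim
      case (elim x)
      then show ?case unfolding s cos_diff_cos_double by (simp add: abs_mult ln_mult)
    qed
    then show ?thesis by (rule AE_angle_lawI)
  qed
  show "has_bochner_integral (angle_law 2 1) (\<lambda>x. ln \<bar>s - cos (2 * x)\<bar>) (s\<^sup>2 + log_pot)"
    using A unfolding B by (rule has_bochner_integralI_AE[OF _ _ C]) simp
qed simp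

text \<open>With c = cos 2x the angular density is a multiple of 1 - c^2 = (1 - e c)(1 + e c). The
  first factor cancels the pole at the end point e and leaves a trigonometric polynomial.\<close>

lemma has_bochner_semicircle_inverse:
  assumes e: "e = 1 \<or> e = - 1"
  shows "has_bochner_integral semicircle (\<lambda>t. 1 / (1 - e * t)) 2"
proof (rule has_bochner_semicircle)
  let ?g = "\<lambda>x. 1 / (1 - e * cos (2 * x)) * (1 - 1 * cos (2 * real 2 * x))"
  have 1: "has_bochner_integral lborel (on_period (\<lambda>x. 2)) (2 * pi)"
    by (rule has_bochner_on_period_const)
  have 2: "has_bochner_integral lborel (on_period (\<lambda>x. cos (2 * real 1 * x))) 0"
    by (rule has_bochner_on_period_cos) simp
  have A: "has_bochner_integral lborel (\<lambda>x. on_period (\<lambda>x. 2) x + 2 * e * on_period (\<lambda>x. cos (2 * real 1 * x)) x) (2 * pi + 2 * e * 0)"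
    by (intro has_bochner_integral_add has_bochner_integral_mult_right 1 2)
  have B: "AE x in lborel. on_period (\<lambda>x. 2) x + 2 * e * on_period (\<lambda>x. cos (2 * real 1 * x)) x = on_period ?g x"
  proof -
    have "AE x::real in lborel. sin (2 * x + 0) \<noteq> 0" by (rule AE_sin_nonzero) simp
    then show ?thesis
    proof eventually_elim
      case (elim x)
      define c where "c = cos (2 * x)"
      have c4: "cos (4 * x) = 2 * c\<^sup>2 - 1"
        using cos_double_cos[of "2 * x"] by (simp add: c_def)
      have c1: "c\<^sup>2 \<noteq> 1" using elim sin_squared_eq[of "2 * x"] by (auto simp: c_def)
      have n: "1 - e * c \<noteq> 0" using e c1 by (auto simp: power2_eq_square)
      have "e\<^sup>2 = 1" using e by auto
      then have "1 - (2 * c\<^sup>2 - 1) = (1 - e * c) * (2 + 2 * e * c)"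
        by (simp add: algebra_simps flip: power2_eq_square)
      then have "1 / (1 - e * c) * (1 - (2 * c\<^sup>2 - 1)) = 2 + 2 * e * c"
        using n by simp
      then show ?case by (simp add: on_period_def c4 c_def[symmetric] indicator_def)
    qed
  qed
  have "has_bochner_integral lborel (on_period ?g) (2 * pi + 2 * e * 0)"
    by (rule has_bochner_integralI_AE[OF A _ B]) simp
  then have "has_bochner_integral lborel (on_period ?g) (2 * pi)" by simp
  then have "has_bochner_integral (angle_law 2 1) (\<lambda>x. 1 / (1 - e * cos (2 * x))) (2 * pi / pi)"
    by (intro has_bochner_angle_law) auto
  then show "has_bochner_integral (angle_law 2 1) (\<lambda>x. 1 / (1 - e * cos (2 * x))) 2" by simp
qed simp

text \<open>With e = sgn s, the bound ln x <= x - 1 gives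
  ln (|s| - e t) - ln (1 - e t) <= (|s| - 1) / (1 - e t); the right side integrates to 2 (|s| - 1),
  which is at most s^2 - 1. So the potential outside is controlled without being computed.\<close>

lemma semicircle_ln_outside:
  assumes s: "1 < \<bar>s\<bar>"
  shows "integrable semicircle (\<lambda>t. ln \<bar>s - t\<bar>)"
    and "1 + log_pot \<le> (\<integral>t. ln \<bar>s - t\<bar> \<partial>semicircle)"
    and "(\<integral>t. ln \<bar>s - t\<bar> \<partial>semicircle) \<le> s\<^sup>2 + log_pot"
proof -
  interpret prob_space semicircle by (rule prob_space_semicircle)
  define e where "e = sgn s"
  have e: "e = 1 \<or> e = - 1" using s by (auto simp: e_def sgn_if)
  have es: "s = e * \<bar>s\<bar>" by (simp add: e_def sgn_mult_abs)
  have L: "has_bochner_integral semicircle (\<lambda>t. ln \<bar>e - t\<bar>) (1 + log_pot)"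
    using has_bochner_semicircle_ln[of e] e by auto
  have J: "has_bochner_integral semicircle (\<lambda>t. 1 / (1 - e * t)) 2"
    by (rule has_bochner_semicircle_inverse[OF e])
  have bd: "AE t in semicircle. ln \<bar>e - t\<bar> \<le> ln \<bar>s - t\<bar> \<and> ln \<bar>s - t\<bar> \<le> ln \<bar>e - t\<bar> + (\<bar>s\<bar> - 1) * (1 / (1 - e * t))"
    using AE_semicircle_bounded AE_semicircle_neq[of e]
  proof eventually_elim
    case (elim t)
    have p: "1 - e * t > 0" using elim e by auto
    have 1: "\<bar>e - t\<bar> = 1 - e * t" using e p by auto
    have 2: "\<bar>s - t\<bar> = \<bar>s\<bar> - e * t" using e p s es by auto
    have "ln (\<bar>s\<bar> - e * t) - ln (1 - e * t) = ln ((\<bar>s\<bar> - e * t) / (1 - e * t))"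
      using p s by (subst ln_div) auto
    also have "\<dots> \<le> (\<bar>s\<bar> - e * t) / (1 - e * t) - 1"
      using p s by (intro ln_le_minus_one) auto
    also have "\<dots> = (\<bar>s\<bar> - 1) * (1 / (1 - e * t))"
      using p by (simp add: field_simps)
    finally show ?case unfolding 1 2 using p s by auto
  qed
  show int: "integrable semicircle (\<lambda>t. ln \<bar>s - t\<bar>)"
  proof (rule Bochner_Integration.integrable_bound)
    show "integrable semicircle (\<lambda>t. \<bar>ln \<bar>e - t\<bar>\<bar> + \<bar>(\<bar>s\<bar> - 1) * (1 / (1 - e * t))\<bar>)"
      using L J by (intro Bochner_Integration.integrable_add integrable_abs integrable_mult_right) (auto simp: has_bochner_integral_iff)
    show "AE t in semicircle. norm (ln \<bar>s - t\<bar>) \<le> norm (\<bar>ln \<bar>e - t\<bar>\<bar> + \<bar>(\<bar>s\<bar> - 1) * (1 / (1 - e * t))\<bar>)"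
      using bd
    proof eventually_elim
      case (elim t)
      have "\<bar>y\<bar> \<le> \<bar>\<bar>x\<bar> + \<bar>z\<bar>\<bar>" if "x \<le> y \<and> y \<le> x + z" for x y z :: real
      proof -
        have "\<bar>y\<bar> \<le> \<bar>x\<bar> + \<bar>z\<bar>"
          using that abs_ge_self[of x] abs_ge_minus_self[of x] abs_ge_self[of z] abs_ge_zero[of z]
          by (intro abs_leI) (auto simp del: abs_ge_zero)
        then show ?thesis by simp
      qed
      from this[OF elim] show ?case by (simp only: real_norm_def)
    qed
  qed simp
  show "1 + log_pot \<le> (\<integral>t. ln \<bar>s - t\<bar> \<partial>semicircle)"
    using L bd int integral_mono_AE[of semicircle "\<lambda>t. ln \<bar>e - t\<bar>" "\<lambda>t. ln \<bar>s - t\<bar>"]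
    by (auto simp: has_bochner_integral_iff elim: eventually_mono)
  have U: "has_bochner_integral semicircle (\<lambda>t. ln \<bar>e - t\<bar> + (\<bar>s\<bar> - 1) * (1 / (1 - e * t))) (1 + log_pot + (\<bar>s\<bar> - 1) * 2)"
    by (intro has_bochner_integral_add has_bochner_integral_mult_right L J)
  have "(\<integral>t. ln \<bar>s - t\<bar> \<partial>semicircle) \<le> 1 + log_pot + (\<bar>s\<bar> - 1) * 2"
    using U bd int integral_mono_AE[of semicircle "\<lambda>t. ln \<bar>s - t\<bar>" "\<lambda>t. ln \<bar>e - t\<bar> + (\<bar>s\<bar> - 1) * (1 / (1 - e * t))"]
    unfolding has_bochner_integral_iff by (auto elim: eventually_mono)
  also have "\<dots> \<le> s\<^sup>2 + log_pot"
    using sum_power2_ge_zero[of "\<bar>s\<bar> - 1" 0] by (simp add: power2_eq_square algebra_simps)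
  finally show "(\<integral>t. ln \<bar>s - t\<bar> \<partial>semicircle) \<le> s\<^sup>2 + log_pot" .
qed

text \<open>The upper bound is the Euler--Lagrange inequality on the whole line. The lower bound
  serves to make the mutual energy of the semicircle law with any law of finite second moment
  converge.\<close>

lemma semicircle_ln:
  shows integrable_semicircle_ln: "integrable semicircle (\<lambda>t. ln \<bar>s - t\<bar>)"
    and semicircle_ln_lower: "log_pot \<le> (\<integral>t. ln \<bar>s - t\<bar> \<partial>semicircle)"
    and semicircle_ln_upper: "(\<integral>t. ln \<bar>s - t\<bar> \<partial>semicircle) \<le> s\<^sup>2 + log_pot"
proof -
  have "integrable semicircle (\<lambda>t. ln \<bar>s - t\<bar>) \<and> log_pot \<le> (\<integral>t. ln \<bar>s - t\<bar> \<partial>semicircle)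
     \<and> (\<integral>t. ln \<bar>s - t\<bar> \<partial>semicircle) \<le> s\<^sup>2 + log_pot"
  proof (cases "\<bar>s\<bar> \<le> 1")
    case True
    from has_bochner_semicircle_ln[OF this] show ?thesis
      unfolding has_bochner_integral_iff by simp
  next
    case False
    then have "1 < \<bar>s\<bar>" by simp
    from semicircle_ln_outside[OF this] show ?thesis by simp
  qed
  then show "integrable semicircle (\<lambda>t. ln \<bar>s - t\<bar>)" "log_pot \<le> (\<integral>t. ln \<bar>s - t\<bar> \<partial>semicircle)"
     "(\<integral>t. ln \<bar>s - t\<bar> \<partial>semicircle) \<le> s\<^sup>2 + log_pot" by blast+
qed

section \<open>Positive definiteness of the logarithmic kernel\<close>

text \<open>The integrand has constant sign in t (that of 1 - d^2), so integrability of ln |s - t|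
  already justifies exchanging the order of integration.\<close>

lemma has_bochner_neg_ln:
  fixes d :: real
  assumes d: "d \<noteq> 0"
  defines "f \<equiv> \<lambda>t. indicator {0..} t * (t / (d\<^sup>2 + t\<^sup>2) - t / (1 + t\<^sup>2))"
  shows "has_bochner_integral lborel f (- ln \<bar>d\<bar>)"
    and "(\<integral>\<^sup>+ t. ennreal \<bar>f t\<bar> \<partial>lborel) = ennreal \<bar>ln \<bar>d\<bar>\<bar>"
proof -
  let ?g = "\<lambda>t. t / (d\<^sup>2 + t\<^sup>2) - t / (1 + t\<^sup>2)"
  let ?F = "\<lambda>t. (ln (d\<^sup>2 + t\<^sup>2) - ln (1 + t\<^sup>2)) / 2"
  have p: "d\<^sup>2 + t\<^sup>2 > 0" "1 + t\<^sup>2 > 0" for t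
    using d by (auto intro: add_pos_nonneg)
  have D: "(?F has_real_derivative ?g t) (at t)" for t
  proof -
    have "(?F has_real_derivative (2 * t / (d\<^sup>2 + t\<^sup>2) - 2 * t / (1 + t\<^sup>2)) / 2) (at t)"
      using p[of t] by (auto intro!: derivative_eq_intros)
    moreover have "(2 * a / b - 2 * a / c) / 2 = a / b - a / c" for a b c :: real
      by (simp add: diff_divide_distrib)
    ultimately show ?thesis by simp
  qed
  have lim: "(?F \<longlongrightarrow> 0) at_top"
  proof -
    have "d\<^sup>2 > 0" using d by simp
    then show ?thesis by real_asymp
  qed
  have F0: "?F 0 = ln \<bar>d\<bar>"
    using d ln_realpow[of "\<bar>d\<bar>" 2] by simp
  have g: "?g t = t * (1 - d\<^sup>2) / ((d\<^sup>2 + t\<^sup>2) * (1 + t\<^sup>2))" for t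
    using p[of t] by (subst diff_frac_eq) (auto simp: algebra_simps)
  have [measurable]: "?g \<in> borel_measurable borel" by measurable
  \<comment> \<open>The sign \<open>s\<close> makes the integrand nonnegative, so both cases |d| <=
    1 and |d| > 1 fall under the fundamental theorem for nonnegative functions on a
    half-line.\<close>
  have key: "has_bochner_integral lborel f (- ln \<bar>d\<bar>) \<and> (\<integral>\<^sup>+ t. ennreal \<bar>f t\<bar> \<partial>lborel) = ennreal \<bar>ln \<bar>d\<bar>\<bar>"
    if s: "s = 1 \<or> s = -1" and nn: "\<And>t. 0 \<le> t \<Longrightarrow> 0 \<le> s * ?g t" and sl: "0 \<le> - s * ln \<bar>d\<bar>" for s
  proof -
    have "(\<integral>\<^sup>+x. ennreal (s * ?g x) * indicator {0 ..} x \<partial>lborel) = ennreal (0 - s * ?F 0)"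
      by (rule nn_integral_FTC_atLeast[where F="\<lambda>t. s * ?F t"])
         (use nn in \<open>auto intro!: DERIV_cmult D tendsto_mult_right_zero lim simp del: times_divide_eq_right\<close>)
    also have "0 - s * ?F 0 = - s * ln \<bar>d\<bar>" by (simp only: F0)
    finally have N: "(\<integral>\<^sup>+x. ennreal (s * ?g x) * indicator {0 ..} x \<partial>lborel) = ennreal (- s * ln \<bar>d\<bar>)" .
    have e1: "ennreal (s * ?g x) * indicator {0 ..} x = ennreal (s * f x)" for x
      by (auto simp: f_def indicator_def)
    have e2: "ennreal (s * ?g x) * indicator {0 ..} x = ennreal \<bar>f x\<bar>" for x
      using nn[of x] s by (auto simp: f_def indicator_def)
    have nf: "0 \<le> s * f x" for x using nn[of x] by (auto simp: f_def indicator_def)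
    have "has_bochner_integral lborel (\<lambda>x. s * f x) (- s * ln \<bar>d\<bar>)"
      using N nf sl unfolding e1
      by (intro has_bochner_integral_nn_integral) (auto simp: f_def)
    from has_bochner_integral_mult_right[OF this, of s] 
    have "has_bochner_integral lborel f (- ln \<bar>d\<bar>)" using s by auto
    moreover have "- s * ln \<bar>d\<bar> = \<bar>ln \<bar>d\<bar>\<bar>" using s sl by auto
    ultimately show ?thesis using N unfolding e2 by simp
  qed
  have "has_bochner_integral lborel f (- ln \<bar>d\<bar>) \<and> (\<integral>\<^sup>+ t. ennreal \<bar>f t\<bar> \<partial>lborel) = ennreal \<bar>ln \<bar>d\<bar>\<bar>"
  proof (cases "\<bar>d\<bar> \<le> 1")
    case True
    then have "d\<^sup>2 \<le> 1" by (simp add: abs_square_le_1)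
    then show ?thesis using True d p by (intro key[of 1]) (auto simp: g less_imp_le)
  next
    case False
    then have "d\<^sup>2 \<ge> 1" using abs_square_le_1[of d] by linarith
    then show ?thesis using False d p by (intro key[of "-1"]) (auto simp: g less_imp_le intro!: divide_nonpos_nonneg mult_nonneg_nonpos)
  qed
  then show "has_bochner_integral lborel f (- ln \<bar>d\<bar>)" "(\<integral>\<^sup>+ t. ennreal \<bar>f t\<bar> \<partial>lborel) = ennreal \<bar>ln \<bar>d\<bar>\<bar>"
    by auto
qed

lemma integrable_exp_half_line: "0 < (u::real) \<Longrightarrow> integrable lborel (\<lambda>x. indicator {0<..} x * exp (- (x * u)))"
  using integrable_I0i_exp_mscale[of u] by (simp add: set_integrable_def)

lemma has_bochner_laplace_cos:
  fixes u d :: real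
  assumes u: "0 < u"
  shows "has_bochner_integral lborel (\<lambda>x. indicator {0<..} x * (exp (- (x * u)) * cos (d * x))) (u / (d\<^sup>2 + u\<^sup>2))"
proof -
  let ?f = "\<lambda>x. exp (- (x * u)) * cos (d * x)"
  \<comment> \<open>The real part of exp((-u + i d) x) / (-u + i d).\<close>
  let ?F = "\<lambda>x. exp (- (x * u)) * ((d * sin (d * x) - u * cos (d * x)) / (d\<^sup>2 + u\<^sup>2))"
  have p: "d\<^sup>2 + u\<^sup>2 > 0" using u by (auto intro: add_nonneg_pos)
  have int: "integrable lborel (\<lambda>x. indicator {0<..} x * ?f x)"
    by (rule Bochner_Integration.integrable_bound[OF integrable_exp_half_line[OF u]])
       (auto simp: indicator_def abs_mult mult_left_le)
  have "(LBINT x=0..\<infinity>. ?f x) = 0 - (- u / (d\<^sup>2 + u\<^sup>2))"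
  proof (rule interval_integral_FTC_integrable)
    show "(?F has_vector_derivative ?f x) (at x)" for x
      unfolding has_real_derivative_iff_has_vector_derivative[symmetric]
    proof -
      have "d * (cos (d * x) * d) - u * (- sin (d * x) * d) - u * (d * sin (d * x) - u * cos (d * x)) = (d\<^sup>2 + u\<^sup>2) * cos (d * x)"
        by (simp add: power2_eq_square algebra_simps)
      then have e: "exp (- (x * u)) * ((d * (cos (d * x) * d) - u * (- sin (d * x) * d)) / (d\<^sup>2 + u\<^sup>2))
           + (- u * exp (- (x * u))) * ((d * sin (d * x) - u * cos (d * x)) / (d\<^sup>2 + u\<^sup>2)) = ?f x"
      proof -
        assume N: "d * (cos (d * x) * d) - u * (- sin (d * x) * d) - u * (d * sin (d * x) - u * cos (d * x)) = (d\<^sup>2 + u\<^sup>2) * cos (d * x)"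
        have "E * (A / P) + (- u * E) * (B / P) = E * ((A - u * B) / P)" for E A P B :: real
          by (simp add: diff_divide_distrib algebra_simps)
        from this[of "exp (- (x * u))" "d * (cos (d * x) * d) - u * (- sin (d * x) * d)" "d\<^sup>2 + u\<^sup>2" "d * sin (d * x) - u * cos (d * x)"]
        show ?thesis unfolding N using p u by simp
      qed
      have "(?F has_real_derivative (exp (- (x * u)) * ((d * (cos (d * x) * d) - u * (- sin (d * x) * d)) / (d\<^sup>2 + u\<^sup>2))
           + (- u * exp (- (x * u))) * ((d * sin (d * x) - u * cos (d * x)) / (d\<^sup>2 + u\<^sup>2)))) (at x)"
      proof (rule DERIV_mult')
        show "((\<lambda>x. exp (- (x * u))) has_real_derivative - u * exp (- (x * u))) (at x)"
          by (auto intro!: derivative_eq_intros)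
        show "((\<lambda>x. (d * sin (d * x) - u * cos (d * x)) / (d\<^sup>2 + u\<^sup>2)) has_real_derivative
            (d * (cos (d * x) * d) - u * (- sin (d * x) * d)) / (d\<^sup>2 + u\<^sup>2)) (at x)"
          by (rule DERIV_cdivide) (auto intro!: derivative_eq_intros)
      qed
      then show "(?F has_real_derivative ?f x) (at x)" unfolding e .
    qed
    show "isCont ?f x" for x by (intro continuous_intros)
    show "set_integrable lborel (einterval 0 \<infinity>) ?f"
      using int by (simp add: set_integrable_def zero_ereal_def)
    have "isCont ?F 0" using p by (intro continuous_intros) auto
    then have "(?F \<longlongrightarrow> - u / (d\<^sup>2 + u\<^sup>2)) (at_right 0)"
      by (auto simp: isCont_def intro: filterlim_mono[OF _ order_refl at_le])
    then show "((?F \<circ> real_of_ereal) \<longlongrightarrow> - u / (d\<^sup>2 + u\<^sup>2)) (at_right 0)"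
      unfolding zero_ereal_def ereal_tendsto_simps .
    have "(?F \<longlongrightarrow> 0) at_top"
    proof (rule Lim_null_comparison)
      let ?B = "(\<bar>d\<bar> + \<bar>u\<bar>) / (d\<^sup>2 + u\<^sup>2)"
      show "\<forall>\<^sub>F x in at_top. norm (?F x) \<le> exp (- (x * u)) * ?B"
      proof (rule always_eventually, rule allI)
        fix x
        have "\<bar>d * sin (d * x) - u * cos (d * x)\<bar> \<le> \<bar>d * sin (d * x)\<bar> + \<bar>u * cos (d * x)\<bar>" by linarith
        also have "\<dots> \<le> \<bar>d\<bar> * 1 + \<bar>u\<bar> * 1" unfolding abs_mult by (intro add_mono mult_left_mono) auto
        finally show "norm (?F x) \<le> exp (- (x * u)) * ?B"
          using p by (auto simp: abs_mult intro!: divide_right_mono)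
      qed
      show "((\<lambda>x. exp (- (x * u)) * ?B) \<longlongrightarrow> 0) at_top"
        using u by (intro tendsto_mult_left_zero) real_asymp
    qed
    then show "((?F \<circ> real_of_ereal) \<longlongrightarrow> 0) (at_left \<infinity>)"
      unfolding ereal_tendsto_simps .
  qed auto
  then have "integral\<^sup>L lborel (\<lambda>x. indicator {0<..} x * ?f x) = u / (d\<^sup>2 + u\<^sup>2)"
    by (simp add: interval_lebesgue_integral_0_infty set_lebesgue_integral_def)
  with int show ?thesis by (simp add: has_bochner_integral_iff)
qed

text \<open>A real-valued integral without confinement, because positive definiteness subtracts such
  energies.\<close>

definition mutual_log_energy :: "real measure \<Rightarrow> real measure \<Rightarrow> real" where
  "mutual_log_energy M N = (\<integral>p. - ln \<bar>fst p - snd p\<bar> \<partial>(M \<Otimes>\<^sub>M N))"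

text \<open>Since ln 0 = 0 here, nullity of the diagonal has to be required separately.\<close>

definition log_integrable :: "real measure \<Rightarrow> real measure \<Rightarrow> bool" where
  "log_integrable M N \<longleftrightarrow> integrable (M \<Otimes>\<^sub>M N) (\<lambda>p. ln \<bar>fst p - snd p\<bar>) \<and> (AE p in M \<Otimes>\<^sub>M N. fst p \<noteq> snd p)"

lemma Re_char: "real_distribution M \<Longrightarrow> Re (char M x) = (\<integral>s. cos (x * s) \<partial>M)"
  and Im_char: "real_distribution M \<Longrightarrow> Im (char M x) = (\<integral>s. sin (x * s) \<partial>M)"
proof -
  assume "real_distribution M"
  then interpret real_distribution M .
  have "complex_integrable M (\<lambda>s. iexp (x * s))" by (rule integrable_iexp) auto
  from integral_Re[OF this] integral_Im[OF this]
  show "Re (char M x) = (\<integral>s. cos (x * s) \<partial>M)" "Im (char M x) = (\<integral>s. sin (x * s) \<partial>M)"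
    by (simp_all add: char_def Re_exp Im_exp)
qed

lemma (in prob_space) integrable_bounded_real:
  assumes "f \<in> borel_measurable M" "\<And>x. \<bar>f x\<bar> \<le> (B::real)" shows "integrable M f"
  using assms by (intro integrable_const_bound[where B=B]) auto

text \<open>Interpreted at (M, M), (M, N) and (N, N), so that each computation is done once for the
  three terms of the quadratic form.\<close>

locale two_distributions = M: real_distribution M + N: real_distribution N
  for M N :: "real measure"
begin

sublocale P: pair_prob_space M N ..

lemma measurable_pair_borel [measurable_cong]: "sets (M \<Otimes>\<^sub>M N) = sets (borel \<Otimes>\<^sub>M borel)"
  by (intro sets_pair_measure_cong) auto

lemma integral_product:
  assumes "f \<in> borel_measurable borel" "g \<in> borel_measurable borel" "\<And>x. \<bar>f x\<bar> \<le> (1::real)" "\<And>x. \<bar>g x\<bar> \<le> (1::real)"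
  shows "(\<integral>p. f (fst p) * g (snd p) \<partial>(M \<Otimes>\<^sub>M N)) = (\<integral>x. f x \<partial>M) * (\<integral>y. g y \<partial>N)"
proof -
  have [measurable]: "f \<in> borel_measurable M" "g \<in> borel_measurable N" using assms by auto
  have "integrable (M \<Otimes>\<^sub>M N) (\<lambda>p. f (fst p) * g (snd p))"
    using assms(3,4) by (intro P.integrable_bounded_real[where B=1]) (auto simp: abs_mult mult_le_one)
  then have "(\<integral>x. \<integral>y. f x * g y \<partial>N \<partial>M) = (\<integral>p. f (fst p) * g (snd p) \<partial>(M \<Otimes>\<^sub>M N))"
    using P.integral_fst'[of "\<lambda>p. f (fst p) * g (snd p)"] by simp
  then show ?thesis by simp
qed

text \<open>The addition theorem turns the cosine of a difference into two products, each of which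
  factorises over the product measure.\<close>

lemma integral_cos_diff:
  "(\<integral>p. cos ((fst p - snd p) * x) \<partial>(M \<Otimes>\<^sub>M N)) = Re (char M x * cnj (char N x))"
proof -
  have "(\<integral>p. cos ((fst p - snd p) * x) \<partial>(M \<Otimes>\<^sub>M N))
     = (\<integral>p. cos (x * fst p) * cos (x * snd p) + sin (x * fst p) * sin (x * snd p) \<partial>(M \<Otimes>\<^sub>M N))"
  proof -
    have "cos ((a - b) * x) = cos (x * a) * cos (x * b) + sin (x * a) * sin (x * b)" for a b
      by (subst cos_diff[symmetric]) (simp add: algebra_simps)
    then show ?thesis by simp
  qed
  also have "\<dots> = (\<integral>p. cos (x * fst p) * cos (x * snd p) \<partial>(M \<Otimes>\<^sub>M N)) + (\<integral>p. sin (x * fst p) * sin (x * snd p) \<partial>(M \<Otimes>\<^sub>M N))"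
    by (intro Bochner_Integration.integral_add P.integrable_bounded_real[where B=1]) (auto simp: abs_mult mult_le_one)
  also have "\<dots> = (\<integral>s. cos (x * s) \<partial>M) * (\<integral>s. cos (x * s) \<partial>N) + (\<integral>s. sin (x * s) \<partial>M) * (\<integral>s. sin (x * s) \<partial>N)"
    using integral_product[of "\<lambda>s. cos (x * s)" "\<lambda>s. cos (x * s)"] integral_product[of "\<lambda>s. sin (x * s)" "\<lambda>s. sin (x * s)"] by simp
  also have "\<dots> = Re (char M x * cnj (char N x))"
    by (simp add: Re_char Im_char M.real_distribution_axioms N.real_distribution_axioms)
  finally show ?thesis .
qed

text \<open>For fixed t > 0 the factor exp(-x t) dominates the integrand, so the exchange with M and
  N is absolutely convergent. The divergence of the logarithm is confined to the later integral over
  t.\<close>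

lemma has_bochner_laplace_char:
  assumes t: "0 < t"
  shows "has_bochner_integral lborel (\<lambda>x. indicator {0<..} x * (exp (- (x * t)) * Re (char M x * cnj (char N x))))
     (\<integral>p. t / ((fst p - snd p)\<^sup>2 + t\<^sup>2) \<partial>(M \<Otimes>\<^sub>M N))"
proof -
  let ?P = "M \<Otimes>\<^sub>M N"
  interpret Q: pair_sigma_finite ?P lborel ..
  let ?g = "\<lambda>p x. indicator {0<..} x * (exp (- (x * t)) * cos ((fst p - snd p) * x))"
  have "integrable (?P \<Otimes>\<^sub>M lborel) (\<lambda>(p, x). indicator {0<..} x * exp (- (x * t)))"
  proof (rule Q.Fubini_integrable)
    show "integrable ?P (\<lambda>p. \<integral>x. norm (case (p, x) of (p, x) \<Rightarrow> indicator {0<..} x * exp (- (x * t))) \<partial>lborel)"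
      by simp
  qed (auto intro: integrable_exp_half_line t)
  then have int: "integrable (?P \<Otimes>\<^sub>M lborel) (\<lambda>(p, x). ?g p x)"
    by (rule Bochner_Integration.integrable_bound) (auto simp: abs_mult indicator_def mult_left_le)
  have "(\<lambda>x. \<integral>p. ?g p x \<partial>?P) = (\<lambda>x. indicator {0<..} x * (exp (- (x * t)) * Re (char M x * cnj (char N x))))"
    by (simp add: integral_cos_diff)
  moreover have "integrable lborel (\<lambda>x. \<integral>p. ?g p x \<partial>?P)"
    using Q.integrable_snd[OF int] .
  moreover have "(\<integral>x. \<integral>p. ?g p x \<partial>?P \<partial>lborel) = (\<integral>p. \<integral>x. ?g p x \<partial>lborel \<partial>?P)"
    using Q.Fubini_integral[OF int] .
  moreover have "(\<integral>x. ?g p x \<partial>lborel) = t / ((fst p - snd p)\<^sup>2 + t\<^sup>2)" for p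
    using has_bochner_laplace_cos[OF t, of "fst p - snd p"] by (simp add: has_bochner_integral_iff)
  ultimately show ?thesis by (simp add: has_bochner_integral_iff)
qed

text \<open>The counterterm t / (1 + t^2) gives convergence at infinity. Since the product measure
  has mass one, it leaves the average unchanged, independent of M and N.\<close>

lemma has_bochner_mutual_log_energy:
  assumes "log_integrable M N"
  shows "has_bochner_integral lborel (\<lambda>t. indicator {0..} t * ((\<integral>p. t / ((fst p - snd p)\<^sup>2 + t\<^sup>2) \<partial>(M \<Otimes>\<^sub>M N)) - t / (1 + t\<^sup>2)))
     (mutual_log_energy M N)"
proof -
  let ?P = "M \<Otimes>\<^sub>M N"
  interpret Q: pair_sigma_finite ?P lborel ..
  let ?f = "\<lambda>p t. indicator {0..} t * (t / ((fst p - snd p)\<^sup>2 + t\<^sup>2) - t / (1 + t\<^sup>2))"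
  have L: "integrable ?P (\<lambda>p. ln \<bar>fst p - snd p\<bar>)" and ne: "AE p in ?P. fst p \<noteq> snd p"
    using assms by (auto simp: log_integrable_def)
  have [measurable]: "(\<lambda>(p, t). ?f p t) \<in> borel_measurable (?P \<Otimes>\<^sub>M lborel)" by measurable
  have int: "integrable (?P \<Otimes>\<^sub>M lborel) (\<lambda>(p, t). ?f p t)"
  proof (rule integrableI_bounded)
    have "(\<integral>\<^sup>+ z. ennreal (norm (case z of (p, t) \<Rightarrow> ?f p t)) \<partial>(?P \<Otimes>\<^sub>M lborel)) = (\<integral>\<^sup>+ p. \<integral>\<^sup>+ t. ennreal \<bar>?f p t\<bar> \<partial>lborel \<partial>?P)"
      by (subst lborel.nn_integral_fst[symmetric]) auto
    also have "\<dots> = (\<integral>\<^sup>+ p. ennreal \<bar>ln \<bar>fst p - snd p\<bar>\<bar> \<partial>?P)"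
      by (rule nn_integral_cong_AE) (use ne in eventually_elim, subst has_bochner_neg_ln(2), auto)
    also have "\<dots> < \<infinity>"
      using L by (simp add: integrable_iff_bounded)
    finally show "(\<integral>\<^sup>+ z. ennreal (norm (case z of (p, t) \<Rightarrow> ?f p t)) \<partial>(?P \<Otimes>\<^sub>M lborel)) < \<infinity>" .
  qed simp
  \<comment> \<open>Splitting off the counterterm uses the bound 1/t on the first fraction; at t = 0
    both sides vanish because t is the numerator.\<close>
  have inner: "(\<integral>p. ?f p t \<partial>?P) = indicator {0..} t * ((\<integral>p. t / ((fst p - snd p)\<^sup>2 + t\<^sup>2) \<partial>?P) - t / (1 + t\<^sup>2))" for t
  proof (cases "t = 0")
    case False
    have b: "\<bar>t / ((fst p - snd p)\<^sup>2 + t\<^sup>2)\<bar> \<le> \<bar>t / t\<^sup>2\<bar>" for p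
      unfolding abs_divide using False by (intro divide_left_mono) (auto simp: add_nonneg_pos)
    have "integrable ?P (\<lambda>p. t / ((fst p - snd p)\<^sup>2 + t\<^sup>2))"
      by (rule P.integrable_bounded_real[OF _ b]) auto
    then show ?thesis by (simp add: P.prob_space[simplified])
  qed simp
  have "(\<integral>t. \<integral>p. ?f p t \<partial>?P \<partial>lborel) = (\<integral>p. \<integral>t. ?f p t \<partial>lborel \<partial>?P)"
    using Q.Fubini_integral[OF int] .
  also have "\<dots> = mutual_log_energy M N"
    unfolding mutual_log_energy_def
  proof (rule integral_cong_AE)
    show "AE p in ?P. (\<integral>t. ?f p t \<partial>lborel) = - ln \<bar>fst p - snd p\<bar>"
      using ne
    proof eventually_elim
      case (elim p)
      then show ?case using has_bochner_neg_ln(1)[of "fst p - snd p"] by (simp add: has_bochner_integral_iff)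
    qed
  qed auto
  finally have "(\<integral>t. \<integral>p. ?f p t \<partial>?P \<partial>lborel) = mutual_log_energy M N" .
  with Q.integrable_snd[OF int] show ?thesis
    unfolding has_bochner_integral_iff inner[symmetric] by (rule conjI)
qed

end

text \<open>With coefficients 1, -2, 1 the counterterms cancel and the characteristic functions
  complete a square: D is the integral over t > 0 and x > 0 of exp(-x t) |char M x - char N
  x|^2.\<close>

theorem mutual_log_energy_positive_definite:
  assumes M: "real_distribution M" and N: "real_distribution N"
    and L: "log_integrable M M" "log_integrable M N" "log_integrable N N"
  defines "D \<equiv> mutual_log_energy M M - 2 * mutual_log_energy M N + mutual_log_energy N N"
  shows "0 \<le> D" and "D = 0 \<Longrightarrow> M = N"
proof -
  interpret M: real_distribution M by fact
  interpret N: real_distribution N by fact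
  interpret MM: two_distributions M M ..
  interpret MN: two_distributions M N ..
  interpret NN: two_distributions N N ..
  let ?q = "\<lambda>M N t. \<integral>p. t / ((fst p - snd p)\<^sup>2 + t\<^sup>2) \<partial>(M \<Otimes>\<^sub>M N)"
  let ?r = "\<lambda>t. t / (1 + t\<^sup>2) :: real"
  let ?h = "\<lambda>t. indicator {0..} t * (?q M M t - ?r t) - 2 * (indicator {0..} t * (?q M N t - ?r t)) + indicator {0..} t * (?q N N t - ?r t)"
  let ?k = "\<lambda>t x. indicator {0<..} x * (exp (- (x * t)) * (cmod (char M x - char N x))\<^sup>2)"
  have D: "has_bochner_integral lborel ?h D"
    unfolding D_def
    by (intro has_bochner_integral_add has_bochner_integral_diff has_bochner_integral_mult_right
      MM.has_bochner_mutual_log_energy MN.has_bochner_mutual_log_energy NN.has_bochner_mutual_log_energy L)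
  have hk: "has_bochner_integral lborel (?k t) (?h t)" if t: "0 < t" for t
  proof -
    let ?E = "\<lambda>x f. indicator {0<..} x * (exp (- (x * t)) * Re f)"
    have "has_bochner_integral lborel (\<lambda>x. ?E x (char M x * cnj (char M x)) - 2 * ?E x (char M x * cnj (char N x)) + ?E x (char N x * cnj (char N x)))
       (?q M M t - 2 * ?q M N t + ?q N N t)"
      by (intro has_bochner_integral_add has_bochner_integral_diff has_bochner_integral_mult_right
        MM.has_bochner_laplace_char MN.has_bochner_laplace_char NN.has_bochner_laplace_char t)
    moreover have "?E x (a * cnj a) - 2 * ?E x (a * cnj b) + ?E x (b * cnj b) = indicator {0<..} x * (exp (- (x * t)) * (cmod (a - b))\<^sup>2)" for a b x
    proof -
      have c: "(cmod (a - b))\<^sup>2 = (Re a - Re b)\<^sup>2 + (Im a - Im b)\<^sup>2" by (simp add: cmod_power2)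
      show ?thesis unfolding c by (simp add: power2_eq_square algebra_simps)
    qed
    ultimately show ?thesis using t by (simp add: algebra_simps)
  qed
  have nn: "0 \<le> ?h t" for t
  proof (cases "0 < t")
    case True
    have "0 \<le> integral\<^sup>L lborel (?k t)" by (rule integral_nonneg_AE) auto
    then show ?thesis using has_bochner_integral_integral_eq[OF hk[OF True]] by (simp only:)
  next
    case False
    then show ?thesis by (cases "t = 0") auto
  qed
  have int: "integrable lborel ?h" and D_eq: "integral\<^sup>L lborel ?h = D"
    using D unfolding has_bochner_integral_iff by (rule conjunct1, rule conjunct2)
  have nn_AE: "AE t in lborel. 0 \<le> ?h t" by (rule AE_I2) (rule nn)
  show "0 \<le> D" unfolding D_eq[symmetric] by (rule integral_nonneg_AE[OF nn_AE])
  assume "D = 0"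
  with D_eq have "integral\<^sup>L lborel ?h = 0" by (rule trans)
  then have "AE t in lborel. ?h t = 0" by (rule integral_nonneg_eq_0_iff_AE[OF int nn_AE, THEN iffD1])
  \<comment> \<open>A single t is enough: its exponential weight is positive, so the characteristic
    functions then agree at almost every x > 0.\<close>
  have "\<exists>t>0. ?h t = 0"
  proof (rule ccontr)
    assume "\<not> (\<exists>t>0. ?h t = 0)"
    with \<open>AE t in lborel. ?h t = 0\<close> have "AE t in lborel. t \<notin> {0<..<1::real}"
      by (auto elim!: eventually_mono)
    moreover have set_eq: "{x::real. 0 < x \<and> x < 1} = {0<..<1}" by auto
    ultimately have "emeasure lborel {0<..<1::real} = 0"
      using set_eq AE_iff_measurable[of "{0<..<1}" lborel "\<lambda>t. t \<notin> {0<..<1::real}"] by auto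
    then show False by simp
  qed
  then obtain t where t: "0 < t" "?h t = 0" by blast
  have int_k: "integrable lborel (?k t)" and "integral\<^sup>L lborel (?k t) = 0"
    using hk[OF t(1)] unfolding t(2) has_bochner_integral_iff by (rule conjunct1, rule conjunct2)
  then have "AE x in lborel. ?k t x = 0"
    by (subst (asm) integral_nonneg_eq_0_iff_AE[OF int_k]) auto
  then have AE: "AE x in lborel. x \<in> {0<..} \<longrightarrow> x \<in> {x. char M x - char N x = 0}"
    by (auto elim!: eventually_mono simp: indicator_def)
  \<comment> \<open>Continuity upgrades agreement almost everywhere on the open half-line to
    agreement at every x > 0.\<close>
  have "closed {x. char M x - char N x = 0}"
    by (intro closed_Collect_eq continuous_intros continuous_at_imp_continuous_on ballI M.isCont_char N.isCont_char)
  then have pos: "char M x = char N x" if "0 < x" for x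
    using mem_closed_if_AE_lebesgue_open[OF open_greaterThan[of 0] _ _, of "{x. char M x - char N x = 0}" x] that AE
    by (auto simp: AE_completion)
  have cnj: "char K (- x) = cnj (char K x)" if "real_distribution K" for K x
    using that by (intro complex_eqI) (simp_all add: Re_char Im_char)
  have "char M x = char N x" for x
    using pos[of x] pos[of "- x"] cnj[OF M, of x] cnj[OF N, of x] M.char_zero N.char_zero
    by (cases x "0::real" rule: linorder_cases) (auto simp: complex_cnj_cancel_iff)
  then show "M = N" by (intro Levy_uniqueness M N) auto
qed

section \<open>The one-dimensional log gas\<close>

text \<open>With the confinement included the kernel is nonnegative, so its integral exists for
  every law. The diagonal is set to infinity explicitly because \<open>ln 0 = 0\<close> would make
  it harmless.\<close>

definition gas_kernel :: "real \<Rightarrow> real \<Rightarrow> ennreal" where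
  "gas_kernel s t = (if s = t then \<infinity> else ennreal (- ln \<bar>s - t\<bar> + (s\<^sup>2 + t\<^sup>2)))"

definition gas_energy :: "real measure \<Rightarrow> ennreal" where
  "gas_energy M = (\<integral>\<^sup>+ p. gas_kernel (fst p) (snd p) \<partial>(M \<Otimes>\<^sub>M M))"

lemma measurable_gas_kernel [measurable]:
  assumes "f \<in> borel_measurable M" "g \<in> borel_measurable M"
  shows "(\<lambda>x. gas_kernel (f x) (g x)) \<in> borel_measurable M"
  using assms unfolding gas_kernel_def by measurable

text \<open>Half of the confinement absorbs the logarithm: with u = |s - t| one has ln u <= u - 1 <=
  u^2 / 4 <= (s^2 + t^2) / 2. The other half is retained so that finite energy forces a finite
  second moment.\<close>

lemma gas_kernel_lower:
  fixes s t :: real shows "(s\<^sup>2 + t\<^sup>2) / 2 \<le> - ln \<bar>s - t\<bar> + (s\<^sup>2 + t\<^sup>2)"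
proof -
  have "ln \<bar>s - t\<bar> \<le> (s - t)\<^sup>2 / 4"
  proof (cases "s = t")
    case False
    then have "ln \<bar>s - t\<bar> \<le> \<bar>s - t\<bar> - 1" by (intro ln_le_minus_one) auto
    also have "\<dots> \<le> \<bar>s - t\<bar>\<^sup>2 / 4"
      using zero_le_power2[of "\<bar>s - t\<bar> - 2"] by (simp add: power2_diff)
    finally show ?thesis by simp
  qed simp
  also have "\<dots> \<le> (s\<^sup>2 + t\<^sup>2) / 2"
    using zero_le_power2[of "s + t"] by (simp add: power2_diff power2_sum)
  finally show ?thesis by (simp add: field_simps)
qed

lemma gas_kernel_ge: "ennreal ((s\<^sup>2 + t\<^sup>2) / 2) \<le> gas_kernel s t"
  using gas_kernel_lower[of s t] by (auto simp: gas_kernel_def intro!: ennreal_leI)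

lemma gas_kernel_nonneg: "0 \<le> - ln \<bar>s - t\<bar> + (s\<^sup>2 + t\<^sup>2 :: real)"
  using gas_kernel_lower[of s t] by (smt (verit) divide_nonneg_nonneg zero_le_power2)

context two_distributions
begin

lemma integrable_fst_snd_square:
  assumes "integrable M (\<lambda>s. s\<^sup>2)" "integrable N (\<lambda>s. s\<^sup>2)"
  shows "has_bochner_integral (M \<Otimes>\<^sub>M N) (\<lambda>p. (fst p)\<^sup>2 + (snd p)\<^sup>2) ((\<integral>s. s\<^sup>2 \<partial>M) + (\<integral>s. s\<^sup>2 \<partial>N))"
proof -
  have f: "integrable (M \<Otimes>\<^sub>M N) (\<lambda>p. (fst p)\<^sup>2)"
    by (rule P.Fubini_integrable) (use assms in auto)
  have g: "integrable (M \<Otimes>\<^sub>M N) (\<lambda>p. (snd p)\<^sup>2)"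
    by (rule P.Fubini_integrable) (use assms in auto)
  show ?thesis
    using f g P.integral_fst'[OF f] P.integral_fst'[OF g]
    by (simp add: has_bochner_integral_iff M.prob_space[simplified] N.prob_space[simplified])
qed

end

lemma gas_energy_eq:
  assumes "real_distribution M" "log_integrable M M" "integrable M (\<lambda>s. s\<^sup>2)"
  shows "gas_energy M = ennreal (mutual_log_energy M M + 2 * (\<integral>s. s\<^sup>2 \<partial>M))"
proof -
  interpret real_distribution M by fact
  interpret MM: two_distributions M M ..
  have 1: "has_bochner_integral (M \<Otimes>\<^sub>M M) (\<lambda>p. - ln \<bar>fst p - snd p\<bar>) (mutual_log_energy M M)"
    using assms(2) by (simp add: has_bochner_integral_iff log_integrable_def mutual_log_energy_def)
  have 2: "has_bochner_integral (M \<Otimes>\<^sub>M M) (\<lambda>p. (fst p)\<^sup>2 + (snd p)\<^sup>2) ((\<integral>s. s\<^sup>2 \<partial>M) + (\<integral>s. s\<^sup>2 \<partial>M))"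
    by (rule MM.integrable_fst_snd_square) fact+
  have "gas_energy M = (\<integral>\<^sup>+ p. ennreal (- ln \<bar>fst p - snd p\<bar> + ((fst p)\<^sup>2 + (snd p)\<^sup>2)) \<partial>(M \<Otimes>\<^sub>M M))"
    unfolding gas_energy_def gas_kernel_def
    by (rule nn_integral_cong_AE) (use assms(2) in \<open>auto simp: log_integrable_def elim!: eventually_mono\<close>)
  also have "\<dots> = ennreal (mutual_log_energy M M + ((\<integral>s. s\<^sup>2 \<partial>M) + (\<integral>s. s\<^sup>2 \<partial>M)))"
    using has_bochner_integral_add[OF 1 2] gas_kernel_nonneg
    by (subst nn_integral_eq_integral) (auto simp: has_bochner_integral_iff simp del: Bochner_Integration.integral_add)
  finally show ?thesis by simp
qed

text \<open>The infinite diagonal must be null, the retained half of the confinement bounds the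
  second moment, and subtracting the kernel from the integrable confinement isolates the
  logarithm.\<close>

lemma gas_energy_finiteD:
  assumes "real_distribution M" "gas_energy M < \<infinity>"
  shows "log_integrable M M" "integrable M (\<lambda>s. s\<^sup>2)"
proof -
  interpret real_distribution M by fact
  interpret MM: two_distributions M M ..
  let ?P = "M \<Otimes>\<^sub>M M"
  have "AE p in ?P. gas_kernel (fst p) (snd p) \<noteq> \<infinity>"
    using assms(2) unfolding gas_energy_def by (intro nn_integral_noteq_infinite) auto
  then have ne: "AE p in ?P. fst p \<noteq> snd p"
    by (rule eventually_mono) (auto simp: gas_kernel_def)
  have "(\<integral>\<^sup>+ s. ennreal (s\<^sup>2 / 2) \<partial>M) = (\<integral>\<^sup>+ p. ennreal ((fst p)\<^sup>2 / 2) \<partial>?P)"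
    by (subst nn_integral_fst[symmetric]) (auto simp: emeasure_space_1[simplified])
  also have "\<dots> \<le> (\<integral>\<^sup>+ p. gas_kernel (fst p) (snd p) \<partial>?P)"
    by (intro nn_integral_mono order_trans[OF _ gas_kernel_ge] ennreal_leI) auto
  also have "\<dots> < \<infinity>" using assms(2) by (simp add: gas_energy_def)
  finally have "integrable M (\<lambda>s. s\<^sup>2 / 2)"
    by (intro integrableI_bounded) auto
  then have "integrable M (\<lambda>s. 2 * (s\<^sup>2 / 2))" by (intro integrable_mult_right)
  then show sq: "integrable M (\<lambda>s. s\<^sup>2)" by simp
  have "(\<integral>\<^sup>+ p. ennreal (norm (- ln \<bar>fst p - snd p\<bar> + ((fst p)\<^sup>2 + (snd p)\<^sup>2))) \<partial>?P) \<le> (\<integral>\<^sup>+ p. gas_kernel (fst p) (snd p) \<partial>?P)"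
    using gas_kernel_nonneg by (intro nn_integral_mono) (auto simp: gas_kernel_def)
  also have "\<dots> < \<infinity>" using assms(2) by (simp add: gas_energy_def)
  finally have k: "integrable ?P (\<lambda>p. - ln \<bar>fst p - snd p\<bar> + ((fst p)\<^sup>2 + (snd p)\<^sup>2))"
    by (intro integrableI_bounded) auto
  have "integrable ?P (\<lambda>p. ((fst p)\<^sup>2 + (snd p)\<^sup>2) - (- ln \<bar>fst p - snd p\<bar> + ((fst p)\<^sup>2 + (snd p)\<^sup>2)))"
    using MM.integrable_fst_snd_square[OF sq sq] k
    by (intro Bochner_Integration.integrable_diff) (auto simp: has_bochner_integral_iff)
  with ne show "log_integrable M M" by (simp add: log_integrable_def)
qed

lemma real_distribution_semicircle: "real_distribution semicircle"
  using prob_space_semicircle by (simp add: real_distribution_def real_distribution_axioms_def)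

lemma integrable_semicircle_square: "integrable semicircle (\<lambda>t. t\<^sup>2)"
proof -
  interpret real_distribution semicircle by (rule real_distribution_semicircle)
  show ?thesis
    using AE_semicircle_bounded
    by (intro integrable_const_bound[where B=1]) (auto elim!: eventually_mono simp: abs_square_le_1)
qed

text \<open>Tonelli applies to the nonnegative kernel; the inner integral over the semicircle law is
  at most s^2 plus a constant, by the lower bound on its potential.\<close>

lemma log_integrable_semicircle:
  assumes "real_distribution M" and sq: "integrable M (\<lambda>s. s\<^sup>2)"
  shows "log_integrable M semicircle"
    and "mutual_log_energy M semicircle = - (\<integral>s. \<integral>t. ln \<bar>s - t\<bar> \<partial>semicircle \<partial>M)"
    and "integrable M (\<lambda>s. \<integral>t. ln \<bar>s - t\<bar> \<partial>semicircle)"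
proof -
  interpret real_distribution M by fact
  interpret S: real_distribution semicircle by (rule real_distribution_semicircle)
  interpret MS: two_distributions M semicircle ..
  let ?P = "M \<Otimes>\<^sub>M semicircle"
  let ?k = "\<lambda>p. - ln \<bar>fst p - snd p\<bar> + ((fst p)\<^sup>2 + (snd p)\<^sup>2)"
  let ?m = "\<integral>t. t\<^sup>2 \<partial>semicircle"
  have in_k: "has_bochner_integral semicircle (\<lambda>t. - ln \<bar>s - t\<bar> + (s\<^sup>2 + t\<^sup>2)) (- (\<integral>t. ln \<bar>s - t\<bar> \<partial>semicircle) + (s\<^sup>2 + ?m))" for s
    using integrable_semicircle_ln[of s] integrable_semicircle_square S.prob_space
    by (intro has_bochner_integral_add has_bochner_integral_minus) (auto simp: has_bochner_integral_iff)
  have "(\<integral>\<^sup>+ p. ennreal (norm (?k p)) \<partial>?P) = (\<integral>\<^sup>+ p. ennreal (?k p) \<partial>?P)"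
    using gas_kernel_nonneg by (intro nn_integral_cong) auto
  also have "\<dots> = (\<integral>\<^sup>+ s. \<integral>\<^sup>+ t. ennreal (- ln \<bar>s - t\<bar> + (s\<^sup>2 + t\<^sup>2)) \<partial>semicircle \<partial>M)"
    by (subst S.nn_integral_fst[symmetric]) auto
  also have "\<dots> \<le> (\<integral>\<^sup>+ s. ennreal (\<bar>log_pot\<bar> + ?m + s\<^sup>2) \<partial>M)"
  proof (intro nn_integral_mono)
    fix s
    have "(\<integral>\<^sup>+ t. ennreal (- ln \<bar>s - t\<bar> + (s\<^sup>2 + t\<^sup>2)) \<partial>semicircle) = ennreal (- (\<integral>t. ln \<bar>s - t\<bar> \<partial>semicircle) + (s\<^sup>2 + ?m))"
      using in_k[of s] gas_kernel_nonneg by (subst nn_integral_eq_integral) (auto simp only: has_bochner_integral_iff intro!: AE_I2)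
    also have "\<dots> \<le> ennreal (\<bar>log_pot\<bar> + ?m + s\<^sup>2)"
      using semicircle_ln_lower[of s] by (intro ennreal_leI) linarith
    finally show "(\<integral>\<^sup>+ t. ennreal (- ln \<bar>s - t\<bar> + (s\<^sup>2 + t\<^sup>2)) \<partial>semicircle) \<le> ennreal (\<bar>log_pot\<bar> + ?m + s\<^sup>2)" .
  qed
  also have "\<dots> < \<infinity>"
  proof -
    have "integrable M (\<lambda>s. \<bar>log_pot\<bar> + ?m + s\<^sup>2)" using sq by auto
    then show ?thesis by (subst nn_integral_eq_integral) auto
  qed
  finally have k: "integrable ?P ?k" by (intro integrableI_bounded) auto
  have "integrable ?P (\<lambda>p. ((fst p)\<^sup>2 + (snd p)\<^sup>2) - ?k p)"
    using MS.integrable_fst_snd_square[OF sq integrable_semicircle_square] k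
    by (intro Bochner_Integration.integrable_diff) (auto simp: has_bochner_integral_iff)
  then have L: "integrable ?P (\<lambda>p. ln \<bar>fst p - snd p\<bar>)" by simp
  moreover have "AE p in ?P. fst p \<noteq> snd p"
  proof (rule MS.P.AE_pair_measure)
    show "{x \<in> space ?P. fst x \<noteq> snd x} \<in> sets ?P" by measurable
    show "AE x in M. AE y in semicircle. fst (x, y) \<noteq> snd (x, y)"
    proof (rule AE_I2)
      show "AE y in semicircle. fst (x, y) \<noteq> snd (x, y)" for x
        using AE_semicircle_neq[of x] by eventually_elim auto
    qed
  qed
  ultimately show "log_integrable M semicircle" by (simp add: log_integrable_def)
  show "mutual_log_energy M semicircle = - (\<integral>s. \<integral>t. ln \<bar>s - t\<bar> \<partial>semicircle \<partial>M)"
    unfolding mutual_log_energy_def using MS.P.integral_fst'[OF L] by simp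
  show "integrable M (\<lambda>s. \<integral>t. ln \<bar>s - t\<bar> \<partial>semicircle)"
    using MS.P.integrable_fst'[OF L] by simp
qed

text \<open>The potential -2 * integral of ln |s - t| over the semicircle law, plus 2 s^2, is constant on
  [-1, 1] and not smaller outside (the Euler--Lagrange conditions), so the excess energy of M is at
  least the energy of the neutral signed measure M - semicircle.\<close>

theorem gas_energy_semicircle_minimal:
  shows gas_energy_semicircle_finite: "gas_energy semicircle < \<infinity>"
    and gas_energy_ge_semicircle: "real_distribution M \<Longrightarrow> gas_energy semicircle \<le> gas_energy M"
    and gas_energy_unique: "real_distribution M \<Longrightarrow> gas_energy M \<le> gas_energy semicircle \<Longrightarrow> M = semicircle"
proof -
  let ?S = semicircle
  note S = real_distribution_semicircle
  interpret S: real_distribution semicircle by (rule S)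
  note SS = log_integrable_semicircle[OF S integrable_semicircle_square]
  have eS: "gas_energy ?S = ennreal (mutual_log_energy ?S ?S + 2 * (\<integral>s. s\<^sup>2 \<partial>?S))"
    by (rule gas_energy_eq[OF S SS(1) integrable_semicircle_square])
  then show fin: "gas_energy ?S < \<infinity>" by simp
  have "(\<integral>s. \<integral>t. ln \<bar>s - t\<bar> \<partial>?S \<partial>?S) = (\<integral>s. s\<^sup>2 + log_pot \<partial>?S)"
    by (rule integral_cong_AE)
       (use AE_semicircle_bounded has_bochner_semicircle_ln in \<open>auto elim!: eventually_mono simp: has_bochner_integral_iff\<close>)
  also have "\<dots> = (\<integral>s. s\<^sup>2 \<partial>?S) + log_pot"
    using integrable_semicircle_square S.prob_space by simp
  finally have mS: "mutual_log_energy ?S ?S = - (\<integral>s. s\<^sup>2 \<partial>?S) - log_pot" using SS(2) by simp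
  have main: "gas_energy ?S \<le> gas_energy M \<and> (gas_energy M \<le> gas_energy ?S \<longrightarrow> M = ?S)"
    if M: "real_distribution M" and f: "gas_energy M < \<infinity>" for M
  proof -
    interpret M: real_distribution M by (rule M)
    note fM = gas_energy_finiteD[OF M f]
    note MS = log_integrable_semicircle[OF M fM(2)]
    let ?D = "mutual_log_energy M M - 2 * mutual_log_energy M ?S + mutual_log_energy ?S ?S"
    have D: "0 \<le> ?D" "?D = 0 \<Longrightarrow> M = ?S"
      by (rule mutual_log_energy_positive_definite[OF M S fM(1) MS(1) SS(1)])+
    have eM: "gas_energy M = ennreal (mutual_log_energy M M + 2 * (\<integral>s. s\<^sup>2 \<partial>M))"
      by (rule gas_energy_eq[OF M fM])
    have "(\<integral>s. \<integral>t. ln \<bar>s - t\<bar> \<partial>?S \<partial>M) \<le> (\<integral>s. s\<^sup>2 + log_pot \<partial>M)"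
      by (rule integral_mono[OF MS(3)]) (use fM(2) semicircle_ln_upper in auto)
    also have "\<dots> = (\<integral>s. s\<^sup>2 \<partial>M) + log_pot"
      using fM(2) M.prob_space by simp
    \<comment> \<open>The Euler--Lagrange inequality bounds the cross term, leaving
      \<open>?D - 2 * log_pot\<close> minus the log energy of the semicircle law. Equality on
      [-1, 1], stored in \<open>mS\<close>, identifies this with \<open>?D\<close> plus the total
      energy of that law.\<close>
    finally have *: "mutual_log_energy M M + 2 * (\<integral>s. s\<^sup>2 \<partial>M) \<ge> ?D + (mutual_log_energy ?S ?S + 2 * (\<integral>s. s\<^sup>2 \<partial>?S))"
      using MS(2) mS by simp
    show ?thesis
    proof
      show "gas_energy ?S \<le> gas_energy M" unfolding eS eM using * D(1) by (intro ennreal_leI) simp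
      show "gas_energy M \<le> gas_energy ?S \<longrightarrow> M = ?S"
      proof
        assume le: "gas_energy M \<le> gas_energy ?S"
        \<comment> \<open>\<open>ennreal\<close> truncates negative numbers, so the comparison can
          be read back in the reals only after the energy of the semicircle law is known to be
          nonnegative.\<close>
        have "0 \<le> (\<integral>p. - ln \<bar>fst p - snd p\<bar> + ((fst p)\<^sup>2 + (snd p)\<^sup>2) \<partial>(?S \<Otimes>\<^sub>M ?S))"
          using gas_kernel_nonneg by (intro integral_nonneg_AE) auto
        interpret SS: two_distributions ?S ?S ..
        have "(\<integral>p. - ln \<bar>fst p - snd p\<bar> + ((fst p)\<^sup>2 + (snd p)\<^sup>2) \<partial>(?S \<Otimes>\<^sub>M ?S)) = mutual_log_energy ?S ?S + ((\<integral>s. s\<^sup>2 \<partial>?S) + (\<integral>s. s\<^sup>2 \<partial>?S))"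
          using SS.integrable_fst_snd_square[OF integrable_semicircle_square integrable_semicircle_square] SS(1)
          unfolding log_integrable_def mutual_log_energy_def has_bochner_integral_iff
          by (subst Bochner_Integration.integral_add) auto
        then have "0 \<le> mutual_log_energy ?S ?S + 2 * (\<integral>s. s\<^sup>2 \<partial>?S)"
          using \<open>0 \<le> (\<integral>p. _ p \<partial>_)\<close> by simp
        with le have "mutual_log_energy M M + 2 * (\<integral>s. s\<^sup>2 \<partial>M) \<le> mutual_log_energy ?S ?S + 2 * (\<integral>s. s\<^sup>2 \<partial>?S)"
          unfolding eS eM by (subst (asm) ennreal_le_iff) auto
        with * D(1) have "?D = 0" by linarith
        then show "M = ?S" by (rule D(2))
      qed
    qed
  qed
  show "gas_energy ?S \<le> gas_energy M" if "real_distribution M"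
    using main[OF that] by (cases "gas_energy M < \<infinity>") (auto simp: less_top[symmetric])
  show "M = ?S" if "real_distribution M" "gas_energy M \<le> gas_energy ?S"
    using main[OF that(1)] that(2) fin by (meson le_less_trans)
qed

section \<open>Planar measures are determined by their one-dimensional projections\<close>

lemma integral_density_normalised:
  fixes f w :: "'a \<Rightarrow> real"
  assumes "w \<in> borel_measurable M" "\<And>x. 0 \<le> w x" "f \<in> borel_measurable M" "0 < m"
  shows "integral\<^sup>L (density M (\<lambda>x. ennreal (w x / m))) f = (\<integral>x. w x * f x \<partial>M) / m"
  using assms by (subst integral_density) (auto intro!: AE_I2)

text \<open>At a = 0 the hypothesis on cosines gives both weighted measures the same mass m. Divided
  by m and pushed forward by \<open>X\<close> they are laws on the line with equal characteristic
  functions, and Levy's theorem applies. The bounds fit the weights 1, 2 + cos, 2 + sin and 1 +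
  indicator.\<close>

lemma weighted_marginal_eq:
  fixes w X :: "complex \<Rightarrow> real"
  assumes \<nu>: "prob_space \<nu>" "sets \<nu> = sets borel" and \<mu>: "prob_space \<mu>" "sets \<mu> = sets borel"
    and w [measurable]: "w \<in> borel_measurable borel" and w_bounds: "\<And>z. 1 \<le> w z" "\<And>z. w z \<le> 3"
    and X [measurable]: "X \<in> borel_measurable borel"
    and c: "\<And>a. (\<integral>z. w z * cos (a * X z) \<partial>\<nu>) = (\<integral>z. w z * cos (a * X z) \<partial>\<mu>)"
    and s: "\<And>a. (\<integral>z. w z * sin (a * X z) \<partial>\<nu>) = (\<integral>z. w z * sin (a * X z) \<partial>\<mu>)"
    and A: "A \<in> sets borel"
  shows "(\<integral>z. w z * indicator A (X z) \<partial>\<nu>) = (\<integral>z. w z * indicator A (X z) \<partial>\<mu>)"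
proof -
  define m where "m = (\<integral>z. w z \<partial>\<mu>)"
  have m\<nu>: "(\<integral>z. w z \<partial>\<nu>) = m" using c[of 0] by (simp add: m_def)
  have wpos: "0 \<le> w z" for z using w_bounds(1)[of z] by linarith
  define law where "law M = distr (density M (\<lambda>z. ennreal (w z / m))) borel X" for M
  have int: "integrable M w" if "prob_space M" "sets M = sets borel" for M
  proof -
    interpret prob_space M by fact
    show ?thesis using w_bounds wpos that(2)
      by (intro integrable_const_bound[where B=3]) (auto simp: measurable_cong_sets[OF that(2) refl])
  qed
  have mpos: "0 < m"
  proof -
    interpret prob_space \<mu> by fact
    have "(\<integral>z. 1 \<partial>\<mu>) \<le> (\<integral>z. w z \<partial>\<mu>)"
      using int[OF \<mu>] w_bounds by (intro integral_mono) auto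
    then show ?thesis by (simp add: m_def prob_space)
  qed
  have meas: "f \<in> borel_measurable M" if "f \<in> borel_measurable borel" "sets M = sets borel" for f :: "complex \<Rightarrow> real" and M
    using that by (simp add: measurable_cong_sets[OF that(2) refl])
  have rd: "real_distribution (law M)" if M: "prob_space M" "sets M = sets borel" and wm: "(\<integral>z. w z \<partial>M) = m" for M
  proof -
    have "(\<integral>\<^sup>+ z. ennreal (w z / m) \<partial>M) = ennreal (\<integral>z. w z / m \<partial>M)"
      using int[OF M] mpos wpos by (intro nn_integral_eq_integral) auto
    also have "\<dots> = 1" using wm mpos by simp
    finally have "prob_space (density M (\<lambda>z. ennreal (w z / m)))"
      using meas[OF w M(2)] by (intro prob_spaceI) (simp add: emeasure_density)
    then have "prob_space (law M)" unfolding law_def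
      using meas[OF X M(2)] by (intro prob_space.prob_space_distr) auto
    then show ?thesis by (simp add: real_distribution_def real_distribution_axioms_def law_def)
  qed
  have int_law: "integral\<^sup>L (law M) f = (\<integral>z. w z * f (X z) \<partial>M) / m"
    if "sets M = sets borel" "f \<in> borel_measurable borel" for M f
    unfolding law_def using that wpos mpos meas[OF X that(1)] meas[OF w that(1)]
    by (subst integral_distr) (auto intro!: integral_density_normalised)
  note r\<nu> = rd[OF \<nu> m\<nu>] and r\<mu> = rd[OF \<mu> m_def[symmetric]]
  have "Re (char (law \<nu>) a) = Re (char (law \<mu>) a) \<and> Im (char (law \<nu>) a) = Im (char (law \<mu>) a)" for a
  proof -
    interpret n: real_distribution "law \<nu>" by (rule r\<nu>)
    interpret m: real_distribution "law \<mu>" by (rule r\<mu>)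
    have "complex_integrable (law \<nu>) (\<lambda>s. iexp (a * s))" "complex_integrable (law \<mu>) (\<lambda>s. iexp (a * s))"
      by (rule n.integrable_iexp m.integrable_iexp; simp)+
    note integral_Re[OF this(1)] integral_Im[OF this(1)] integral_Re[OF this(2)] integral_Im[OF this(2)]
    then show ?thesis
      by (simp add: char_def Re_exp Im_exp int_law \<nu> \<mu> c s)
  qed
  then have "char (law \<nu>) = char (law \<mu>)" by (intro ext complex_eqI) auto
  then have "law \<nu> = law \<mu>" by (rule Levy_uniqueness[OF r\<nu> r\<mu>])
  then have "integral\<^sup>L (law \<nu>) (indicator A) = (integral\<^sup>L (law \<mu>) (indicator A) :: real)" by simp
  then show ?thesis using int_law[OF \<nu>(2), of "indicator A"] int_law[OF \<mu>(2), of "indicator A"] A mpos by simp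
qed

lemma complex_measure_eqI:
  assumes \<nu>: "prob_space \<nu>" "sets \<nu> = sets (borel :: complex measure)" and \<mu>: "prob_space \<mu>" "sets \<mu> = sets borel"
    and rect: "\<And>A B. A \<in> sets borel \<Longrightarrow> B \<in> sets borel \<Longrightarrow>
      measure \<nu> {z. Re z \<in> A \<and> Im z \<in> B} = measure \<mu> {z. Re z \<in> A \<and> Im z \<in> B}"
  shows "\<nu> = \<mu>"
proof -
  let ?f = "\<lambda>z. (Re z, Im z)" and ?g = "\<lambda>p. Complex (fst p) (snd p)"
  let ?B = "borel \<Otimes>\<^sub>M borel :: (real \<times> real) measure"
  have f: "?f \<in> M \<rightarrow>\<^sub>M ?B" if "sets M = sets borel" for M
    by (subst measurable_cong_sets[OF that refl]) measurable
  have "continuous_on UNIV ?g" by (simp add: Complex_eq) (intro continuous_intros)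
  then have "?g \<in> borel_measurable borel" by (rule borel_measurable_continuous_onI)
  then have g: "?g \<in> ?B \<rightarrow>\<^sub>M borel" by (simp add: borel_prod)
  have recover: "distr (distr M ?B ?f) borel ?g = M" if "sets M = sets borel" for M
    using f[OF that] g that by (subst distr_distr) (auto simp: comp_def distr_id2)
  have "distr \<nu> ?B ?f = distr \<mu> ?B ?f"
  proof (rule measure_eqI_generator_eq[OF Int_stable_pair_measure_generator[of borel borel]])
    interpret n: prob_space \<nu> by fact
    interpret m: prob_space \<mu> by fact
    fix R :: "(real \<times> real) set" assume "R \<in> {a \<times> b |a b. a \<in> sets borel \<and> b \<in> sets borel}"
    then obtain A B where R: "R = A \<times> B" "A \<in> sets borel" "B \<in> sets borel" by auto
    then have RB: "R \<in> sets ?B" by auto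
    have e: "emeasure (distr M ?B ?f) R = emeasure M {z. Re z \<in> A \<and> Im z \<in> B}" if "sets M = sets borel" for M
    proof -
      have "?f -` R \<inter> space M = {z. Re z \<in> A \<and> Im z \<in> B}"
        using sets_eq_imp_space_eq[OF that] by (auto simp: R)
      then show ?thesis by (simp only: emeasure_distr[OF f[OF that] RB])
    qed
    show "emeasure (distr \<nu> ?B ?f) R = emeasure (distr \<mu> ?B ?f) R"
      unfolding e[OF \<nu>(2)] e[OF \<mu>(2)] n.emeasure_eq_measure m.emeasure_eq_measure rect[OF R(2,3)] ..
  next
    show "range (\<lambda>i::nat. UNIV \<times> UNIV) \<subseteq> {a \<times> b |a b. a \<in> sets borel \<and> b \<in> sets (borel :: real measure)}"
      by (rule image_subsetI, rule CollectI, intro exI conjI, rule refl) auto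
    interpret n: prob_space "distr \<nu> ?B ?f" by (rule prob_space.prob_space_distr[OF \<nu>(1) f[OF \<nu>(2)]])
    show "emeasure (distr \<nu> ?B ?f) (UNIV \<times> UNIV) \<noteq> \<infinity>" by simp
  qed (auto simp: sets_pair_measure)
  then have "distr (distr \<nu> ?B ?f) borel ?g = distr (distr \<mu> ?B ?f) borel ?g" by (rule arg_cong)
  then show ?thesis unfolding recover[OF \<nu>(2)] recover[OF \<mu>(2)] .
qed

text \<open>The one-dimensional uniqueness theorem is applied twice: first to the real part, with a weight
  depending on the imaginary part, then to the imaginary part.\<close>

theorem complex_measure_eqI_trig:
  assumes \<nu>: "prob_space \<nu>" "sets \<nu> = sets (borel :: complex measure)" and \<mu>: "prob_space \<mu>" "sets \<mu> = sets borel"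
    and c: "\<And>a b. (\<integral>z. cos (a * Re z + b * Im z) \<partial>\<nu>) = (\<integral>z. cos (a * Re z + b * Im z) \<partial>\<mu>)"
    and s: "\<And>a b. (\<integral>z. sin (a * Re z + b * Im z) \<partial>\<nu>) = (\<integral>z. sin (a * Re z + b * Im z) \<partial>\<mu>)"
  shows "\<nu> = \<mu>"
proof (rule complex_measure_eqI[OF \<nu> \<mu>])
  fix A B :: "real set" assume A [measurable]: "A \<in> sets borel" and B [measurable]: "B \<in> sets borel"
  have meas: "f \<in> borel_measurable M" if "f \<in> borel_measurable borel" "sets M = sets borel" for f :: "complex \<Rightarrow> real" and M
    using that by (simp add: measurable_cong_sets[OF that(2) refl])
  have int: "integrable M f" if "prob_space M" "sets M = sets borel" "f \<in> borel_measurable borel" "\<And>z. \<bar>f z\<bar> \<le> 1"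
    for f :: "complex \<Rightarrow> real" and M
  proof -
    interpret prob_space M by fact
    show ?thesis using that by (intro integrable_const_bound[where B=1] meas[OF that(3,2)]) auto
  qed
  \<comment> \<open>The test functions with equal integrals. Integrability is recorded so that
    \<open>L\<close> is closed under linear combinations.\<close>
  define L where "L f \<longleftrightarrow> f \<in> borel_measurable borel \<and> (\<forall>M\<in>{\<nu>, \<mu>}. integrable M f) \<and> (\<integral>z. f z \<partial>\<nu>) = (\<integral>z. f z \<partial>\<mu>)" for f :: "complex \<Rightarrow> real"
  have LI: "L f" if "f \<in> borel_measurable borel" "\<And>z. \<bar>f z\<bar> \<le> 1" "(\<integral>z. f z \<partial>\<nu>) = (\<integral>z. f z \<partial>\<mu>)" for f
    using that \<nu> \<mu> by (auto simp: L_def intro!: int)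
  have Ladd: "L (\<lambda>z. f z + g z)" if "L f" "L g" for f g
    using that by (auto simp: L_def)
  have Lmult: "L (\<lambda>z. k * f z)" if "L f" for f k
    using that unfolding L_def by (simp add: borel_measurable_times)
  have LE: "(\<integral>z. f z \<partial>\<nu>) = (\<integral>z. f z \<partial>\<mu>)" if "L g" "\<And>z. f z = g z" for f g
    using that(1) by (simp add: that(2) L_def)
  have Lc: "L (\<lambda>z. cos (a * Re z + b * Im z))" and Ls: "L (\<lambda>z. sin (a * Re z + b * Im z))" for a b
    by (rule LI[OF _ _ c] LI[OF _ _ s]; simp)+
  have L1: "L (\<lambda>z. 1)" using Lc[of 0 0] by simp
  have marg: "L (\<lambda>z. indicator A (Re z) * cos (b * Im z))" "L (\<lambda>z. indicator A (Re z) * sin (b * Im z))" if A [measurable]: "A \<in> sets borel" for A b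
  proof -
    \<comment> \<open>Product-to-sum formulas bring products of functions of Re z and Im z back to
      the plane waves of the hypotheses.\<close>
    have prods: "cos (b * Im z) * cos (a * Re z) = (1/2) * cos (a * Re z + b * Im z) + (1/2) * cos (a * Re z + (- b) * Im z)"
      "cos (b * Im z) * sin (a * Re z) = (1/2) * sin (a * Re z + b * Im z) + (1/2) * sin (a * Re z + (- b) * Im z)"
      "sin (b * Im z) * cos (a * Re z) = (1/2) * sin (a * Re z + b * Im z) + (- (1/2)) * sin (a * Re z + (- b) * Im z)"
      "sin (b * Im z) * sin (a * Re z) = (1/2) * cos (a * Re z + (- b) * Im z) + (- (1/2)) * cos (a * Re z + b * Im z)" for a z
      by (simp_all add: cos_add sin_add cos_diff sin_diff algebra_simps)
    have prodL: "L (\<lambda>z. cos (b * Im z) * cos (a * Re z))" "L (\<lambda>z. cos (b * Im z) * sin (a * Re z))"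
       "L (\<lambda>z. sin (b * Im z) * cos (a * Re z))" "L (\<lambda>z. sin (b * Im z) * sin (a * Re z))" for a
      unfolding prods by (intro Ladd Lmult Lc Ls)+
    have 1: "(\<integral>z. (1::real) * indicator A (Re z) \<partial>\<nu>) = (\<integral>z. (1::real) * indicator A (Re z) \<partial>\<mu>)"
    proof (rule weighted_marginal_eq[OF \<nu> \<mu> _ _ _ _ _ _ A])
      show "(\<integral>z. 1 * cos (a * Re z) \<partial>\<nu>) = (\<integral>z. 1 * cos (a * Re z) \<partial>\<mu>)" "(\<integral>z. 1 * sin (a * Re z) \<partial>\<nu>) = (\<integral>z. 1 * sin (a * Re z) \<partial>\<mu>)" for a
        by (rule LE[OF Lc[of a 0]] LE[OF Ls[of a 0]]; simp)+
    qed auto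
    have LA: "L (\<lambda>z. indicator A (Re z))" by (rule LI) (use 1 in auto)
    \<comment> \<open>The cosine is shifted by 2 to become a positive weight; the shift is removed
      later by linearity.\<close>
    have 2: "(\<integral>z. (2 + cos (b * Im z)) * indicator A (Re z) \<partial>\<nu>) = (\<integral>z. (2 + cos (b * Im z)) * indicator A (Re z) \<partial>\<mu>)"
    proof (rule weighted_marginal_eq[OF \<nu> \<mu> _ _ _ _ _ _ A])
      show "(\<integral>z. (2 + cos (b * Im z)) * cos (a * Re z) \<partial>\<nu>) = (\<integral>z. (2 + cos (b * Im z)) * cos (a * Re z) \<partial>\<mu>)" for a
        by (rule LE[OF Ladd[OF Lmult[OF Lc[of a 0], of 2] prodL(1)[of a]]])
           (simp add: distrib_right)
      show "(\<integral>z. (2 + cos (b * Im z)) * sin (a * Re z) \<partial>\<nu>) = (\<integral>z. (2 + cos (b * Im z)) * sin (a * Re z) \<partial>\<mu>)" for a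
        by (rule LE[OF Ladd[OF Lmult[OF Ls[of a 0], of 2] prodL(2)[of a]]])
           (simp add: distrib_right)
      show "1 \<le> 2 + cos (b * Im z)" "2 + cos (b * Im z) \<le> 3" for z
        using cos_ge_minus_one[of "b * Im z"] cos_le_one[of "b * Im z"] by linarith+
    qed auto
    have 3: "(\<integral>z. (2 + sin (b * Im z)) * indicator A (Re z) \<partial>\<nu>) = (\<integral>z. (2 + sin (b * Im z)) * indicator A (Re z) \<partial>\<mu>)"
    proof (rule weighted_marginal_eq[OF \<nu> \<mu> _ _ _ _ _ _ A])
      show "(\<integral>z. (2 + sin (b * Im z)) * cos (a * Re z) \<partial>\<nu>) = (\<integral>z. (2 + sin (b * Im z)) * cos (a * Re z) \<partial>\<mu>)" for a
        by (rule LE[OF Ladd[OF Lmult[OF Lc[of a 0], of 2] prodL(3)[of a]]])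
           (simp add: distrib_right)
      show "(\<integral>z. (2 + sin (b * Im z)) * sin (a * Re z) \<partial>\<nu>) = (\<integral>z. (2 + sin (b * Im z)) * sin (a * Re z) \<partial>\<mu>)" for a
        by (rule LE[OF Ladd[OF Lmult[OF Ls[of a 0], of 2] prodL(4)[of a]]])
           (simp add: distrib_right)
      show "1 \<le> 2 + sin (b * Im z)" "2 + sin (b * Im z) \<le> 3" for z
        using sin_ge_minus_one[of "b * Im z"] sin_le_one[of "b * Im z"] by linarith+
    qed auto
    \<comment> \<open>The factor 1/3 brings the function under the bound 1 that \<open>LI\<close>
      requires.\<close>
    have L2: "L (\<lambda>z. (1/3) * ((2 + g (b * Im z)) * indicator A (Re z)))"
      if "g \<in> borel_measurable borel" "\<And>x. \<bar>2 + g x\<bar> \<le> 3"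
        "(\<integral>z. (2 + g (b * Im z)) * indicator A (Re z) \<partial>\<nu>) = (\<integral>z. (2 + g (b * Im z)) * indicator A (Re z) \<partial>\<mu>)" for g :: "real \<Rightarrow> real"
    proof (rule LI)
      show "\<bar>(1/3) * ((2 + g (b * Im z)) * indicator A (Re z))\<bar> \<le> 1" for z
        using that(2)[of "b * Im z"] by (auto simp: indicator_def)
      show "(\<lambda>z. (1/3) * ((2 + g (b * Im z)) * indicator A (Re z))) \<in> borel_measurable borel"
        using that(1) by measurable
    qed (simp only: integral_mult_right_zero that(3))
    have "\<bar>2 + cos x\<bar> \<le> 3" "\<bar>2 + sin x\<bar> \<le> 3" for x :: real
      using cos_ge_minus_one[of x] cos_le_one[of x] sin_ge_minus_one[of x] sin_le_one[of x] by linarith+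
    note L2c = L2[OF _ this(1) 2] and L2s = L2[OF _ this(2) 3]
    from L2c have L2c: "L (\<lambda>z. (1/3) * ((2 + cos (b * Im z)) * indicator A (Re z)))" by simp
    from L2s have L2s: "L (\<lambda>z. (1/3) * ((2 + sin (b * Im z)) * indicator A (Re z)))" by simp
    from Ladd[OF Lmult[OF L2c, of 3] Lmult[OF LA, of "-2"]] show "L (\<lambda>z. indicator A (Re z) * cos (b * Im z))"
      by (simp add: algebra_simps)
    from Ladd[OF Lmult[OF L2s, of 3] Lmult[OF LA, of "-2"]] show "L (\<lambda>z. indicator A (Re z) * sin (b * Im z))"
      by (simp add: algebra_simps)
  qed
  have 1: "(\<integral>z. (1::real) * indicator B (Im z) \<partial>\<nu>) = (\<integral>z. (1::real) * indicator B (Im z) \<partial>\<mu>)"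
  proof (rule weighted_marginal_eq[OF \<nu> \<mu> _ _ _ _ _ _ B])
    show "(\<integral>z. 1 * cos (a * Im z) \<partial>\<nu>) = (\<integral>z. 1 * cos (a * Im z) \<partial>\<mu>)" "(\<integral>z. 1 * sin (a * Im z) \<partial>\<nu>) = (\<integral>z. 1 * sin (a * Im z) \<partial>\<mu>)" for a
      by (rule LE[OF Lc[of 0 a]] LE[OF Ls[of 0 a]]; simp)+
  qed auto
  have LB: "L (\<lambda>z. indicator B (Im z))" by (rule LI) (use 1 in auto)
  have 2: "(\<integral>z. (1 + indicator A (Re z)) * indicator B (Im z) \<partial>\<nu> :: real) = (\<integral>z. (1 + indicator A (Re z)) * indicator B (Im z) \<partial>\<mu>)"
  proof (rule weighted_marginal_eq[OF \<nu> \<mu> _ _ _ _ _ _ B])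
    show "(\<integral>z. (1 + indicator A (Re z)) * cos (a * Im z) \<partial>\<nu>) = (\<integral>z. (1 + indicator A (Re z)) * cos (a * Im z) \<partial>\<mu>)" for a
      by (rule LE[OF Ladd[OF Lc[of 0 a] marg(1)[OF A, of a]]]) (simp add: distrib_right)
    show "(\<integral>z. (1 + indicator A (Re z)) * sin (a * Im z) \<partial>\<nu>) = (\<integral>z. (1 + indicator A (Re z)) * sin (a * Im z) \<partial>\<mu>)" for a
      by (rule LE[OF Ladd[OF Ls[of 0 a] marg(2)[OF A, of a]]]) (simp add: distrib_right)
  qed (auto simp: indicator_def)
  have "L (\<lambda>z. (1/2) * ((1 + indicator A (Re z)) * indicator B (Im z)))"
  proof (rule LI)
    show "\<bar>(1/2) * ((1 + indicator A (Re z)) * indicator B (Im z))\<bar> \<le> (1::real)" for z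
      by (auto simp: indicator_def)
  qed (measurable, simp only: integral_mult_right_zero 2)
  from Ladd[OF Lmult[OF this, of 2] Lmult[OF LB, of "-1"]]
  have "L (\<lambda>z. indicator A (Re z) * indicator B (Im z))" by (simp add: algebra_simps)
  then have "(\<integral>z. indicator {z. Re z \<in> A \<and> Im z \<in> B} z \<partial>\<nu>) = (\<integral>z. indicator {z. Re z \<in> A \<and> Im z \<in> B} z \<partial>\<mu> :: real)"
    by (rule LE) (auto simp: indicator_def)
  moreover have "{z. Re z \<in> A \<and> Im z \<in> B} \<in> sets borel" by measurable
  ultimately show "measure \<nu> {z. Re z \<in> A \<and> Im z \<in> B} = measure \<mu> {z. Re z \<in> A \<and> Im z \<in> B}"
    using \<nu>(2) \<mu>(2) sets_eq_imp_space_eq[OF \<nu>(2)] sets_eq_imp_space_eq[OF \<mu>(2)] by simp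
qed

section \<open>Projections of the ellipse\<close>

text \<open>On [0, pi] the map x -> cos 2x covers [-1, 1] twice. On each branch the density 2
  sin^2(2x) / pi, divided by the Jacobian 2 |sin 2x|, becomes sqrt(1 - q^2) / pi.\<close>

lemma nn_integral_semicircle:
  assumes f [measurable]: "f \<in> borel_measurable borel"
  shows "(\<integral>\<^sup>+ t. f t \<partial>semicircle) = (\<integral>\<^sup>+ q. f q * ennreal (2 / pi * sqrt (1 - q\<^sup>2)) * indicator {-1..1} q \<partial>lborel)"
proof -
  let ?w = "\<lambda>q. ennreal (sqrt (1 - q\<^sup>2) / pi)"
  have sq: "sqrt (1 - (cos (2 * x))\<^sup>2) = \<bar>sin (2 * x)\<bar>" for x :: real
    using sin_squared_eq[of "2 * x"] by (metis real_sqrt_abs)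
  have c4: "1 - cos (4 * x) = 2 * (sin (2 * x))\<^sup>2" for x :: real
    using cos_double_sin[of "2 * x"] by simp
  have dens: "ennreal (on_period (\<lambda>x. (1 - 1 * cos (2 * real 2 * x)) / pi) x) = indicator {0..pi} x * ennreal (2 * (sin (2 * x))\<^sup>2 / pi)" for x
    by (auto simp: on_period_def indicator_def c4)
  have 1: "(\<integral>\<^sup>+ x. f (cos (2 * x)) * ennreal (2 * (sin (2 * x))\<^sup>2 / pi) * indicator {pi/2..pi} x \<partial>lborel)
     = (\<integral>\<^sup>+ q. f q * ?w q * indicator {-1..1} q \<partial>lborel)"
  proof -
    have s: "sin (2 * x) \<le> 0" if "x \<in> {pi/2..pi}" for x
    proof -
      have "0 \<le> sin (2 * x - pi)" using that by (intro sin_ge_zero) auto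
      then show ?thesis by (simp add: sin_diff)
    qed
    have "(\<integral>\<^sup>+ q. f q * ?w q * indicator {cos (2 * (pi/2))..cos (2 * pi)} q \<partial>lborel)
       = (\<integral>\<^sup>+ x. f (cos (2 * x)) * ?w (cos (2 * x)) * ennreal (- 2 * sin (2 * x)) * indicator {pi/2..pi} x \<partial>lborel)"
    proof (rule nn_integral_substitution_aux[where f="\<lambda>q. f q * ?w q" and g="\<lambda>x. cos (2 * x)" and g'="\<lambda>x. - 2 * sin (2 * x)"])
      show "((\<lambda>x. cos (2 * x)) has_real_derivative - 2 * sin (2 * x)) (at x)" for x :: real
        by (auto intro!: derivative_eq_intros)
      show "continuous_on {pi/2..pi} (\<lambda>x::real. - 2 * sin (2 * x))" by (intro continuous_intros)
      show "0 \<le> - 2 * sin (2 * x)" if "x \<in> {pi/2..pi}" for x using s[OF that] by simp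
    qed simp_all
    also have "\<dots> = (\<integral>\<^sup>+ x. f (cos (2 * x)) * ennreal (2 * (sin (2 * x))\<^sup>2 / pi) * indicator {pi/2..pi} x \<partial>lborel)"
    proof (intro nn_integral_cong)
      fix x
      show "f (cos (2 * x)) * ?w (cos (2 * x)) * ennreal (- 2 * sin (2 * x)) * indicator {pi/2..pi} x
          = f (cos (2 * x)) * ennreal (2 * (sin (2 * x))\<^sup>2 / pi) * indicator {pi/2..pi} x"
      proof (cases "x \<in> {pi/2..pi}")
        case True
        have "?w (cos (2 * x)) * ennreal (- 2 * sin (2 * x)) = ennreal (2 * (sin (2 * x))\<^sup>2 / pi)"
          using s[OF True] unfolding power2_minus sq by (subst ennreal_mult[symmetric]) (auto simp: power2_eq_square divide_nonpos_pos)
        then show ?thesis by (simp add: mult.assoc)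
      qed simp
    qed
    finally show ?thesis by simp
  qed
  have 2: "(\<integral>\<^sup>+ x. f (cos (2 * x)) * ennreal (2 * (sin (2 * x))\<^sup>2 / pi) * indicator {0..pi/2} x \<partial>lborel)
     = (\<integral>\<^sup>+ q. f (- q) * ?w q * indicator {-1..1} q \<partial>lborel)"
  proof -
    have s: "0 \<le> sin (2 * x)" if "x \<in> {0..pi/2}" for x
      using that by (intro sin_ge_zero) auto
    have "(\<integral>\<^sup>+ q. f (- q) * ?w q * indicator {- cos (2 * 0)..- cos (2 * (pi/2))} q \<partial>lborel)
       = (\<integral>\<^sup>+ x. f (- (- cos (2 * x))) * ?w (- cos (2 * x)) * ennreal (2 * sin (2 * x)) * indicator {0..pi/2} x \<partial>lborel)"
    \<comment> \<open>The substitution rule wants a nondecreasing map, hence -cos 2x on the first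
      branch; the sign is removed by \<open>reflect\<close>.\<close>
    proof (rule nn_integral_substitution_aux[where f="\<lambda>q. f (- q) * ?w q" and g="\<lambda>x. - cos (2 * x)" and g'="\<lambda>x. 2 * sin (2 * x)"])
      show "((\<lambda>x. - cos (2 * x)) has_real_derivative 2 * sin (2 * x)) (at x)" for x :: real
        by (auto intro!: derivative_eq_intros)
      show "continuous_on {0..pi/2} (\<lambda>x::real. 2 * sin (2 * x))" by (intro continuous_intros)
      show "0 \<le> 2 * sin (2 * x)" if "x \<in> {0..pi/2}" for x using s[OF that] by simp
    qed simp_all
    also have "\<dots> = (\<integral>\<^sup>+ x. f (cos (2 * x)) * ennreal (2 * (sin (2 * x))\<^sup>2 / pi) * indicator {0..pi/2} x \<partial>lborel)"
    proof (intro nn_integral_cong)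
      fix x
      show "f (- (- cos (2 * x))) * ?w (- cos (2 * x)) * ennreal (2 * sin (2 * x)) * indicator {0..pi/2} x
          = f (cos (2 * x)) * ennreal (2 * (sin (2 * x))\<^sup>2 / pi) * indicator {0..pi/2} x"
      proof (cases "x \<in> {0..pi/2}")
        case True
        have "?w (- cos (2 * x)) * ennreal (2 * sin (2 * x)) = ennreal (2 * (sin (2 * x))\<^sup>2 / pi)"
          using s[OF True] unfolding power2_minus sq by (subst ennreal_mult[symmetric]) (auto simp: power2_eq_square divide_nonpos_pos)
        then show ?thesis by (simp add: mult.assoc)
      qed simp
    qed
    finally show ?thesis by simp
  qed
  have reflect: "(\<integral>\<^sup>+ q. f (- q) * ?w q * indicator {-1..1} q \<partial>lborel) = (\<integral>\<^sup>+ q. f q * ?w q * indicator {-1..1} q \<partial>lborel)"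
    by (subst nn_integral_real_affine[where c="-1" and t=0]) (auto intro!: nn_integral_cong simp: indicator_def)
  have "(\<integral>\<^sup>+ t. f t \<partial>semicircle) = (\<integral>\<^sup>+ x. f (cos (2 * x)) \<partial>angle_law 2 1)"
    unfolding semicircle_def by (subst nn_integral_distr) auto
  also have "\<dots> = (\<integral>\<^sup>+ x. f (cos (2 * x)) * ennreal (2 * (sin (2 * x))\<^sup>2 / pi) * indicator {0..pi} x \<partial>lborel)"
    unfolding angle_law_def
    by (subst nn_integral_density) (measurable, simp only: dens, intro nn_integral_cong, simp only: mult_ac)
  also have "\<dots> = (\<integral>\<^sup>+ x. f (cos (2 * x)) * ennreal (2 * (sin (2 * x))\<^sup>2 / pi) * indicator {0..pi/2} x +
     f (cos (2 * x)) * ennreal (2 * (sin (2 * x))\<^sup>2 / pi) * indicator {pi/2..pi} x \<partial>lborel)"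
  proof (rule nn_integral_cong_AE)
    show "AE x in lborel. f (cos (2 * x)) * ennreal (2 * (sin (2 * x))\<^sup>2 / pi) * indicator {0..pi} x =
      f (cos (2 * x)) * ennreal (2 * (sin (2 * x))\<^sup>2 / pi) * indicator {0..pi/2} x +
      f (cos (2 * x)) * ennreal (2 * (sin (2 * x))\<^sup>2 / pi) * indicator {pi/2..pi} x"
      using AE_lborel_singleton[of "pi/2"] by eventually_elim (auto simp: indicator_def)
  qed
  also have "\<dots> = (\<integral>\<^sup>+ q. f q * ?w q * indicator {-1..1} q \<partial>lborel) + (\<integral>\<^sup>+ q. f q * ?w q * indicator {-1..1} q \<partial>lborel)"
    by (subst nn_integral_add) (auto simp: 1 2 reflect)
  also have "\<dots> = (\<integral>\<^sup>+ q. 2 * (f q * ?w q * indicator {-1..1} q) \<partial>lborel)"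
    by (subst nn_integral_cmult) (auto simp: mult_2)
  also have "\<dots> = (\<integral>\<^sup>+ q. f q * ennreal (2 / pi * sqrt (1 - q\<^sup>2)) * indicator {-1..1} q \<partial>lborel)"
  proof (intro nn_integral_cong)
    fix q :: real
    show "2 * (f q * ?w q * indicator {-1..1} q) = f q * ennreal (2 / pi * sqrt (1 - q\<^sup>2)) * indicator {-1..1} q"
    proof (cases "q \<in> {-1..1}")
      case True
      then have "q\<^sup>2 \<le> 1" by (simp add: abs_square_le_1 abs_le_iff)
      then have "2 * ?w q = ennreal (2 / pi * sqrt (1 - q\<^sup>2))"
        by (subst ennreal_numeral[symmetric], subst ennreal_mult[symmetric]) (auto simp: field_simps)
      moreover have "2 * (f q * ?w q * indicator {-1..1} q) = f q * (2 * ?w q) * indicator {-1..1} q"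
        by (simp only: mult_ac)
      ultimately show ?thesis by simp
    qed simp
  qed
  finally show ?thesis .
qed

section \<open>Planar Lebesgue measure in coordinates\<close>

lemma lborel_complex: "distr (lborel \<Otimes>\<^sub>M lborel) borel (\<lambda>p. Complex (fst p) (snd p)) = lborel"
proof (rule lborel_eqI[symmetric])
  let ?g = "\<lambda>p. Complex (fst p) (snd p)"
  have "continuous_on UNIV ?g" by (simp add: Complex_eq) (intro continuous_intros)
  then have "?g \<in> borel_measurable borel" by (rule borel_measurable_continuous_onI)
  then have g: "?g \<in> lborel \<Otimes>\<^sub>M lborel \<rightarrow>\<^sub>M borel" by (simp add: lborel_prod)
  fix l u :: complex assume le: "\<And>b. b \<in> Basis \<Longrightarrow> l \<bullet> b \<le> u \<bullet> b"
  have "Re l \<le> Re u" "Im l \<le> Im u" using le[of 1] le[of \<i>] by (auto simp: Basis_complex_def)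
  have "?g -` box l u = {Re l<..<Re u} \<times> {Im l<..<Im u}"
    by (auto simp: in_box_complex_iff)
  then have "emeasure (distr (lborel \<Otimes>\<^sub>M lborel) borel ?g) (box l u) = emeasure (lborel \<Otimes>\<^sub>M lborel) ({Re l<..<Re u} \<times> {Im l<..<Im u})"
    using g by (subst emeasure_distr) (auto simp: space_pair_measure)
  also have "\<dots> = ennreal (Re u - Re l) * ennreal (Im u - Im l)"
    using \<open>Re l \<le> Re u\<close> \<open>Im l \<le> Im u\<close> by (subst lborel.emeasure_pair_measure_Times) auto
  also have "\<dots> = ennreal (\<Prod>b\<in>Basis. (u - l) \<bullet> b)"
    using \<open>Re l \<le> Re u\<close> \<open>Im l \<le> Im u\<close> by (simp add: Basis_complex_def ennreal_mult)
  finally show "emeasure (distr (lborel \<Otimes>\<^sub>M lborel) borel ?g) (box l u) = ennreal (\<Prod>b\<in>Basis. (u - l) \<bullet> b)" .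
qed simp

text \<open>The inner variable is x because, for cos phi nonzero, the projection is an invertible
  affine function of x at fixed y.\<close>

lemma nn_integral_lborel_complex:
  assumes f: "f \<in> borel_measurable borel"
  shows "(\<integral>\<^sup>+ z. f z \<partial>lborel) = (\<integral>\<^sup>+ y. \<integral>\<^sup>+ x. f (Complex x y) \<partial>lborel \<partial>lborel)"
proof -
  let ?g = "\<lambda>p. Complex (fst p) (snd p)"
  have "continuous_on UNIV ?g" by (simp add: Complex_eq) (intro continuous_intros)
  then have "?g \<in> borel_measurable borel" by (rule borel_measurable_continuous_onI)
  then have g: "?g \<in> lborel \<Otimes>\<^sub>M lborel \<rightarrow>\<^sub>M borel" by (simp add: lborel_prod)
  have "(\<integral>\<^sup>+ z. f z \<partial>lborel) = (\<integral>\<^sup>+ p. f (?g p) \<partial>(lborel \<Otimes>\<^sub>M lborel))"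
    by (subst lborel_complex[symmetric], subst nn_integral_distr[OF g]) (use f in auto)
  also have "\<dots> = (\<integral>\<^sup>+ y. \<integral>\<^sup>+ x. f (?g (x, y)) \<partial>lborel \<partial>lborel)"
    by (subst lborel_pair.nn_integral_snd[symmetric]) (auto intro!: measurable_compose[OF g f])
  finally show ?thesis by simp
qed

text \<open>The half-width of the ellipse in direction phi. Its square is pi times the density of
  angle_law 1 alpha: this coincidence is what makes every projection of the ellipse optimal.\<close>

definition direction_radius :: "real \<Rightarrow> real \<Rightarrow> real" where
  "direction_radius \<alpha> \<phi> = sqrt (1 - \<alpha> * cos (2 * \<phi>))"

definition direction_proj :: "real \<Rightarrow> real \<Rightarrow> complex \<Rightarrow> real" where
  "direction_proj \<alpha> \<phi> z = (cos \<phi> * Re z + sin \<phi> * Im z) / direction_radius \<alpha> \<phi>"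

lemma direction_radius_sq:
  assumes "\<bar>\<alpha>\<bar> < 1"
  shows "0 < direction_radius \<alpha> \<phi>" "(direction_radius \<alpha> \<phi>)\<^sup>2 = 1 - \<alpha> * cos (2 * \<phi>)"
    "1 - \<bar>\<alpha>\<bar> \<le> (direction_radius \<alpha> \<phi>)\<^sup>2"
proof -
  have "\<bar>\<alpha> * cos (2 * \<phi>)\<bar> \<le> \<bar>\<alpha>\<bar> * 1" unfolding abs_mult by (intro mult_left_mono) auto
  then have "1 - \<bar>\<alpha>\<bar> \<le> 1 - \<alpha> * cos (2 * \<phi>)" by linarith
  then show "0 < direction_radius \<alpha> \<phi>" "(direction_radius \<alpha> \<phi>)\<^sup>2 = 1 - \<alpha> * cos (2 * \<phi>)" "1 - \<bar>\<alpha>\<bar> \<le> (direction_radius \<alpha> \<phi>)\<^sup>2"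
    using assms by (auto simp: direction_radius_def)
qed

text \<open>Here x = (R q - s y) / c is the point at height y with normalised projection q.
  Completing the square in y, with R^2 = A c^2 + B s^2, shows the fibre over q to be an interval
  with centre B s q / R and half-length sqrt(A B) |c| sqrt(1 - q^2) / R when |q| <= 1, and empty
  otherwise.\<close>

lemma ellipse_fibre_iff:
  fixes A B c s R q y :: real
  assumes pos: "0 < A" "0 < B" "c \<noteq> 0" "0 < R" and R: "R\<^sup>2 = A * c\<^sup>2 + B * s\<^sup>2"
  shows "((R * q - s * y) / c)\<^sup>2 / A + y\<^sup>2 / B \<le> 1 \<longleftrightarrow> (R\<^sup>2 * y - B * s * R * q)\<^sup>2 \<le> A * B * c\<^sup>2 * R\<^sup>2 * (1 - q\<^sup>2)"
proof -
  let ?K = "A * B * c\<^sup>2 * R\<^sup>2"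
  have K: "0 < ?K" using pos by simp
  have "?K * (((R * q - s * y) / c)\<^sup>2 / A + y\<^sup>2 / B) = B * R\<^sup>2 * (R * q - s * y)\<^sup>2 + A * c\<^sup>2 * R\<^sup>2 * y\<^sup>2"
    using pos by (simp add: field_simps)
  also have "\<dots> = R\<^sup>2 * ((A * c\<^sup>2 + B * s\<^sup>2) * y\<^sup>2 - 2 * B * R * q * s * y + B * R\<^sup>2 * q\<^sup>2)"
    by (simp add: power2_eq_square algebra_simps)
  also have "\<dots> = R\<^sup>2 * (R\<^sup>2 * y\<^sup>2 - 2 * B * R * q * s * y + B * (A * c\<^sup>2 + B * s\<^sup>2) * q\<^sup>2)"
    by (simp only: R)
  also have "\<dots> = (R\<^sup>2 * y - B * s * R * q)\<^sup>2 + ?K * q\<^sup>2"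
    by (simp add: power2_eq_square algebra_simps)
  finally have e: "?K * (((R * q - s * y) / c)\<^sup>2 / A + y\<^sup>2 / B) = (R\<^sup>2 * y - B * s * R * q)\<^sup>2 + ?K * q\<^sup>2" .
  have "((R * q - s * y) / c)\<^sup>2 / A + y\<^sup>2 / B \<le> 1 \<longleftrightarrow> ?K * (((R * q - s * y) / c)\<^sup>2 / A + y\<^sup>2 / B) \<le> ?K * 1"
    using K by (simp only: mult_le_cancel_left_pos)
  also have "\<dots> \<longleftrightarrow> (R\<^sup>2 * y - B * s * R * q)\<^sup>2 \<le> ?K * (1 - q\<^sup>2)"
    unfolding e by (simp add: algebra_simps)
  finally show ?thesis .
qed

lemma ellipse_domain_borel [measurable]: "ellipse_domain \<alpha> \<in> sets borel"
  unfolding ellipse_domain_def by measurable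

lemma direction_proj_borel [measurable]: "direction_proj \<alpha> \<phi> \<in> borel_measurable borel"
  unfolding direction_proj_def[abs_def] by measurable

text \<open>The Jacobian |R / c| of x -> q cancels the dependence of the fibre length on the
  direction. What is left, 2 sqrt(A B) sqrt(1 - q^2), is the area times the semicircle
  density.\<close>

lemma nn_integral_ellipse_proj:
  assumes \<alpha>: "\<bar>\<alpha>\<bar> < 1" and c: "cos \<phi> \<noteq> 0" and f [measurable]: "f \<in> borel_measurable borel"
  shows "(\<integral>\<^sup>+ z. f (direction_proj \<alpha> \<phi> z) * indicator (ellipse_domain \<alpha>) z \<partial>lborel)
     = ennreal (pi * sqrt ((1 - \<alpha>) * (1 + \<alpha>))) * (\<integral>\<^sup>+ t. f t \<partial>semicircle)"
proof -
  define R where "R = direction_radius \<alpha> \<phi>"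
  define A B c s where "A = 1 - \<alpha>" and "B = 1 + \<alpha>" and "c = cos \<phi>" and "s = sin \<phi>"
  have pos: "0 < A" "0 < B" "c \<noteq> 0" "0 < R"
    using \<alpha> c direction_radius_sq(1)[OF \<alpha>] by (auto simp: A_def B_def c_def R_def)
  have R2: "R\<^sup>2 = A * c\<^sup>2 + B * s\<^sup>2"
    using direction_radius_sq(2)[OF \<alpha>, of \<phi>, unfolded cos_double] sin_cos_squared_add[of \<phi>]
    by (simp add: R_def A_def B_def c_def s_def algebra_simps)
  let ?E = "\<lambda>x y. indicator (ellipse_domain \<alpha>) (Complex x y) :: ennreal"
  \<comment> \<open>The ellipse in the coordinates (q, y); as a closed set it is jointly measurable,
    which the exchange of the two integrals requires.\<close>
  define T where "T = {p. (R\<^sup>2 * snd p - B * s * R * fst p)\<^sup>2 \<le> A * B * c\<^sup>2 * R\<^sup>2 * (1 - (fst p)\<^sup>2)}"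
  have "closed T" unfolding T_def by (intro closed_Collect_le continuous_intros)
  then have T [measurable]: "T \<in> sets (borel \<Otimes>\<^sub>M borel)" unfolding borel_prod by (rule borel_closed)
  have T_iff: "(q, y) \<in> T \<longleftrightarrow> (R\<^sup>2 * y - B * s * R * q)\<^sup>2 \<le> A * B * c\<^sup>2 * R\<^sup>2 * (1 - q\<^sup>2)" for q y
    by (simp add: T_def)
  have fib: "?E ((R * q - s * y) / c) y = indicator T (q, y)" for q y
    using ellipse_fibre_iff[OF pos R2, of q y] by (simp add: indicator_def T_iff ellipse_domain_def A_def B_def)
  have Cm: "Complex x y = of_real x + \<i> * of_real y" for x y by (simp add: Complex_eq)
  have inner: "(\<integral>\<^sup>+ x. f (direction_proj \<alpha> \<phi> (Complex x y)) * ?E x y \<partial>lborel)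
      = (\<integral>\<^sup>+ q. ennreal \<bar>R / c\<bar> * (f q * ?E ((R * q - s * y) / c) y) \<partial>lborel)" for y
  proof -
    have "(\<integral>\<^sup>+ x. f (direction_proj \<alpha> \<phi> (Complex x y)) * ?E x y \<partial>lborel)
      = ennreal \<bar>R / c\<bar> * (\<integral>\<^sup>+ q. f (direction_proj \<alpha> \<phi> (Complex (- s * y / c + R / c * q) y)) * ?E (- s * y / c + R / c * q) y \<partial>lborel)"
      unfolding Cm using pos by (intro nn_integral_real_affine) (auto simp del: of_real_add)
    also have "\<dots> = ennreal \<bar>R / c\<bar> * (\<integral>\<^sup>+ q. f q * ?E ((R * q - s * y) / c) y \<partial>lborel)"
    proof -
      have "- s * y / c + R / c * q = (R * q - s * y) / c" for q using pos by (simp add: field_simps)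
      moreover have "direction_proj \<alpha> \<phi> (Complex ((R * q - s * y) / c) y) = q" for q
        using pos by (simp add: direction_proj_def R_def[symmetric] c_def[symmetric] s_def[symmetric])
      ultimately show ?thesis by simp
    qed
    also have "\<dots> = (\<integral>\<^sup>+ q. ennreal \<bar>R / c\<bar> * (f q * ?E ((R * q - s * y) / c) y) \<partial>lborel)"
      unfolding Cm by (subst nn_integral_cmult) (auto simp del: of_real_add of_real_diff of_real_mult of_real_divide)
    finally show ?thesis .
  qed
  have len: "(\<integral>\<^sup>+ y. indicator T (q, y) \<partial>lborel)
     = ennreal (2 * sqrt (A * B) * \<bar>c\<bar> / R * sqrt (1 - q\<^sup>2)) * indicator {-1..1} q" for q
  proof (cases "q \<in> {-1..1}")
    case True
    then have q: "0 \<le> 1 - q\<^sup>2" by (simp add: abs_square_le_1 abs_le_iff)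
    define h where "h = sqrt (A * B) * \<bar>c\<bar> * R * sqrt (1 - q\<^sup>2)"
    have h0: "0 \<le> h" using pos q by (simp add: h_def)
    have "h\<^sup>2 = A * B * c\<^sup>2 * R\<^sup>2 * (1 - q\<^sup>2)"
      using pos q by (simp add: h_def power_mult_distrib)
    then have "(R\<^sup>2 * y - B * s * R * q)\<^sup>2 \<le> A * B * c\<^sup>2 * R\<^sup>2 * (1 - q\<^sup>2) \<longleftrightarrow> \<bar>R\<^sup>2 * y - B * s * R * q\<bar> \<le> h" for y
      using h0 by (metis abs_le_square_iff abs_of_nonneg)
    also have "\<bar>R\<^sup>2 * y - B * s * R * q\<bar> \<le> h \<longleftrightarrow> (B * s * R * q - h) / R\<^sup>2 \<le> y \<and> y \<le> (B * s * R * q + h) / R\<^sup>2" for y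
      using pos by (auto simp: field_simps abs_le_iff)
    finally have iff: "(R\<^sup>2 * y - B * s * R * q)\<^sup>2 \<le> A * B * c\<^sup>2 * R\<^sup>2 * (1 - q\<^sup>2)
       \<longleftrightarrow> (B * s * R * q - h) / R\<^sup>2 \<le> y \<and> y \<le> (B * s * R * q + h) / R\<^sup>2" for y .
    have fibre_eq: "(indicator T (q, y) :: ennreal)
       = indicator {(B * s * R * q - h) / R\<^sup>2..(B * s * R * q + h) / R\<^sup>2} y" for y
      by (simp only: T_iff iff indicator_def atLeastAtMost_iff)
    have length_eq: "(B * s * R * q + h) / R\<^sup>2 - (B * s * R * q - h) / R\<^sup>2 = 2 * sqrt (A * B) * \<bar>c\<bar> / R * sqrt (1 - q\<^sup>2)"
      using pos by (simp add: h_def field_simps power2_eq_square)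
    have "(B * s * R * q - h) / R\<^sup>2 \<le> (B * s * R * q + h) / R\<^sup>2"
      using h0 by (intro divide_right_mono) auto
    from emeasure_lborel_Icc[OF this]
    have "(\<integral>\<^sup>+ y. indicator {(B * s * R * q - h) / R\<^sup>2..(B * s * R * q + h) / R\<^sup>2} y \<partial>lborel)
       = ennreal ((B * s * R * q + h) / R\<^sup>2 - (B * s * R * q - h) / R\<^sup>2)"
      by (subst nn_integral_indicator) auto
    then show ?thesis unfolding fibre_eq length_eq using True by simp
  next
    case False
    then have "1 - q\<^sup>2 < 0" using abs_square_le_1[of q] by (auto simp: abs_le_iff)
    then have "A * B * c\<^sup>2 * R\<^sup>2 * (1 - q\<^sup>2) < 0" using pos by (intro mult_pos_neg) auto
    then have "(q, y) \<notin> T" for y unfolding T_iff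
      using zero_le_power2[of "R\<^sup>2 * y - B * s * R * q"] by linarith
    then show ?thesis using False by simp
  qed
  have "(\<integral>\<^sup>+ z. f (direction_proj \<alpha> \<phi> z) * indicator (ellipse_domain \<alpha>) z \<partial>lborel)
     = (\<integral>\<^sup>+ y. \<integral>\<^sup>+ q. ennreal \<bar>R / c\<bar> * (f q * ?E ((R * q - s * y) / c) y) \<partial>lborel \<partial>lborel)"
    by (subst nn_integral_lborel_complex) (auto simp: inner)
  also have "\<dots> = (\<integral>\<^sup>+ q. \<integral>\<^sup>+ y. ennreal \<bar>R / c\<bar> * (f q * ?E ((R * q - s * y) / c) y) \<partial>lborel \<partial>lborel)"
    unfolding fib by (rule lborel_pair.Fubini') measurable
  also have "\<dots> = (\<integral>\<^sup>+ q. ennreal (pi * sqrt (A * B)) * (f q * ennreal (2 / pi * sqrt (1 - q\<^sup>2)) * indicator {-1..1} q) \<partial>lborel)"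
  proof (intro nn_integral_cong)
    fix q
    have "(\<integral>\<^sup>+ y. ennreal \<bar>R / c\<bar> * (f q * ?E ((R * q - s * y) / c) y) \<partial>lborel)
      = ennreal \<bar>R / c\<bar> * (f q * (ennreal (2 * sqrt (A * B) * \<bar>c\<bar> / R * sqrt (1 - q\<^sup>2)) * indicator {-1..1} q))"
      unfolding fib by (subst nn_integral_cmult, measurable, subst nn_integral_cmult, measurable, simp only: len)
    also have "\<dots> = ennreal (pi * sqrt (A * B)) * (f q * ennreal (2 / pi * sqrt (1 - q\<^sup>2)) * indicator {-1..1} q)"
    proof (cases "q \<in> {-1..1}")
      case True
      then have q: "0 \<le> 1 - q\<^sup>2" by (simp add: abs_square_le_1 abs_le_iff)
      have "\<bar>R / c\<bar> * (2 * sqrt (A * B) * \<bar>c\<bar> / R * sqrt (1 - q\<^sup>2)) = pi * sqrt (A * B) * (2 / pi * sqrt (1 - q\<^sup>2))"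
        using pos by (simp add: abs_divide)
      moreover have "0 \<le> \<bar>R / c\<bar>" "0 \<le> pi * sqrt (A * B)" using pos by auto
      ultimately have eq: "ennreal \<bar>R / c\<bar> * ennreal (2 * sqrt (A * B) * \<bar>c\<bar> / R * sqrt (1 - q\<^sup>2)) = ennreal (pi * sqrt (A * B)) * ennreal (2 / pi * sqrt (1 - q\<^sup>2))"
        by (simp only: ennreal_mult'[symmetric])
      have comm: "a * (u * (X * i)) = u * i * (a * X)" "Y * (u * Z * i) = u * i * (Y * Z)" for a u i X Y Z :: ennreal
        by (simp_all add: ac_simps)
      show ?thesis
        by (subst comm(1), subst comm(2), rule arg_cong[where f="\<lambda>t. f q * indicator {-1..1} q * t"], rule eq)
    qed simp
    finally show "(\<integral>\<^sup>+ y. ennreal \<bar>R / c\<bar> * (f q * ?E ((R * q - s * y) / c) y) \<partial>lborel)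
       = ennreal (pi * sqrt (A * B)) * (f q * ennreal (2 / pi * sqrt (1 - q\<^sup>2)) * indicator {-1..1} q)" .
  qed
  also have "\<dots> = ennreal (pi * sqrt (A * B)) * (\<integral>\<^sup>+ t. f t \<partial>semicircle)"
    by (subst nn_integral_cmult) (auto simp: nn_integral_semicircle)
  finally show ?thesis by (simp add: A_def B_def)
qed

lemma emeasure_ellipse_domain:
  assumes \<alpha>: "\<bar>\<alpha>\<bar> < 1"
  shows "emeasure lborel (ellipse_domain \<alpha>) = ennreal (pi * sqrt ((1 - \<alpha>) * (1 + \<alpha>)))"
proof -
  interpret prob_space semicircle by (rule prob_space_semicircle)
  show ?thesis
    using nn_integral_ellipse_proj[OF \<alpha>, of 0 "\<lambda>_. 1"] emeasure_space_1 by simp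
qed

lemma distr_ellipse_proj:
  assumes \<alpha>: "\<bar>\<alpha>\<bar> < 1" and c: "cos \<phi> \<noteq> 0"
  shows "distr (uniform_measure lborel (ellipse_domain \<alpha>)) borel (direction_proj \<alpha> \<phi>) = semicircle"
proof (rule measure_eqI)
  let ?m = "pi * sqrt ((1 - \<alpha>) * (1 + \<alpha>))"
  have m: "0 < ?m" using \<alpha> by simp
  fix A assume "A \<in> sets (distr (uniform_measure lborel (ellipse_domain \<alpha>)) borel (direction_proj \<alpha> \<phi>))"
  then have A [measurable]: "A \<in> sets borel" by simp
  have "emeasure (distr (uniform_measure lborel (ellipse_domain \<alpha>)) borel (direction_proj \<alpha> \<phi>)) A
     = emeasure lborel (ellipse_domain \<alpha> \<inter> (direction_proj \<alpha> \<phi> -` A)) / ennreal ?m"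
    using measurable_sets_borel[OF direction_proj_borel A] by (subst emeasure_distr) (auto simp: emeasure_ellipse_domain[OF \<alpha>])
  also have "emeasure lborel (ellipse_domain \<alpha> \<inter> (direction_proj \<alpha> \<phi> -` A))
      = (\<integral>\<^sup>+ z. indicator A (direction_proj \<alpha> \<phi> z) * indicator (ellipse_domain \<alpha>) z \<partial>lborel)"
  proof -
    have "ellipse_domain \<alpha> \<inter> (direction_proj \<alpha> \<phi> -` A) \<in> sets lborel"
      using measurable_sets_borel[OF direction_proj_borel A, of \<alpha> \<phi>] by auto
    then have "emeasure lborel (ellipse_domain \<alpha> \<inter> (direction_proj \<alpha> \<phi> -` A))
       = (\<integral>\<^sup>+ z. indicator (ellipse_domain \<alpha> \<inter> (direction_proj \<alpha> \<phi> -` A)) z \<partial>lborel)"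
      by simp
    also have "\<dots> = (\<integral>\<^sup>+ z. indicator A (direction_proj \<alpha> \<phi> z) * indicator (ellipse_domain \<alpha>) z \<partial>lborel)"
      by (intro nn_integral_cong) (auto split: split_indicator)
    finally show ?thesis .
  qed
  also have "\<dots> = ennreal ?m * emeasure semicircle A"
    by (subst nn_integral_ellipse_proj[OF \<alpha> c]) auto
  also have "\<dots> / ennreal ?m = emeasure semicircle A"
    using m by (subst mult.commute, intro ennreal_mult_divide_eq) auto
  finally show "emeasure (distr (uniform_measure lborel (ellipse_domain \<alpha>)) borel (direction_proj \<alpha> \<phi>)) A = emeasure semicircle A" .
qed simp

section \<open>The energy as an average over directions\<close>

text \<open>Integrating (f + C) + f^- + C^- = f^+ + C^+ avoids subtracting infinities. The lower
  bound on f then makes its negative part finite, and only finite terms are moved across.\<close>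

lemma ereal_integral_shift:
  assumes M: "prob_space M" and f [measurable]: "f \<in> borel_measurable M" and nonneg: "\<And>x. 0 \<le> f x + ereal C"
  shows "ereal_integral M f = enn2ereal (\<integral>\<^sup>+ x. e2ennreal (f x + ereal C) \<partial>M) - ereal C"
proof -
  interpret prob_space M by fact
  define G where "G = (\<integral>\<^sup>+ x. e2ennreal (f x + ereal C) \<partial>M)"
  define P where "P = (\<integral>\<^sup>+ x. e2ennreal (f x) \<partial>M)"
  define N where "N = (\<integral>\<^sup>+ x. e2ennreal (- f x) \<partial>M)"
  have pw: "e2ennreal (f x + ereal C) + e2ennreal (- f x) + ennreal (- C) = e2ennreal (f x) + ennreal C" for x
  proof (cases "f x")
    case (real r)
    then have r: "0 \<le> r + C" using nonneg[of x] by simp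
    have "ennreal (r + C) + ennreal (- r) + ennreal (- C) = ennreal r + ennreal C"
      using r by (cases "0 \<le> r"; cases "0 \<le> C") (auto simp: ennreal_neg simp flip: ennreal_plus)
    then show ?thesis by (simp add: real e2ennreal_ereal)
  next
    case PInf
    then show ?thesis by (simp add: e2ennreal_infty)
  next
    case MInf
    then show ?thesis using nonneg[of x] by simp
  qed
  have "G + N + ennreal (- C) = (\<integral>\<^sup>+ x. e2ennreal (f x + ereal C) + e2ennreal (- f x) + ennreal (- C) \<partial>M)"
    unfolding G_def N_def by (simp add: nn_integral_add emeasure_space_1)
  also have "\<dots> = P + ennreal C"
    unfolding pw P_def by (simp add: nn_integral_add emeasure_space_1)
  finally have eq: "G + N + ennreal (- C) = P + ennreal C" .
  have "e2ennreal (- f x) \<le> ennreal \<bar>C\<bar>" for x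
  proof (cases "f x")
    case (real r)
    then show ?thesis using nonneg[of x] by (auto simp: e2ennreal_ereal intro!: ennreal_leI)
  next
    case PInf
    then show ?thesis by (simp add: e2ennreal_neg)
  next
    case MInf
    then show ?thesis using nonneg[of x] by simp
  qed
  then have "N \<le> (\<integral>\<^sup>+ x. ennreal \<bar>C\<bar> \<partial>M)" unfolding N_def by (intro nn_integral_mono)
  then have N: "N \<le> ennreal \<bar>C\<bar>" by (simp add: emeasure_space_1)
  then have "N < \<top>" using ennreal_less_top le_less_trans by blast
  then obtain n where n: "N = ennreal n" "0 \<le> n" by (cases N) auto
  have "enn2ereal P - enn2ereal N = enn2ereal G - ereal C"
  proof (cases P)
    case top
    then have "G = \<top>" using eq n by (cases G) (auto simp flip: ennreal_plus)
    then show ?thesis using top n by (simp add: enn2ereal_ennreal)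
  next
    case (real p)
    have "G + N + ennreal (- C) \<noteq> \<top>" unfolding eq real by simp
    then have "G \<noteq> \<top>" by auto
    then obtain g where g: "G = ennreal g" "0 \<le> g" by (cases G) auto
    have "p - n = g - C"
      using eq real g n by (cases "0 \<le> C") (auto simp: ennreal_neg simp flip: ennreal_plus)
    then show ?thesis using real g n by (simp add: enn2ereal_ennreal)
  qed
  then show ?thesis by (simp add: ereal_integral_def P_def N_def G_def)
qed

lemma W_kernel_borel [measurable]: "W_kernel \<alpha> \<in> borel_measurable borel"
  unfolding W_kernel_def[abs_def] by measurable

lemma direction_proj_diff: "direction_proj \<alpha> \<phi> z - direction_proj \<alpha> \<phi> w = direction_proj \<alpha> \<phi> (z - w)"
  by (simp add: direction_proj_def diff_divide_distrib[symmetric] algebra_simps)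

lemma has_bochner_on_period_sin:
  assumes "k > 0" shows "has_bochner_integral lborel (on_period (\<lambda>x. sin (2 * real k * x))) 0"
proof -
  have "has_bochner_integral lborel (\<lambda>x. sin (2 * real k * x) * indicator {0..pi} x)
      (- cos (2 * real k * pi) / (2 * real k) - (- cos (2 * real k * 0) / (2 * real k)))"
    using assms by (intro has_bochner_integral_FTC_Icc_real) (auto intro!: derivative_eq_intros)
  then show ?thesis
    using cos_npi[of "2 * k"] by (simp add: on_period_def[abs_def] mult.commute)
qed

text \<open>The squared radius in the denominator cancels the density, and the harmonics cos 2x and
  sin 2x of the remaining square integrate to 0.\<close>

lemma has_bochner_direction_proj_square:
  assumes \<alpha>: "\<bar>\<alpha>\<bar> < 1"
  shows "has_bochner_integral (angle_law 1 \<alpha>) (\<lambda>\<phi>. (direction_proj \<alpha> \<phi> z)\<^sup>2) ((cmod z)\<^sup>2 / 2)"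
proof -
  have "has_bochner_integral lborel (\<lambda>x. on_period (\<lambda>x. (cmod z)\<^sup>2 / 2) x + (((Re z)\<^sup>2 - (Im z)\<^sup>2) / 2 * on_period (\<lambda>x. cos (2 * real 1 * x)) x
      + Re z * Im z * on_period (\<lambda>x. sin (2 * real 1 * x)) x)) ((cmod z)\<^sup>2 / 2 * pi + (((Re z)\<^sup>2 - (Im z)\<^sup>2) / 2 * 0 + Re z * Im z * 0))"
    by (intro has_bochner_integral_add has_bochner_integral_mult_right has_bochner_on_period_const
      has_bochner_on_period_cos has_bochner_on_period_sin) auto
  moreover have "on_period (\<lambda>x. (cmod z)\<^sup>2 / 2) x + (((Re z)\<^sup>2 - (Im z)\<^sup>2) / 2 * on_period (\<lambda>x. cos (2 * real 1 * x)) x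
      + Re z * Im z * on_period (\<lambda>x. sin (2 * real 1 * x)) x)
     = on_period (\<lambda>x. (direction_proj \<alpha> x z)\<^sup>2 * (1 - \<alpha> * cos (2 * real 1 * x))) x" for x
  proof -
    have "(direction_proj \<alpha> x z)\<^sup>2 * (1 - \<alpha> * cos (2 * x)) = (cos x * Re z + sin x * Im z)\<^sup>2"
      using direction_radius_sq(1)[OF \<alpha>, of x] by (simp add: direction_proj_def power_divide flip: direction_radius_sq(2)[OF \<alpha>])
    also have "\<dots> = (cos x)\<^sup>2 * (Re z)\<^sup>2 + (sin x)\<^sup>2 * (Im z)\<^sup>2 + Re z * Im z * (2 * sin x * cos x)"
      by (simp add: power2_eq_square algebra_simps)
    also have "\<dots> = (cmod z)\<^sup>2 / 2 + (((Re z)\<^sup>2 - (Im z)\<^sup>2) / 2 * cos (2 * x) + Re z * Im z * sin (2 * x))"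
      unfolding cos_double sin_double cmod_power2 sin_squared_eq by (simp add: field_simps)
    finally show ?thesis by (simp add: on_period_def indicator_def)
  qed
  ultimately have "has_bochner_integral lborel (on_period (\<lambda>x. (direction_proj \<alpha> x z)\<^sup>2 * (1 - \<alpha> * cos (2 * real 1 * x)))) ((cmod z)\<^sup>2 / 2 * pi)"
    by simp
  then have "has_bochner_integral (angle_law 1 \<alpha>) (\<lambda>\<phi>. (direction_proj \<alpha> \<phi> z)\<^sup>2) ((cmod z)\<^sup>2 / 2 * pi / pi)"
    using \<alpha> by (intro has_bochner_angle_law) (auto simp: direction_proj_def[abs_def] direction_radius_def[abs_def])
  then show ?thesis by simp
qed

text \<open>The constant between the planar kernel and the average: the integral comes from the
  normalisation of the projections, \<open>mean_ln_sin\<close> from the mean logarithm, and \<alpha>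
  / 2 from cos(2 \<theta>) = 1 - 2 x^2 / |z|^2.\<close>

definition energy_shift :: "real \<Rightarrow> real" where
  "energy_shift \<alpha> = (\<integral>\<phi>. ln (direction_radius \<alpha> \<phi>) \<partial>angle_law 1 \<alpha>) - mean_ln_sin - \<alpha> / 2"

lemma integrable_ln_direction_radius:
  assumes \<alpha>: "\<bar>\<alpha>\<bar> < 1" shows "integrable (angle_law 1 \<alpha>) (\<lambda>\<phi>. ln (direction_radius \<alpha> \<phi>))"
proof -
  interpret prob_space "angle_law 1 \<alpha>" using \<alpha> by (intro prob_space_angle_law) auto
  have "\<bar>ln (direction_radius \<alpha> \<phi>)\<bar> \<le> \<bar>ln (1 - \<bar>\<alpha>\<bar>)\<bar> + ln 2" for \<phi>
  proof -
    let ?R = "direction_radius \<alpha> \<phi>"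
    have "\<bar>\<alpha> * cos (2 * \<phi>)\<bar> \<le> 1 * 1" unfolding abs_mult using \<alpha> by (intro mult_mono) auto
    then have "?R\<^sup>2 \<le> 2" using direction_radius_sq(2)[OF \<alpha>, of \<phi>] by linarith
    then have u: "ln (?R\<^sup>2) \<le> ln 2" using direction_radius_sq(1)[OF \<alpha>, of \<phi>] by (subst ln_le_cancel_iff) auto
    have l: "ln (1 - \<bar>\<alpha>\<bar>) \<le> ln (?R\<^sup>2)"
      using direction_radius_sq[OF \<alpha>, of \<phi>] \<alpha> by (subst ln_le_cancel_iff) auto
    have "ln (?R\<^sup>2) = 2 * ln ?R" using direction_radius_sq(1)[OF \<alpha>, of \<phi>] by (simp add: ln_realpow)
    moreover have "0 \<le> ln (2::real)" by simp
    ultimately show ?thesis using u l by linarith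
  qed
  then show ?thesis
    by (intro integrable_const_bound[where B="\<bar>ln (1 - \<bar>\<alpha>\<bar>)\<bar> + ln 2"]) (auto simp: direction_radius_def[abs_def])
qed

lemma direction_proj_polar:
  assumes "d \<noteq> 0"
  shows "\<exists>\<theta>. (\<forall>\<phi>. direction_proj \<alpha> \<phi> d = cmod d * sin (\<phi> - \<theta>) / direction_radius \<alpha> \<phi>)
    \<and> cos (2 * \<theta>) = 1 - 2 * ((Re d)\<^sup>2 / (cmod d)\<^sup>2)"
proof -
  define t where "t = Arg d"
  have "d = rcis (cmod d) t" unfolding t_def by (simp add: rcis_cmod_Arg)
  then have re: "Re d = cmod d * cos t" and im: "Im d = cmod d * sin t"
    by (metis Re_rcis, metis Im_rcis)
  show ?thesis
  \<comment> \<open>The quarter turn rewrites cos(\<phi> - t) as a sine, the form in which the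
    logarithmic integral is available.\<close>
  proof (intro exI[of _ "t - pi / 2"] conjI allI)
    fix \<phi>
    have "\<phi> - (t - pi / 2) = pi / 2 - (t - \<phi>)" by simp
    then have "sin (\<phi> - (t - pi / 2)) = cos (t - \<phi>)" by (simp only: sin_diff[of "pi / 2"]) simp
    then have "cmod d * sin (\<phi> - (t - pi / 2)) = cos \<phi> * Re d + sin \<phi> * Im d"
      by (simp add: re im cos_diff algebra_simps)
    then show "direction_proj \<alpha> \<phi> d = cmod d * sin (\<phi> - (t - pi / 2)) / direction_radius \<alpha> \<phi>"
      by (simp add: direction_proj_def)
  next
    have "2 * (t - pi / 2) = 2 * t - pi" by simp
    then have "cos (2 * (t - pi / 2)) = - cos (2 * t)" by (simp add: cos_diff)
    also have "\<dots> = 1 - 2 * (cos t)\<^sup>2" by (simp add: cos_double_cos)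
    finally have *: "cos (2 * (t - pi / 2)) = 1 - 2 * (cos t)\<^sup>2" .
    have "(Re d)\<^sup>2 / (cmod d)\<^sup>2 = (cos t)\<^sup>2"
      unfolding re power_mult_distrib using assms by (simp add: power2_eq_square)
    then show "cos (2 * (t - pi / 2)) = 1 - 2 * ((Re d)\<^sup>2 / (cmod d)\<^sup>2)" using * by (simp only:)
  qed
qed

text \<open>Off the diagonal the logarithm of the projection splits into ln |d|, ln |sin(\<phi> -
  \<theta>)| and ln R, each with a known mean; on it both sides are infinite. Nonnegativity is
  inherited from \<open>gas_kernel\<close>, so \<open>energy_shift\<close> is an admissible constant
  for \<open>ereal_integral_shift\<close>.\<close>

lemma W_kernel_eq_average:
  assumes \<alpha>: "\<bar>\<alpha>\<bar> < 1"
  shows "(\<integral>\<^sup>+ \<phi>. gas_kernel (direction_proj \<alpha> \<phi> z) (direction_proj \<alpha> \<phi> w) \<partial>angle_law 1 \<alpha>)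
     = e2ennreal (W_kernel \<alpha> (z - w) + ereal (((cmod z)\<^sup>2 + (cmod w)\<^sup>2) / 2) + ereal (energy_shift \<alpha>))"
    and "0 \<le> W_kernel \<alpha> (z - w) + ereal (((cmod z)\<^sup>2 + (cmod w)\<^sup>2) / 2) + ereal (energy_shift \<alpha>)"
proof -
  let ?\<Theta> = "angle_law 1 \<alpha>" and ?p = "direction_proj \<alpha>" and ?R = "direction_radius \<alpha>"
  let ?rhs = "W_kernel \<alpha> (z - w) + ereal (((cmod z)\<^sup>2 + (cmod w)\<^sup>2) / 2) + ereal (energy_shift \<alpha>)"
  interpret prob_space ?\<Theta> using \<alpha> by (intro prob_space_angle_law) auto
  have "(\<integral>\<^sup>+ \<phi>. gas_kernel (?p \<phi> z) (?p \<phi> w) \<partial>?\<Theta>) = e2ennreal ?rhs \<and> 0 \<le> ?rhs"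
  proof (cases "z = w")
    case True
    then show ?thesis using emeasure_space_1
      by (simp add: gas_kernel_def W_kernel_def e2ennreal_infty ennreal_top_mult)
  next
    case False
    define d where "d = z - w"
    have d: "d \<noteq> 0" using False by (simp add: d_def)
    obtain \<theta> where p: "\<And>\<phi>. ?p \<phi> d = cmod d * sin (\<phi> - \<theta>) / ?R \<phi>"
      and c: "cos (2 * \<theta>) = 1 - 2 * ((Re d)\<^sup>2 / (cmod d)\<^sup>2)"
      using direction_proj_polar[OF d, of \<alpha>] by blast
    have "AE \<phi> in lborel. sin (1 * \<phi> + - \<theta>) \<noteq> 0" by (rule AE_sin_nonzero) simp
    then have s: "AE \<phi> in ?\<Theta>. sin (\<phi> - \<theta>) \<noteq> 0" by (intro AE_angle_lawI) simp
    have R: "0 < ?R \<phi>" for \<phi> by (rule direction_radius_sq(1)[OF \<alpha>])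
    define F where "F \<phi> = - ln \<bar>?p \<phi> z - ?p \<phi> w\<bar> + ((?p \<phi> z)\<^sup>2 + (?p \<phi> w)\<^sup>2)" for \<phi>
    let ?G = "\<lambda>\<phi>. (ln (?R \<phi>) - ln \<bar>sin (\<phi> - \<theta>)\<bar> - ln (cmod d)) + ((?p \<phi> z)\<^sup>2 + (?p \<phi> w)\<^sup>2)"
    let ?V = "- ln (cmod d) + \<alpha> * ((Re d)\<^sup>2 / (cmod d)\<^sup>2)"
    let ?I = "?V + ((cmod z)\<^sup>2 + (cmod w)\<^sup>2) / 2 + energy_shift \<alpha>"
    have cst: "has_bochner_integral ?\<Theta> (\<lambda>\<phi>. ln (cmod d)) (ln (cmod d))"
      unfolding has_bochner_integral_iff
      by (rule conjI[OF integrable_const]) (subst lebesgue_integral_const, use prob_space in simp)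
    have lnR: "has_bochner_integral ?\<Theta> (\<lambda>\<phi>. ln (?R \<phi>)) (\<integral>\<phi>. ln (?R \<phi>) \<partial>?\<Theta>)"
      using integrable_ln_direction_radius[OF \<alpha>] by (rule has_bochner_integral_integrable)
    have lns: "has_bochner_integral ?\<Theta> (\<lambda>\<phi>. ln \<bar>sin (\<phi> - \<theta>)\<bar>) (mean_ln_sin + \<alpha> * cos (2 * real 1 * \<theta>) / (2 * real 1))"
      using \<alpha> by (intro has_bochner_angle_law_ln_sin) auto
    have G: "has_bochner_integral ?\<Theta> ?G (((\<integral>\<phi>. ln (?R \<phi>) \<partial>?\<Theta>) - (mean_ln_sin + \<alpha> * cos (2 * real 1 * \<theta>) / (2 * real 1)) - ln (cmod d))
        + ((cmod z)\<^sup>2 / 2 + (cmod w)\<^sup>2 / 2))"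
      by (intro has_bochner_integral_add has_bochner_integral_diff lnR lns cst has_bochner_direction_proj_square \<alpha>)
    have val: "((\<integral>\<phi>. ln (?R \<phi>) \<partial>?\<Theta>) - (mean_ln_sin + \<alpha> * cos (2 * real 1 * \<theta>) / (2 * real 1)) - ln (cmod d))
        + ((cmod z)\<^sup>2 / 2 + (cmod w)\<^sup>2 / 2) = ?I"
      using c by (simp add: energy_shift_def right_diff_distrib add_divide_distrib diff_divide_distrib)
    have FG: "AE \<phi> in ?\<Theta>. ?G \<phi> = F \<phi>"
      using s
    proof eventually_elim
      case (elim \<phi>)
      have "\<bar>?p \<phi> z - ?p \<phi> w\<bar> = cmod d * \<bar>sin (\<phi> - \<theta>)\<bar> / ?R \<phi>"
        unfolding direction_proj_diff d_def[symmetric] p using R[of \<phi>] by (simp add: abs_mult)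
      then have "ln \<bar>?p \<phi> z - ?p \<phi> w\<bar> = ln (cmod d) + ln \<bar>sin (\<phi> - \<theta>)\<bar> - ln (?R \<phi>)"
        using R[of \<phi>] elim d by (simp add: ln_mult ln_div)
      then show ?case by (simp add: F_def)
    qed
    have Fm: "F \<in> borel_measurable ?\<Theta>"
      unfolding F_def[abs_def] direction_proj_def direction_radius_def by measurable
    have F: "has_bochner_integral ?\<Theta> F ?I"
      using G unfolding val by (rule has_bochner_integralI_AE[OF _ Fm FG])
    have F0: "0 \<le> F \<phi>" for \<phi> unfolding F_def by (rule gas_kernel_nonneg)
    have intF: "integrable ?\<Theta> F" and I_eq: "integral\<^sup>L ?\<Theta> F = ?I"
      using F unfolding has_bochner_integral_iff by (rule conjunct1, rule conjunct2)
    have I0: "0 \<le> ?I" unfolding I_eq[symmetric] using F0 by (intro integral_nonneg_AE) auto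
    have "(\<integral>\<^sup>+ \<phi>. gas_kernel (?p \<phi> z) (?p \<phi> w) \<partial>?\<Theta>) = (\<integral>\<^sup>+ \<phi>. ennreal (F \<phi>) \<partial>?\<Theta>)"
    proof (rule nn_integral_cong_AE)
      show "AE \<phi> in ?\<Theta>. gas_kernel (?p \<phi> z) (?p \<phi> w) = ennreal (F \<phi>)"
        using s
      proof eventually_elim
        case (elim \<phi>)
        have "?p \<phi> z - ?p \<phi> w \<noteq> 0"
          unfolding direction_proj_diff d_def[symmetric] p using R[of \<phi>] elim d by simp
        then show ?case by (simp add: gas_kernel_def F_def)
      qed
    qed
    also have "\<dots> = ennreal ?I"
      unfolding I_eq[symmetric] using F0 by (intro nn_integral_eq_integral intF) auto
    finally have "(\<integral>\<^sup>+ \<phi>. gas_kernel (?p \<phi> z) (?p \<phi> w) \<partial>?\<Theta>) = ennreal ?I" .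
    moreover have "?rhs = ereal ?I" using d by (simp add: W_kernel_def d_def)
    ultimately show ?thesis using I0 by (simp only: e2ennreal_ereal ereal_less_eq zero_ereal_def)
  qed
  then show "(\<integral>\<^sup>+ \<phi>. gas_kernel (?p \<phi> z) (?p \<phi> w) \<partial>?\<Theta>) = e2ennreal ?rhs" "0 \<le> ?rhs" by blast+
qed

lemma real_distribution_direction_proj:
  "prob_space \<nu> \<Longrightarrow> sets \<nu> = sets borel \<Longrightarrow> real_distribution (distr \<nu> borel (direction_proj \<alpha> \<phi>))"
  by (simp add: real_distribution_def real_distribution_axioms_def prob_space.prob_space_distr
    measurable_cong_sets[of \<nu> borel])

text \<open>Tonelli for the nonnegative kernel covers infinite energies too. The measurability in
  \<phi> allows equality of averages to be turned into equality for almost every direction.\<close>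

theorem energy_eq_average:
  assumes \<alpha>: "\<bar>\<alpha>\<bar> < 1" and \<nu>: "prob_space \<nu>" "sets \<nu> = sets borel"
  shows "(\<lambda>\<phi>. gas_energy (distr \<nu> borel (direction_proj \<alpha> \<phi>))) \<in> borel_measurable (angle_law 1 \<alpha>)"
    and "energy \<alpha> \<nu> = enn2ereal (\<integral>\<^sup>+ \<phi>. gas_energy (distr \<nu> borel (direction_proj \<alpha> \<phi>)) \<partial>angle_law 1 \<alpha>) - ereal (energy_shift \<alpha>)"
proof -
  let ?\<Theta> = "angle_law 1 \<alpha>" and ?p = "direction_proj \<alpha>"
  let ?f = "\<lambda>(z, w). W_kernel \<alpha> (z - w) + ereal (((cmod z)\<^sup>2 + (cmod w)\<^sup>2) / 2)"
  interpret N: prob_space \<nu> by fact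
  interpret T: prob_space ?\<Theta> using \<alpha> by (intro prob_space_angle_law) auto
  interpret P: pair_prob_space \<nu> \<nu> ..
  interpret Q: pair_sigma_finite "\<nu> \<Otimes>\<^sub>M \<nu>" ?\<Theta> ..
  note [measurable_cong] = \<nu>(2)
  have p_meas [measurable]: "?p \<phi> \<in> borel_measurable \<nu>" for \<phi>
    using direction_proj_borel by (simp add: measurable_cong_sets[OF \<nu>(2) refl])
  have k_meas: "(\<lambda>(x, \<phi>). gas_kernel (?p \<phi> (fst x)) (?p \<phi> (snd x))) \<in> borel_measurable ((\<nu> \<Otimes>\<^sub>M \<nu>) \<Otimes>\<^sub>M ?\<Theta>)"
    unfolding direction_proj_def direction_radius_def by measurable
  have ge: "gas_energy (distr \<nu> borel (?p \<phi>)) = (\<integral>\<^sup>+ x. gas_kernel (?p \<phi> (fst x)) (?p \<phi> (snd x)) \<partial>(\<nu> \<Otimes>\<^sub>M \<nu>))" for \<phi>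
  proof -
    interpret D: real_distribution "distr \<nu> borel (?p \<phi>)" by (rule real_distribution_direction_proj[OF \<nu>])
    have "sigma_finite_measure (distr \<nu> borel (?p \<phi>))" by unfold_locales
    then have "distr \<nu> borel (?p \<phi>) \<Otimes>\<^sub>M distr \<nu> borel (?p \<phi>)
       = distr (\<nu> \<Otimes>\<^sub>M \<nu>) (borel \<Otimes>\<^sub>M borel) (\<lambda>(x, y). (?p \<phi> x, ?p \<phi> y))"
      by (intro pair_measure_distr p_meas)
    then show ?thesis
      unfolding gas_energy_def by (simp add: nn_integral_distr case_prod_beta)
  qed
  show "(\<lambda>\<phi>. gas_energy (distr \<nu> borel (?p \<phi>))) \<in> borel_measurable ?\<Theta>"
    unfolding ge using k_meas by (intro P.P.borel_measurable_nn_integral) auto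
  have f_meas: "?f \<in> borel_measurable (\<nu> \<Otimes>\<^sub>M \<nu>)" by measurable
  have f0: "0 \<le> ?f x + ereal (energy_shift \<alpha>)" for x
    using W_kernel_eq_average(2)[OF \<alpha>] by (cases x) simp
  have P: "prob_space (\<nu> \<Otimes>\<^sub>M \<nu>)" by (rule P.P.prob_space_axioms)
  have "energy \<alpha> \<nu> = enn2ereal (\<integral>\<^sup>+ x. e2ennreal (?f x + ereal (energy_shift \<alpha>)) \<partial>(\<nu> \<Otimes>\<^sub>M \<nu>)) - ereal (energy_shift \<alpha>)"
    unfolding energy_def by (rule ereal_integral_shift[OF P f_meas f0])
  also have "(\<integral>\<^sup>+ x. e2ennreal (?f x + ereal (energy_shift \<alpha>)) \<partial>(\<nu> \<Otimes>\<^sub>M \<nu>))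
      = (\<integral>\<^sup>+ x. \<integral>\<^sup>+ \<phi>. gas_kernel (?p \<phi> (fst x)) (?p \<phi> (snd x)) \<partial>?\<Theta> \<partial>(\<nu> \<Otimes>\<^sub>M \<nu>))"
    by (simp only: W_kernel_eq_average(1)[OF \<alpha>] case_prod_beta)
  also have "\<dots> = (\<integral>\<^sup>+ \<phi>. gas_energy (distr \<nu> borel (?p \<phi>)) \<partial>?\<Theta>)"
    unfolding ge by (rule Q.Fubini'[OF k_meas, symmetric])
  finally show "energy \<alpha> \<nu> = enn2ereal (\<integral>\<^sup>+ \<phi>. gas_energy (distr \<nu> borel (?p \<phi>)) \<partial>?\<Theta>) - ereal (energy_shift \<alpha>)" .
qed

section \<open>From almost every direction to every frequency\<close>

lemma continuous_on_integral_bounded: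
  fixes h :: "real \<Rightarrow> complex \<Rightarrow> real"
  assumes \<nu>: "prob_space \<nu>" "sets \<nu> = sets borel"
    and h: "\<And>x. h x \<in> borel_measurable borel" "\<And>x z. \<bar>h x z\<bar> \<le> 1" "\<And>z. continuous_on UNIV (\<lambda>x. h x z)"
  shows "continuous_on UNIV (\<lambda>x. \<integral>z. h x z \<partial>\<nu>)"
proof -
  interpret prob_space \<nu> by fact
  have m: "h x \<in> borel_measurable \<nu>" for x using h(1) by (simp add: measurable_cong_sets[OF \<nu>(2) refl])
  have "isCont (\<lambda>x. \<integral>z. h x z \<partial>\<nu>) t" for t
    unfolding continuous_at_sequentially
  proof safe
    fix X assume X: "X \<longlonglongrightarrow> t"
    show "((\<lambda>x. \<integral>z. h x z \<partial>\<nu>) \<circ> X) \<longlonglongrightarrow> (\<integral>z. h t z \<partial>\<nu>)"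
      unfolding comp_def
    proof (rule integral_dominated_convergence[where w="\<lambda>_. 1"])
      show "AE z in \<nu>. (\<lambda>n. h (X n) z) \<longlonglongrightarrow> h t z"
      proof (rule AE_I2)
        fix z
        have "isCont (\<lambda>x. h x z) t" using h(3)[of z] by (simp add: continuous_on_eq_continuous_at)
        then show "(\<lambda>n. h (X n) z) \<longlonglongrightarrow> h t z" using X by (rule isCont_tendsto_compose)
      qed
    qed (use m h(2) in auto)
  qed
  then show ?thesis by (simp add: continuous_on_eq_continuous_at)
qed

text \<open>The angular law lives on [0, pi], so frequencies in the lower half-plane are reached
  with a negative \<xi>.\<close>

lemma half_plane_polar:
  fixes a b :: real
  obtains \<xi> \<phi> where "0 \<le> \<phi>" "\<phi> \<le> pi" "a = \<xi> * cos \<phi>" "b = \<xi> * sin \<phi>"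
proof -
  have *: "\<exists>\<xi> \<phi>. 0 \<le> \<phi> \<and> \<phi> \<le> pi \<and> a = \<xi> * cos \<phi> \<and> b = \<xi> * sin \<phi>" if "0 \<le> b" for a b :: real
  proof -
    let ?t = "Arg (Complex a b)"
    have e: "Complex a b = rcis (cmod (Complex a b)) ?t" by (simp add: rcis_cmod_Arg)
    then have "a = cmod (Complex a b) * cos ?t" "b = cmod (Complex a b) * sin ?t"
      by (metis Re_rcis complex.sel(1), metis Im_rcis complex.sel(2))
    moreover have "?t \<le> pi" by (rule Arg_le_pi)
    moreover have "0 \<le> ?t \<or> cmod (Complex a b) = 0"
    proof (rule ccontr)
      assume n: "\<not> (0 \<le> ?t \<or> cmod (Complex a b) = 0)"
      then have "0 < sin (- ?t)" using mpi_less_Arg[of "Complex a b"] by (intro sin_gt_zero) auto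
      then have "cmod (Complex a b) * sin ?t < 0" using n by (intro mult_pos_neg) auto
      with calculation(2) that show False by linarith
    qed
    ultimately show ?thesis
      by (metis mult_zero_left order_refl pi_ge_zero)
  qed
  show thesis
  proof (cases "0 \<le> b")
    case True
    then show ?thesis using *[of b a] that by blast
  next
    case False
    then obtain \<xi> \<phi> where "0 \<le> \<phi>" "\<phi> \<le> pi" "- a = \<xi> * cos \<phi>" "- b = \<xi> * sin \<phi>" using *[of "- b" "- a"] by auto
    then show ?thesis by (intro that[of \<phi> "- \<xi>"]) auto
  qed
qed

text \<open>Undoing the normalisation by R expresses each plane wave through one projection. Its
  integral is continuous in \<phi>, so agreement at almost every angle extends to all of (0, pi),
  then to the closure.\<close>

lemma measure_eqI_AE_direction_proj:
  assumes \<alpha>: "\<bar>\<alpha>\<bar> < 1" and \<nu>: "prob_space \<nu>" "sets \<nu> = sets borel" and \<mu>: "prob_space \<mu>" "sets \<mu> = sets borel"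
    and AE: "AE \<phi> in angle_law 1 \<alpha>. distr \<nu> borel (direction_proj \<alpha> \<phi>) = distr \<mu> borel (direction_proj \<alpha> \<phi>)"
  shows "\<nu> = \<mu>"
proof -
  have AE2: "AE \<phi> in lborel. \<phi> \<in> {0<..<pi} \<longrightarrow> distr \<nu> borel (direction_proj \<alpha> \<phi>) = distr \<mu> borel (direction_proj \<alpha> \<phi>)"
  proof -
    have pos: "0 < ennreal (on_period (\<lambda>x. (1 - \<alpha> * cos (2 * real 1 * x)) / pi) \<phi>)" if "\<phi> \<in> {0<..<pi}" for \<phi>
    proof -
      have "0 < 1 - \<alpha> * cos (2 * \<phi>)"
        using direction_radius_sq[OF \<alpha>, of \<phi>] \<alpha> by linarith
      then show ?thesis using that by (simp add: on_period_def)
    qed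
    from AE have "AE \<phi> in lborel. 0 < ennreal (on_period (\<lambda>x. (1 - \<alpha> * cos (2 * real 1 * x)) / pi) \<phi>) \<longrightarrow>
        distr \<nu> borel (direction_proj \<alpha> \<phi>) = distr \<mu> borel (direction_proj \<alpha> \<phi>)"
      unfolding angle_law_def by (subst (asm) AE_density) auto
    then show ?thesis by eventually_elim (use pos in blast)
  qed
  have trig: "(\<integral>z. g (\<xi> * cos \<phi> * Re z + \<xi> * sin \<phi> * Im z) \<partial>\<nu>) = (\<integral>z. g (\<xi> * cos \<phi> * Re z + \<xi> * sin \<phi> * Im z) \<partial>\<mu>)"
    if g: "continuous_on UNIV g" "\<And>x. \<bar>g x\<bar> \<le> 1" and \<phi>: "0 \<le> \<phi>" "\<phi> \<le> pi" for g :: "real \<Rightarrow> real" and \<xi> \<phi>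
  proof -
    have [measurable]: "g \<in> borel_measurable borel" using g(1) by (rule borel_measurable_continuous_onI)
    let ?h = "\<lambda>\<phi> z. g (\<xi> * cos \<phi> * Re z + \<xi> * sin \<phi> * Im z)"
    let ?C = "{\<phi>. (\<integral>z. ?h \<phi> z \<partial>\<nu>) = (\<integral>z. ?h \<phi> z \<partial>\<mu>)}"
    have cont: "continuous_on UNIV (\<lambda>\<phi>. \<integral>z. ?h \<phi> z \<partial>M)" if "prob_space M" "sets M = sets borel" for M
      using g by (intro continuous_on_integral_bounded[OF that]) (auto intro!: continuous_on_compose2[OF g(1)] continuous_intros)
    have closed: "closed ?C"
      by (intro closed_Collect_eq cont \<nu> \<mu>)
    have meas: "direction_proj \<alpha> \<phi> \<in> borel_measurable M" if "sets M = sets borel" for M \<phi>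
      using direction_proj_borel by (simp add: measurable_cong_sets[OF that refl])
    have distr: "(\<integral>z. ?h \<phi> z \<partial>M) = (\<integral>t. g (\<xi> * direction_radius \<alpha> \<phi> * t) \<partial>distr M borel (direction_proj \<alpha> \<phi>))" if "sets M = sets borel" for M \<phi>
    proof -
      have "\<xi> * cos \<phi> * Re z + \<xi> * sin \<phi> * Im z = \<xi> * direction_radius \<alpha> \<phi> * direction_proj \<alpha> \<phi> z" for z
      proof -
        have "\<xi> * r * (X / r) = \<xi> * X" if "0 < r" for r X :: real using that by simp
        from this[OF direction_radius_sq(1)[OF \<alpha>]] show ?thesis
          by (simp only: direction_proj_def distrib_left mult.assoc)
      qed
      then show ?thesis using meas[OF that] by (subst integral_distr) auto
    qed
    have "AE \<phi> in lborel. \<phi> \<in> {0<..<pi} \<longrightarrow> \<phi> \<in> ?C"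
      using AE2 by eventually_elim (auto simp: distr \<nu> \<mu>)
    then have "AE \<phi>\<in>{0<..<pi} in lebesgue. \<phi> \<in> ?C" by (rule AE_completion)
    then have "{0<..<pi} \<subseteq> ?C"
      using mem_closed_if_AE_lebesgue_open[OF open_greaterThanLessThan closed] by blast
    then have "closure {0<..<pi} \<subseteq> ?C" using closed by (rule closure_minimal)
    then show ?thesis using \<phi> by (auto simp: closure_greaterThanLessThan)
  qed
  show ?thesis
  proof (rule complex_measure_eqI_trig[OF \<nu> \<mu>])
    fix a b :: real
    obtain \<xi> \<phi> where "0 \<le> \<phi>" "\<phi> \<le> pi" and ab: "a = \<xi> * cos \<phi>" "b = \<xi> * sin \<phi>" by (rule half_plane_polar)
    then show "(\<integral>z. cos (a * Re z + b * Im z) \<partial>\<nu>) = (\<integral>z. cos (a * Re z + b * Im z) \<partial>\<mu>)"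
      "(\<integral>z. sin (a * Re z + b * Im z) \<partial>\<nu>) = (\<integral>z. sin (a * Re z + b * Im z) \<partial>\<mu>)"
      unfolding ab by (intro trig; auto intro!: continuous_intros)+
  qed
qed

text \<open>Finiteness of \<open>j\<close> permits the subtraction, and the nonnegative excess
  \<open>g - j\<close> has integral 0.\<close>

lemma AE_le_if_nn_integral_le:
  assumes M: "prob_space M" and g [measurable]: "g \<in> borel_measurable M" and ge: "\<And>x. j \<le> g x"
    and le: "(\<integral>\<^sup>+ x. g x \<partial>M) \<le> j" and fin: "j < \<infinity>"
  shows "AE x in M. g x \<le> (j::ennreal)"
proof -
  interpret prob_space M by fact
  have j: "(\<integral>\<^sup>+ x. j \<partial>M) = j" by (simp add: emeasure_space_1)
  have "(\<integral>\<^sup>+ x. g x - j \<partial>M) = (\<integral>\<^sup>+ x. g x \<partial>M) - (\<integral>\<^sup>+ x. j \<partial>M)"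
    using fin ge by (intro nn_integral_diff) (auto simp: j emeasure_space_1)
  also have "\<dots> = 0" unfolding j using le le_less_trans[OF le fin] by (simp add: diff_eq_0_iff_ennreal)
  finally have "AE x in M. g x - j = 0" by (subst (asm) nn_integral_0_iff_AE) auto
  then show ?thesis by eventually_elim (use fin in \<open>auto simp: diff_eq_0_iff_ennreal\<close>)
qed

theorem mainTheorem1:
  fixes \<alpha> :: real
  assumes "-1 < \<alpha>" and "\<alpha> < 1"
  shows "(\<exists>!\<mu>. is_arg_min (energy \<alpha>) borel_prob \<mu>) \<and>
         is_arg_min (energy \<alpha>) borel_prob (uniform_measure lborel (ellipse_domain \<alpha>))"
proof -
  have \<alpha>: "\<bar>\<alpha>\<bar> < 1" using assms by auto
  let ?\<mu> = "uniform_measure lborel (ellipse_domain \<alpha>)" and ?\<Theta> = "angle_law 1 \<alpha>"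
  let ?j = "gas_energy semicircle" and ?C = "ereal (energy_shift \<alpha>)"
  let ?g = "\<lambda>\<nu> \<phi>. gas_energy (distr \<nu> borel (direction_proj \<alpha> \<phi>))"
  have \<Theta>: "prob_space ?\<Theta>" using \<alpha> by (intro prob_space_angle_law) auto
  interpret T: prob_space ?\<Theta> by (rule \<Theta>)
  have \<mu>: "prob_space ?\<mu>" "sets ?\<mu> = sets borel"
    using assms by (auto intro!: prob_space_uniform_measure simp: emeasure_ellipse_domain[OF \<alpha>])
  \<comment> \<open>This sine is cos \<phi>: the vertical direction, where fibres cannot be
    parametrised by y, is a null set.\<close>
  have "AE \<phi> in lborel. sin (1 * \<phi> + pi / 2) \<noteq> 0" by (rule AE_sin_nonzero) simp
  then have "AE \<phi> in ?\<Theta>. sin (1 * \<phi> + pi / 2) \<noteq> 0" by (rule AE_angle_lawI)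
  then have proj_\<mu>: "AE \<phi> in ?\<Theta>. distr ?\<mu> borel (direction_proj \<alpha> \<phi>) = semicircle"
    by eventually_elim (rule distr_ellipse_proj[OF \<alpha>], simp add: sin_add)
  have "(\<integral>\<^sup>+ \<phi>. ?g ?\<mu> \<phi> \<partial>?\<Theta>) = (\<integral>\<^sup>+ \<phi>. ?j \<partial>?\<Theta>)"
    by (rule nn_integral_cong_AE) (use proj_\<mu> in eventually_elim, simp)
  then have e\<mu>: "energy \<alpha> ?\<mu> = enn2ereal ?j - ?C"
    using energy_eq_average(2)[OF \<alpha> \<mu>] T.emeasure_space_1 by simp
  have ge: "?j \<le> ?g \<nu> \<phi>" if "borel_prob \<nu>" for \<nu> \<phi>
    using that by (intro gas_energy_ge_semicircle real_distribution_direction_proj) (auto simp: borel_prob_def)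
  have min: "energy \<alpha> ?\<mu> \<le> energy \<alpha> \<nu>" if \<nu>: "borel_prob \<nu>" for \<nu>
  proof -
    have "(\<integral>\<^sup>+ \<phi>. ?j \<partial>?\<Theta>) \<le> (\<integral>\<^sup>+ \<phi>. ?g \<nu> \<phi> \<partial>?\<Theta>)"
      by (intro nn_integral_mono ge \<nu>)
    then have "?j \<le> (\<integral>\<^sup>+ \<phi>. ?g \<nu> \<phi> \<partial>?\<Theta>)" using T.emeasure_space_1 by simp
    then show ?thesis using \<nu>
      by (auto simp: e\<mu> energy_eq_average(2)[OF \<alpha>] borel_prob_def less_eq_ennreal.rep_eq intro!: ereal_minus_mono)
  qed
  have arg_min: "is_arg_min (energy \<alpha>) borel_prob ?\<mu>"
    unfolding is_arg_min_def using \<mu> min by (auto simp: borel_prob_def not_less)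
  moreover have "\<nu> = ?\<mu>" if "is_arg_min (energy \<alpha>) borel_prob \<nu>" for \<nu>
  proof -
    have bp: "borel_prob \<nu>" and "\<not> energy \<alpha> ?\<mu> < energy \<alpha> \<nu>"
      using that arg_min by (auto simp: is_arg_min_def)
    then have le: "energy \<alpha> \<nu> \<le> energy \<alpha> ?\<mu>" by (simp add: not_less)
    have \<nu>: "prob_space \<nu>" "sets \<nu> = sets borel" using bp by (auto simp: borel_prob_def)
    have "enn2ereal (\<integral>\<^sup>+ \<phi>. ?g \<nu> \<phi> \<partial>?\<Theta>) - ?C \<le> enn2ereal ?j - ?C"
      using le unfolding e\<mu> energy_eq_average(2)[OF \<alpha> \<nu>] .
    \<comment> \<open>Subtracting a finite constant reflects the order even at infinite
      values.\<close>
    moreover have "x \<le> y" if "x - ereal c \<le> y - ereal c" for x y c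
      using that by (cases x; cases y) auto
    ultimately have "enn2ereal (\<integral>\<^sup>+ \<phi>. ?g \<nu> \<phi> \<partial>?\<Theta>) \<le> enn2ereal ?j" by blast
    then have "(\<integral>\<^sup>+ \<phi>. ?g \<nu> \<phi> \<partial>?\<Theta>) \<le> ?j" by (simp add: less_eq_ennreal.rep_eq)
    then have "AE \<phi> in ?\<Theta>. ?g \<nu> \<phi> \<le> ?j"
      by (intro AE_le_if_nn_integral_le[OF \<Theta> energy_eq_average(1)[OF \<alpha> \<nu>] ge[OF bp] _ gas_energy_semicircle_finite])
    then have "AE \<phi> in ?\<Theta>. distr \<nu> borel (direction_proj \<alpha> \<phi>) = distr ?\<mu> borel (direction_proj \<alpha> \<phi>)"
      using proj_\<mu>
    proof eventually_elim
      case (elim \<phi>)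
      have "distr \<nu> borel (direction_proj \<alpha> \<phi>) = semicircle"
        by (rule gas_energy_unique[OF real_distribution_direction_proj[OF \<nu>] elim(1)])
      with elim(2) show ?case by simp
    qed
    then show ?thesis by (rule measure_eqI_AE_direction_proj[OF \<alpha> \<nu> \<mu>])
  qed
  ultimately show ?thesis by blast
qed

end
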